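(* (1) Let $X$ be a linearly ordered compact ultrametric space with a small similarity structure $\mathrm{Sim}_X$. Then $\Gamma(\mathrm{Sim}_X)\cong D_b(\mathcal P_{\mathrm{Sim}_X},[X])$. (2) Conversely, if $\mathcal P=\langle\Sigma\mid\mathcal R\rangle$ is a tree-like semigroup presentation and $x\in\Sigma$, then there exist a linearly ordered compact ultrametric space $X_{\mathcal P}$ and a small similarity structure $\mathrm{Sim}_{X_{\mathcal P}}$ on it such that $D_b(\mathcal P,x)\cong\Gamma(\mathrm{Sim}_{X_{\mathcal P}})$.
   Context: Balls in a compact ultrametric space $X$ are closed metric balls of positive radius ($X$ itself is a ball). A *finite similarity structure* $\mathrm{Sim}_X$ assigns to each ordered pair of balls $B_1,B_2$ a finite (possibly empty) set $\mathrm{Sim}_X(B_1,B_2)$ of surjective similarities $B_1\to B_2$, closed under identities, inverses, compositions and restrictions to sub-balls. $\Gamma(\mathrm{Sim}_X)$ is the group of homeomorphisms $g$ of $X$ such that every point lies in a ball $B$ with $g(B)$ a ball and $g|_B\in\mathrm{Sim}_X(B,g(B))$. $[B]$ is the class of $B$ under $A\sim B\iff\mathrm{Sim}_X(A,B)\ne\emptyset$. A *linearly ordered ultrametric space* is an ultrametric space with a linear order such that whenever $B_1,B_2$ are disjoint balls and some point of $B_1$ is less than some point of $B_2$, every point of $B_1$ is less than every point of $B_2$. A finite similarity structure on a linearly ordered compact ultrametric space is *small* if $|\mathrm{Sim}_X(B_1,B_2)|\le1$ for all balls and every element of each $\mathrm{Sim}_X(B_1,B_2)$ is order-preserving. $\mathcal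 P_{\mathrm{Sim}_X}=\langle\Sigma\mid\mathcal R\rangle$ has alphabet $\Sigma=\{[B]: B\text{ a ball}\}$ and relations $([B],[B_1][B_2]\cdots[B_n])$ for every ball $B$ having $n\ge1$ maximal proper sub-balls $B_1<\dots<B_n$ (listed in order). A *semigroup presentation* $\langle\Sigma\mid\mathcal R\rangle$ consists of a set $\Sigma$ and $\mathcal R\subseteq\Sigma^+\times\Sigma^+$ (non-empty words). It is *tree-like* if every $(w_1,w_2)\in\mathcal R$ has $|w_1|=1$, $|w_2|>1$, and $(a,w_1),(a,w_2)\in\mathcal R$ implies $w_1=w_2$. *Braided diagrams over $\mathcal P$*: take a frame $\partial[0,1]^2$ (with top, bottom, left-to-right order), a finite set of *transistors* (copies of $[0,1]^2$ with top, bottom, left-to-right orders), and a finite non-empty set of *wires* (copies of $[0,1]$) each labelled by a letter of $\Sigma$. The top end of each wire $W$ is attached to a point $t(W)$ on the bottom of a transistor or on the top of the frame, and its bottom end to a point $b(W)$ on the top of a transistor or on the bottom of the frame, all attachment points distinct. Reading labels of wires attached along the top (resp. bottom) of a transistor $T$ from left to right gives its top label $\ell_t(T)$ (resp. bottom label $\ell_b(T)$); require $(\ell_t(T),\ell_b(T))\in\mathcal R$ or $(\ell_b(T),\ell_t(T))\in\mathcal R$. Write $T_1\preceq T_2$ if some wire has $t(W)\in T_2$ and $b(W)\in T_1$; require the transitive closure of $\preceq$ to be a strict partial order. The top/bottom labels of the diagram are read along the top/bottom of the frame; a $(u,w)$-diagram has top label $u$, bottom label $w$. Two diagrams are equivalent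 if there is a homeomorphism between them preserving labels, frames, tops/bottoms and left-to-right orders. Concatenation $\Delta_1\circ\Delta_2$ of a $(w_1,w_2)$-diagram and a $(w_2,w_3)$-diagram glues the wires at the bottom of $\Delta_1$'s frame to those at the top of $\Delta_2$'s frame in order. A *dipole* is a pair $T_1\,\dot\preceq\,T_2$ such that $\ell_b(T_1)=\ell_t(T_2)$ and the wires attached to the bottom of $T_2$ are, in order, exactly the wires attached to the top of $T_1$; reducing it deletes $T_1,T_2$ and these wires and glues, in order, the wires on top of $T_2$ to the wires at the bottom of $T_1$; the inverse operation inserts a dipole. $D_b(\mathcal P,w)$ is the group of $(w,w)$-diagrams modulo equivalence and insertion/removal of dipoles, under concatenation (the *braided diagram group* ). *)

theory Defs
  imports "HOL-Analysis.Analysis" "HOL-Algebra.Group" "HOL-Library.FuncSet"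
begin

definition ultrametric :: "'p set \<Rightarrow> ('p \<Rightarrow> 'p \<Rightarrow> real) \<Rightarrow> bool" where
  "ultrametric X d \<longleftrightarrow> Metric_space X d \<and>
     (\<forall>x\<in>X. \<forall>y\<in>X. \<forall>z\<in>X. d x z \<le> max (d x y) (d y z))"

definition compact_ultrametric :: "'p set \<Rightarrow> ('p \<Rightarrow> 'p \<Rightarrow> real) \<Rightarrow> bool" where
  "compact_ultrametric X d \<longleftrightarrow> ultrametric X d \<and>
     compact_space (Metric_space.mtopology X d)"

definition balls :: "'p set \<Rightarrow> ('p \<Rightarrow> 'p \<Rightarrow> real) \<Rightarrow> 'p set set" where
  "balls X d = {Metric_space.mcball X d x r | x r. x \<in> X \<and> r > 0}"

definition strict_less :: "('p \<times> 'p) set \<Rightarrow> 'p \<Rightarrow> 'p \<Rightarrow> bool" where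
  "strict_less L x y \<longleftrightarrow> (x, y) \<in> L \<and> x \<noteq> y"

definition lin_ordered_ultrametric ::
  "'p set \<Rightarrow> ('p \<Rightarrow> 'p \<Rightarrow> real) \<Rightarrow> ('p \<times> 'p) set \<Rightarrow> bool" where
  "lin_ordered_ultrametric X d L \<longleftrightarrow> ultrametric X d \<and> linear_order_on X L \<and>
     (\<forall>B1\<in>balls X d. \<forall>B2\<in>balls X d. B1 \<inter> B2 = {} \<longrightarrow>
        (\<exists>x\<in>B1. \<exists>y\<in>B2. strict_less L x y) \<longrightarrow>
        (\<forall>x\<in>B1. \<forall>y\<in>B2. strict_less L x y))"

text \<open>Maps between balls are represented extensionally (value undefined outside
  the domain ball), so that a set of maps B1 \<rightarrow> B2 is a set of functions.\<close>

definition surj_similarity ::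
  "('p \<Rightarrow> 'p \<Rightarrow> real) \<Rightarrow> 'p set \<Rightarrow> 'p set \<Rightarrow> ('p \<Rightarrow> 'p) \<Rightarrow> bool" where
  "surj_similarity d B1 B2 f \<longleftrightarrow> f \<in> extensional B1 \<and> f ` B1 = B2 \<and>
     (\<exists>c>0. \<forall>x\<in>B1. \<forall>y\<in>B1. d (f x) (f y) = c * d x y)"

definition finite_sim_structure ::
  "'p set \<Rightarrow> ('p \<Rightarrow> 'p \<Rightarrow> real) \<Rightarrow> ('p set \<Rightarrow> 'p set \<Rightarrow> ('p \<Rightarrow> 'p) set) \<Rightarrow> bool" where
  "finite_sim_structure X d Sim \<longleftrightarrow>
     (\<forall>B1\<in>balls X d. \<forall>B2\<in>balls X d.
        finite (Sim B1 B2) \<and> (\<forall>f\<in>Sim B1 B2. surj_similarity d B1 B2 f)) \<and>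
     (\<forall>B\<in>balls X d. restrict id B \<in> Sim B B) \<and>
     (\<forall>B1\<in>balls X d. \<forall>B2\<in>balls X d. \<forall>f\<in>Sim B1 B2.
        restrict (inv_into B1 f) B2 \<in> Sim B2 B1) \<and>
     (\<forall>B1\<in>balls X d. \<forall>B2\<in>balls X d. \<forall>B3\<in>balls X d. \<forall>f\<in>Sim B1 B2. \<forall>g\<in>Sim B2 B3.
        restrict (g \<circ> f) B1 \<in> Sim B1 B3) \<and>
     (\<forall>B1\<in>balls X d. \<forall>B2\<in>balls X d. \<forall>f\<in>Sim B1 B2. \<forall>B\<in>balls X d. B \<subseteq> B1 \<longrightarrow>
        restrict f B \<in> Sim B (f ` B))"

definition small_sim_structure ::
  "'p set \<Rightarrow> ('p \<Rightarrow> 'p \<Rightarrow> real) \<Rightarrow> ('p \<times> 'p) set \<Rightarrow>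
   ('p set \<Rightarrow> 'p set \<Rightarrow> ('p \<Rightarrow> 'p) set) \<Rightarrow> bool" where
  "small_sim_structure X d L Sim \<longleftrightarrow>
     lin_ordered_ultrametric X d L \<and> compact_space (Metric_space.mtopology X d) \<and>
     finite_sim_structure X d Sim \<and>
     (\<forall>B1\<in>balls X d. \<forall>B2\<in>balls X d. card (Sim B1 B2) \<le> 1 \<and>
        (\<forall>f\<in>Sim B1 B2. \<forall>x\<in>B1. \<forall>y\<in>B1. (x, y) \<in> L \<longrightarrow> (f x, f y) \<in> L))"

definition Gamma_set ::
  "'p set \<Rightarrow> ('p \<Rightarrow> 'p \<Rightarrow> real) \<Rightarrow> ('p set \<Rightarrow> 'p set \<Rightarrow> ('p \<Rightarrow> 'p) set) \<Rightarrow> ('p \<Rightarrow> 'p) set" where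
  "Gamma_set X d Sim = {g. g \<in> extensional X \<and> g ` X \<subseteq> X \<and>
     homeomorphic_map (Metric_space.mtopology X d) (Metric_space.mtopology X d) g \<and>
     (\<forall>x\<in>X. \<exists>B\<in>balls X d. x \<in> B \<and> g ` B \<in> balls X d \<and>
        restrict g B \<in> Sim B (g ` B))}"

definition Gamma ::
  "'p set \<Rightarrow> ('p \<Rightarrow> 'p \<Rightarrow> real) \<Rightarrow> ('p set \<Rightarrow> 'p set \<Rightarrow> ('p \<Rightarrow> 'p) set) \<Rightarrow> ('p \<Rightarrow> 'p) monoid" where
  "Gamma X d Sim = \<lparr>carrier = Gamma_set X d Sim,
      mult = (\<lambda>g h. restrict (g \<circ> h) X), one = restrict id X\<rparr>"

definition sim_rel ::
  "'p set \<Rightarrow> ('p \<Rightarrow> 'p \<Rightarrow> real) \<Rightarrow> ('p set \<Rightarrow> 'p set \<Rightarrow> ('p \<Rightarrow> 'p) set) \<Rightarrow> ('p set \<times> 'p set) set" where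
  "sim_rel X d Sim = {(A, B). A \<in> balls X d \<and> B \<in> balls X d \<and> Sim A B \<noteq> {}}"

definition ball_class ::
  "'p set \<Rightarrow> ('p \<Rightarrow> 'p \<Rightarrow> real) \<Rightarrow> ('p set \<Rightarrow> 'p set \<Rightarrow> ('p \<Rightarrow> 'p) set) \<Rightarrow> 'p set \<Rightarrow> 'p set set" where
  "ball_class X d Sim B = sim_rel X d Sim `` {B}"

definition sim_alphabet ::
  "'p set \<Rightarrow> ('p \<Rightarrow> 'p \<Rightarrow> real) \<Rightarrow> ('p set \<Rightarrow> 'p set \<Rightarrow> ('p \<Rightarrow> 'p) set) \<Rightarrow> 'p set set set" where
  "sim_alphabet X d Sim = ball_class X d Sim ` balls X d"

definition max_proper_subballs :: "'p set \<Rightarrow> ('p \<Rightarrow> 'p \<Rightarrow> real) \<Rightarrow> 'p set \<Rightarrow> 'p set set" where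
  "max_proper_subballs X d B = {B'. B' \<in> balls X d \<and> B' \<subset> B \<and>
      \<not> (\<exists>C\<in>balls X d. B' \<subset> C \<and> C \<subset> B)}"

definition ball_less :: "('p \<times> 'p) set \<Rightarrow> 'p set \<Rightarrow> 'p set \<Rightarrow> bool" where
  "ball_less L B1 B2 \<longleftrightarrow> (\<forall>x\<in>B1. \<forall>y\<in>B2. strict_less L x y)"

definition sim_relations ::
  "'p set \<Rightarrow> ('p \<Rightarrow> 'p \<Rightarrow> real) \<Rightarrow> ('p \<times> 'p) set \<Rightarrow> ('p set \<Rightarrow> 'p set \<Rightarrow> ('p \<Rightarrow> 'p) set)
    \<Rightarrow> ('p set set list \<times> 'p set set list) set" where
  "sim_relations X d L Sim = {([ball_class X d Sim B], map (ball_class X d Sim) bs) | B bs.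
      B \<in> balls X d \<and> bs \<noteq> [] \<and> set bs = max_proper_subballs X d B \<and>
      sorted_wrt (ball_less L) bs}"

definition semigroup_presentation :: "'a set \<Rightarrow> ('a list \<times> 'a list) set \<Rightarrow> bool" where
  "semigroup_presentation S R \<longleftrightarrow>
     (\<forall>(u, v)\<in>R. u \<noteq> [] \<and> v \<noteq> [] \<and> set u \<subseteq> S \<and> set v \<subseteq> S)"

definition tree_like :: "('a list \<times> 'a list) set \<Rightarrow> bool" where
  "tree_like R \<longleftrightarrow> (\<forall>(u, v)\<in>R. length u = 1 \<and> length v > 1) \<and>
     (\<forall>a w1 w2. ([a], w1) \<in> R \<longrightarrow> ([a], w2) \<in> R \<longrightarrow> w1 = w2)"

text \<open>Transistors and wires are named by natural numbers (finite sets trs, wrs).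
  ftop / fbot: wires attached to the top / bottom of the frame, left to right.
  ttop t: wires whose bottom end is attached to the top of transistor t, left to right.
  tbot t: wires whose top end is attached to the bottom of transistor t, left to right.\<close>

record 'a bdiag =
  trs :: "nat set"
  wrs :: "nat set"
  lab :: "nat \<Rightarrow> 'a"
  ftop :: "nat list"
  fbot :: "nat list"
  ttop :: "nat \<Rightarrow> nat list"
  tbot :: "nat \<Rightarrow> nat list"

definition top_end_slots :: "'a bdiag \<Rightarrow> (nat option \<times> nat) set" where
  "top_end_slots D = {(None, k) | k. k < length (ftop D)} \<union>
     {(Some t, k) | t k. t \<in> trs D \<and> k < length (tbot D t)}"

definition top_end_wire :: "'a bdiag \<Rightarrow> nat option \<times> nat \<Rightarrow> nat" where
  "top_end_wire D s = (case s of (None, k) \<Rightarrow> ftop D ! k | (Some t, k) \<Rightarrow> tbot D t ! k)"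

definition bot_end_slots :: "'a bdiag \<Rightarrow> (nat option \<times> nat) set" where
  "bot_end_slots D = {(None, k) | k. k < length (fbot D)} \<union>
     {(Some t, k) | t k. t \<in> trs D \<and> k < length (ttop D t)}"

definition bot_end_wire :: "'a bdiag \<Rightarrow> nat option \<times> nat \<Rightarrow> nat" where
  "bot_end_wire D s = (case s of (None, k) \<Rightarrow> fbot D ! k | (Some t, k) \<Rightarrow> ttop D t ! k)"

definition diag_prec :: "'a bdiag \<Rightarrow> (nat \<times> nat) set" where
  "diag_prec D = {(t1, t2). t1 \<in> trs D \<and> t2 \<in> trs D \<and>
      (\<exists>w\<in>wrs D. w \<in> set (tbot D t2) \<and> w \<in> set (ttop D t1))}"

definition valid_diag :: "'a set \<Rightarrow> ('a list \<times> 'a list) set \<Rightarrow> 'a bdiag \<Rightarrow> bool" where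
  "valid_diag S R D \<longleftrightarrow>
     finite (trs D) \<and> finite (wrs D) \<and> wrs D \<noteq> {} \<and>
     (\<forall>w\<in>wrs D. lab D w \<in> S) \<and>
     bij_betw (top_end_wire D) (top_end_slots D) (wrs D) \<and>
     bij_betw (bot_end_wire D) (bot_end_slots D) (wrs D) \<and>
     (\<forall>t\<in>trs D. (map (lab D) (ttop D t), map (lab D) (tbot D t)) \<in> R \<or>
                 (map (lab D) (tbot D t), map (lab D) (ttop D t)) \<in> R) \<and>
     irrefl ((diag_prec D)\<^sup>+)"

definition top_label :: "'a bdiag \<Rightarrow> 'a list" where
  "top_label D = map (lab D) (ftop D)"

definition bot_label :: "'a bdiag \<Rightarrow> 'a list" where
  "bot_label D = map (lab D) (fbot D)"

text \<open>Equivalence of diagrams (homeomorphism preserving all the structure).\<close>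
definition diag_iso :: "'a bdiag \<Rightarrow> 'a bdiag \<Rightarrow> bool" where
  "diag_iso D1 D2 \<longleftrightarrow> (\<exists>\<sigma> \<tau>. bij_betw \<sigma> (trs D1) (trs D2) \<and> bij_betw \<tau> (wrs D1) (wrs D2) \<and>
     (\<forall>w\<in>wrs D1. lab D2 (\<tau> w) = lab D1 w) \<and>
     ftop D2 = map \<tau> (ftop D1) \<and> fbot D2 = map \<tau> (fbot D1) \<and>
     (\<forall>t\<in>trs D1. ttop D2 (\<sigma> t) = map \<tau> (ttop D1 t) \<and> tbot D2 (\<sigma> t) = map \<tau> (tbot D1 t)))"

text \<open>Concatenation: wires/transistors of D1 are renamed n \<mapsto> 2n, those of D2 n \<mapsto> 2n+1,
  except that the wire at position k of the top of D2's frame is identified with the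
  wire at position k of the bottom of D1's frame.\<close>
definition concat_wire :: "'a bdiag \<Rightarrow> 'a bdiag \<Rightarrow> nat \<Rightarrow> nat" where
  "concat_wire D1 D2 w = (case map_of (zip (ftop D2) (fbot D1)) w of
      Some v \<Rightarrow> 2 * v | None \<Rightarrow> 2 * w + 1)"

definition diag_concat :: "'a bdiag \<Rightarrow> 'a bdiag \<Rightarrow> 'a bdiag" where
  "diag_concat D1 D2 = \<lparr>
     trs = (\<lambda>t. 2 * t) ` trs D1 \<union> (\<lambda>t. 2 * t + 1) ` trs D2,
     wrs = (\<lambda>w. 2 * w) ` wrs D1 \<union> concat_wire D1 D2 ` wrs D2,
     lab = (\<lambda>w. if even w then lab D1 (w div 2) else lab D2 (w div 2)),
     ftop = map (\<lambda>w. 2 * w) (ftop D1),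
     fbot = map (concat_wire D1 D2) (fbot D2),
     ttop = (\<lambda>t. if even t then map (\<lambda>w. 2 * w) (ttop D1 (t div 2))
                 else map (concat_wire D1 D2) (ttop D2 (t div 2))),
     tbot = (\<lambda>t. if even t then map (\<lambda>w. 2 * w) (tbot D1 (t div 2))
                 else map (concat_wire D1 D2) (tbot D2 (t div 2))) \<rparr>"

text \<open>Reduction of the dipole T1 \<preceq> T2: delete T1, T2 and the wires between them, and glue
  the k-th wire on top of T2 with the k-th wire at the bottom of T1.\<close>
definition dipole_glue :: "'a bdiag \<Rightarrow> nat \<Rightarrow> nat \<Rightarrow> nat \<Rightarrow> nat" where
  "dipole_glue D t1 t2 w = (case map_of (zip (tbot D t1) (ttop D t2)) w of
      Some u \<Rightarrow> u | None \<Rightarrow> w)"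

definition reduce_dipole :: "'a bdiag \<Rightarrow> nat \<Rightarrow> nat \<Rightarrow> 'a bdiag" where
  "reduce_dipole D t1 t2 = D\<lparr>
     trs := trs D - {t1, t2},
     wrs := wrs D - set (tbot D t2) - set (tbot D t1),
     fbot := map (dipole_glue D t1 t2) (fbot D),
     ttop := (\<lambda>t. map (dipole_glue D t1 t2) (ttop D t)) \<rparr>"

definition is_dipole :: "'a bdiag \<Rightarrow> nat \<Rightarrow> nat \<Rightarrow> bool" where
  "is_dipole D t1 t2 \<longleftrightarrow> t1 \<in> trs D \<and> t2 \<in> trs D \<and> t1 \<noteq> t2 \<and>
     (t1, t2) \<in> diag_prec D \<and>
     map (lab D) (tbot D t1) = map (lab D) (ttop D t2) \<and>
     tbot D t2 = ttop D t1"

definition dipole_red :: "'a bdiag \<Rightarrow> 'a bdiag \<Rightarrow> bool" where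
  "dipole_red D D' \<longleftrightarrow> (\<exists>t1 t2. is_dipole D t1 t2 \<and> D' = reduce_dipole D t1 t2)"

definition diagrams_ww :: "'a set \<Rightarrow> ('a list \<times> 'a list) set \<Rightarrow> 'a list \<Rightarrow> 'a bdiag set" where
  "diagrams_ww S R w = {D. valid_diag S R D \<and> top_label D = w \<and> bot_label D = w}"

definition diag_equiv :: "'a set \<Rightarrow> ('a list \<times> 'a list) set \<Rightarrow> 'a list \<Rightarrow> ('a bdiag \<times> 'a bdiag) set" where
  "diag_equiv S R w = ({(D1, D2). D1 \<in> diagrams_ww S R w \<and> D2 \<in> diagrams_ww S R w \<and>
      (diag_iso D1 D2 \<or> dipole_red D1 D2 \<or> dipole_red D2 D1)})\<^sup>*"

definition trivial_diag :: "'a list \<Rightarrow> 'a bdiag" where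
  "trivial_diag w = \<lparr> trs = {}, wrs = {..<length w}, lab = (\<lambda>k. w ! k),
     ftop = [0..<length w], fbot = [0..<length w], ttop = (\<lambda>_. []), tbot = (\<lambda>_. []) \<rparr>"

definition braided_diagram_group ::
  "'a set \<Rightarrow> ('a list \<times> 'a list) set \<Rightarrow> 'a list \<Rightarrow> 'a bdiag set monoid" where
  "braided_diagram_group S R w = \<lparr>
     carrier = diagrams_ww S R w // diag_equiv S R w,
     mult = (\<lambda>c1 c2. \<Union>D1\<in>c1. \<Union>D2\<in>c2. diag_equiv S R w `` {diag_concat D1 D2}),
     one = diag_equiv S R w `` {trivial_diag w} \<rparr>"

end

theory Submission
  imports Defs
begin

text \<open>
  A diagram acts on the maximal paths through the tree of descendants of the letter
  \<open>x\<close> (a path that stops at a leaf is padded with zeros): a path entering at the top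
  of the frame loses its first step at each transistor that splits a wire and gains one at each
  transistor that merges wires. Reduction of dipoles does not change this action and concatenation
  composes it. A path only gains and loses finitely many steps, so the action locally replaces one
  prefix by another one ending in the same letter. Conversely, every such bijection has a smallest
  pair of trees describing it, and a dipole-free diagram is determined by this pair, up to
  isomorphism: splitting a node at which the bijection already is a prefix swap would force a
  dipole. Hence \<open>D_b(\<P>, x)\<close> is the group of local prefix swaps. The two halves of
  the theorem compare this group with \<open>\<Gamma>(Sim)\<close>: a small similarity structure
  is the structure of prefix swaps, once points are coded by their descents through maximal proper
  sub-balls.
\<close>

section \<open>Paths in the tree of descendants of a letter\<close>

text \<open>Confluence of dipole reduction is never proved. Termination is enough, because the
  action tells the diagrams apart: two dipole-free diagrams with the same action are both isomorphic
  to one diagram built from that action. Freeness from dipoles enters twice. Without a merge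
  followed by its inverse split, no split lies below a merge, so the diagram is a tree glued to an
  inverted tree. Without a split followed by its inverse merge, these trees cannot be larger than
  the bijection demands. The case that has to be kept out is a letter with a single child: it would
  give two nodes with the same set of paths, and a node could no longer be read off from the
  bijection. The right-hand side of a tree-like relation has at least two letters, and maximal
  proper sub-balls cover a ball that is not a point, so there is never exactly one of them. Turning
  a diagram upside down exchanges splits and merges and inverts the action; it spares a second proof
  of most facts about the lower half. Padding by zeros makes every path a plain sequence of numbers,
  so one type of points serves all trees.\<close>

definition scons :: "nat \<Rightarrow> (nat \<Rightarrow> nat) \<Rightarrow> nat \<Rightarrow> nat" where
  "scons i p = case_nat i p"

lemma scons_0 [simp]: "scons i p 0 = i"
  and scons_Suc [simp]: "scons i p (Suc n) = p n"
  by (simp_all add: scons_def)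

lemma scons_inject [simp]: "scons i p = scons j q \<longleftrightarrow> i = j \<and> p = q"
proof
  assume eq: "scons i p = scons j q"
  have "p n = q n" for n using fun_cong [OF eq, of "Suc n"] by simp
  then show "i = j \<and> p = q" using fun_cong [OF eq, of 0] by auto
qed simp

lemma scons_collapse: "scons (p 0) (\<lambda>n. p (Suc n)) = p"
  by (rule ext) (simp add: scons_def split: nat.split)

lemma scons_zero [simp]: "scons 0 (\<lambda>_. 0) = (\<lambda>_. 0)"
  by (rule ext) (simp add: scons_def split: nat.split)

primrec app :: "nat list \<Rightarrow> (nat \<Rightarrow> nat) \<Rightarrow> nat \<Rightarrow> nat" where
  "app [] p = p"
| "app (i # u) p = scons i (app u p)"

lemma app_append [simp]: "app (u @ v) p = app u (app v p)"
  by (induction u) auto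

lemma app_inject [simp]: "app u p = app u q \<longleftrightarrow> p = q"
  by (induction u) auto

lemma app_nth: "app u p n = (if n < length u then u ! n else p (n - length u))"
  by (induction u arbitrary: n) (auto simp: scons_def nth_Cons split: nat.split)

text \<open>Two prefixes of one sequence are comparable, and the surplus \<open>s\<close> of the
  longer one heads the tail of the shorter. Comparisons of cylinders rest on this.\<close>

lemma app_eq_comparable:
  assumes "app u p = app v q"
  shows "(\<exists>s. u = v @ s \<and> q = app s p) \<or> (\<exists>s. v = u @ s \<and> p = app s q)"
  using assms
proof (induction u arbitrary: v)
  case (Cons i u)
  show ?case
  proof (cases v)
    case (Cons j v')
    with Cons.prems have "i = j" "app u p = app v' q" by auto
    with Cons.IH [of v'] Cons show ?thesis by auto
  qed (use Cons.prems in auto)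
qed auto

text \<open>\<open>ch a\<close> lists the children of a letter, and \<open>[]\<close> marks a leaf.
  Excluding single children makes a node recoverable from the set of paths through it.\<close>

locale letter_tree =
  fixes ch :: "'a \<Rightarrow> 'a list"
  assumes length_ch: "length (ch a) \<noteq> 1"
begin

primrec node :: "'a \<Rightarrow> nat list \<Rightarrow> bool" where
  "node a [] \<longleftrightarrow> True"
| "node a (i # u) \<longleftrightarrow> i < length (ch a) \<and> node (ch a ! i) u"

primrec lbl :: "'a \<Rightarrow> nat list \<Rightarrow> 'a" where
  "lbl a [] = a"
| "lbl a (i # u) = lbl (ch a ! i) u"

text \<open>Paths may be infinite, hence coinduction. A leaf admits only the zero tail, so a path
  that ends has exactly one representation as a sequence.\<close>

coinductive ends :: "'a \<Rightarrow> (nat \<Rightarrow> nat) \<Rightarrow> bool" where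
  leaf: "ch a = [] \<Longrightarrow> ends a (\<lambda>_. 0)"
| branch: "i < length (ch a) \<Longrightarrow> ends (ch a ! i) p \<Longrightarrow> ends a (scons i p)"

abbreviation E :: "'a \<Rightarrow> (nat \<Rightarrow> nat) set" where "E a \<equiv> {p. ends a p}"

lemma node_append [simp]: "node a (u @ v) \<longleftrightarrow> node a u \<and> node (lbl a u) v"
  by (induction u arbitrary: a) auto

lemma lbl_append [simp]: "lbl a (u @ v) = lbl (lbl a u) v"
  by (induction u arbitrary: a) auto

lemma ends_leaf_iff: "ch a = [] \<Longrightarrow> ends a p \<longleftrightarrow> p = (\<lambda>_. 0)"
  by (subst ends.simps) auto

lemma ends_scons_iff: "ch a \<noteq> [] \<Longrightarrow> ends a (scons i p) \<longleftrightarrow> i < length (ch a) \<and> ends (ch a ! i) p"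
  by (subst ends.simps) auto

lemma ends_scons [simp]: "i < length (ch a) \<Longrightarrow> ends a (scons i p) \<longleftrightarrow> ends (ch a ! i) p"
  by (subst ends_scons_iff) auto

lemma ends_branchE:
  assumes "ends a p" "ch a \<noteq> []"
  obtains i q where "i < length (ch a)" "p = scons i q" "ends (ch a ! i) q"
  using assms by (cases rule: ends.cases) auto

text \<open>Going to the first child wherever there is one is always possible. Behind the prefix of
  a node this gives each cylinder a distinguished point, used later as a witness and as a centre of
  balls.\<close>

lemma ends_zero [simp]: "ends a (\<lambda>_. 0)"
proof (rule ends.coinduct [where X = "\<lambda>a p. p = (\<lambda>_. 0)"], goal_cases)
  case (2 a p)
  show ?case
  proof (cases "ch a = []")
    case True
    with 2 show ?thesis by (intro disjI1) simp
  next
    case False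
    then have "0 < length (ch a)" by simp
    moreover have "p = scons 0 (\<lambda>_. 0)" using 2 by (simp only: scons_zero)
    ultimately show ?thesis by blast
  qed
qed simp

lemma ends_app [simp]: "node a u \<Longrightarrow> ends a (app u p) \<longleftrightarrow> ends (lbl a u) p"
  by (induction u arbitrary: a) auto

text \<open>A letter with children has at least two, so one of the children 0 and 1 differs from
  \<open>j\<close>.\<close>

lemma ends_head_neq:
  assumes "ch a \<noteq> []"
  obtains p where "ends a p" "p 0 \<noteq> j"
proof -
  have "length (ch a) > 1"
    using assms length_ch [of a] by (cases "length (ch a)") auto
  then have "\<exists>i. i < length (ch a) \<and> i \<noteq> j"
    by (intro exI [of _ "if j = 0 then 1 else 0"]) auto
  then obtain i where "i < length (ch a)" "i \<noteq> j" by blast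
  then have "ends a (scons i (\<lambda>_. 0))" by simp
  with \<open>i \<noteq> j\<close> show ?thesis by (intro that [of "scons i (\<lambda>_. 0)"]) auto
qed

lemma cylinder_self:
  assumes "node a s" "\<And>p. ends a p \<Longrightarrow> \<exists>q. p = app s q"
  shows "s = []"
proof (cases s)
  case (Cons j s')
  with assms(1) have "ch a \<noteq> []" by auto
  then obtain p where "ends a p" "p 0 \<noteq> j" by (rule ends_head_neq)
  with assms(2) obtain q where "p = app s q" by blast
  with \<open>p 0 \<noteq> j\<close> Cons show ?thesis by simp
qed

text \<open>A common point makes the nodes comparable, and by \<open>cylinder_self\<close> a proper
  descendant misses some path of its ancestor.\<close>

lemma cylinder_inject:
  assumes "node a u" "node a v" "app u ` E (lbl a u) = app v ` E (lbl a v)"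
  shows "u = v"
proof -
  have sub: "s = []" if "node a (w @ s)" "app w ` E (lbl a w) = app (w @ s) ` E (lbl a (w @ s))" for w s
  proof (rule cylinder_self)
    show "node (lbl a w) s" using that(1) by simp
    fix p assume "ends (lbl a w) p"
    then have "app w p \<in> app (w @ s) ` E (lbl a (w @ s))"
      by (subst that(2) [symmetric]) (rule imageI, simp)
    then obtain q where "app w p = app (w @ s) q" by (rule imageE)
    then show "\<exists>q. p = app s q" by auto
  qed
  have "app u (\<lambda>_. 0) \<in> app v ` E (lbl a v)"
    unfolding assms(3) [symmetric] by (rule imageI) simp
  then obtain q where "app u (\<lambda>_. 0) = app v q" by (rule imageE)
  from app_eq_comparable [OF this] consider s where "u = v @ s" | s where "v = u @ s"
    by blast
  then show ?thesis
  proof cases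
    case 1
    with sub [of v s] assms show ?thesis by simp
  next
    case 2
    with sub [of u s] assms show ?thesis by simp
  qed
qed

text \<open>The tails \<open>r\<close> sweep out whole cylinders, so agreement of the two
  substitutions forces equal cylinders. Hence the partner of a node under a prefix swap is
  unique.\<close>

lemma swap_inject:
  assumes "node a v" "node a v'" "lbl a v = lbl a v'"
    and "\<And>r. ends (lbl a v) r \<Longrightarrow> app v r = app v' r"
  shows "v = v'"
  using assms by (intro cylinder_inject [of a]) (auto simp: image_def)

text \<open>A path can be cut at depth \<open>n\<close> unless it has ended at a leaf before. This
  exception recurs wherever depth measures distance.\<close>

lemma ends_prefix:
  assumes "ends a p"
  shows "\<exists>u r. node a u \<and> p = app u r \<and> ends (lbl a u) r \<and>
           (length u = n \<or> length u \<le> n \<and> ch (lbl a u) = [])"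
  using assms
proof (induction n arbitrary: a p)
  case 0
  then show ?case by (intro exI [of _ "[]"]) auto
next
  case (Suc n)
  show ?case
  proof (cases "ch a = []")
    case True
    with Suc.prems show ?thesis by (intro exI [of _ "[]"]) auto
  next
    case False
    with Suc.prems obtain i q where iq: "i < length (ch a)" "p = scons i q" "ends (ch a ! i) q"
      by (rule ends_branchE)
    from Suc.IH [OF iq(3)] obtain u r where
      "node (ch a ! i) u" "q = app u r" "ends (lbl (ch a ! i) u) r"
      "length u = n \<or> length u \<le> n \<and> ch (lbl (ch a ! i) u) = []" by blast
    with iq show ?thesis by (intro exI [of _ "i # u"] exI [of _ r]) auto
  qed
qed

text \<open>Being a path is checked one coordinate at a time, so the set of paths is closed under
  pointwise limits. This serves both the infinite branch in \<open>koenig\<close> and the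
  completeness of the path space.\<close>

lemma ends_cong_limit:
  assumes "\<And>n. \<exists>q. ends a q \<and> (\<forall>k<n. q k = p k)"
  shows "ends a p"
  using assms
proof (coinduction arbitrary: a p)
  case ends
  show ?case
  proof (cases "ch a = []")
    case True
    have "p n = 0" for n
      using ends [rule_format, of "Suc n"] True by (auto simp: ends_leaf_iff)
    then show ?thesis using True by auto
  next
    case False
    define i q where "i = p 0" and "q = (\<lambda>n. p (Suc n))"
    have p: "p = scons i q" by (simp add: i_def q_def scons_collapse)
    have *: "\<exists>q'. ends (ch a ! i) q' \<and> (\<forall>k<n. q' k = q k) \<and> i < length (ch a)" for n
    proof -
      obtain p' where p': "ends a p'" "\<forall>k<Suc n. p' k = p k" using ends by blast
      from p'(1) False obtain j q' where "j < length (ch a)" "p' = scons j q'" "ends (ch a ! j) q'"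
        by (rule ends_branchE)
      moreover have "j = i" using p'(2) calculation p by force
      moreover have "\<forall>k<n. q' k = q k"
        using p'(2) calculation p by (metis Suc_less_eq scons_Suc)
      ultimately show ?thesis by blast
    qed
    then have "i < length (ch a)" by blast
    moreover have "\<forall>n. \<exists>q'. ends (ch a ! i) q' \<and> (\<forall>k<n. q' k = q k)" using * by blast
    ultimately show ?thesis using p by blast
  qed
qed

lemma ends_if_all_prefixes_nodes:
  assumes "\<And>n. node a (map p [0..<n])"
  shows "ends a p"
proof (rule ends_cong_limit)
  fix n
  show "\<exists>q. ends a q \<and> (\<forall>k<n. q k = p k)"
    using assms [of n] by (intro exI [of _ "app (map p [0..<n]) (\<lambda>_. 0)"]) (auto simp: app_nth)
qed

text \<open>Koenig's lemma for a prefix-closed set of nodes; branching is finite because the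
  children form a list.\<close>

lemma koenig:
  assumes nodes: "\<And>u. u \<in> F \<Longrightarrow> node a u"
    and closed: "\<And>u v. u @ v \<in> F \<Longrightarrow> u \<in> F"
    and no_branch: "\<And>p. ends a p \<Longrightarrow> \<exists>n. map p [0..<n] \<notin> F"
  shows "finite F"
proof (rule ccontr)
  assume inf: "infinite F"
  \<comment> \<open>These nodes have infinitely many descendants in \<open>F\<close>. Each has a
    child of the same kind, and following such children forever yields the forbidden branch.\<close>
  define big where "big u \<longleftrightarrow> infinite {v \<in> F. \<exists>s. v = u @ s}" for u
  have step: "\<exists>i. big (u @ [i])" if "big u" for u
  proof (rule ccontr)
    assume "\<nexists>i. big (u @ [i])"
    then have "finite (\<Union>i<length (ch (lbl a u)). {v \<in> F. \<exists>s. v = (u @ [i]) @ s})"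
      by (auto simp: big_def)
    moreover have "{v \<in> F. \<exists>s. v = u @ s} \<subseteq> insert u (\<Union>i<length (ch (lbl a u)). {v \<in> F. \<exists>s. v = (u @ [i]) @ s})"
    proof
      fix v assume "v \<in> {v \<in> F. \<exists>s. v = u @ s}"
      then obtain s where s: "v \<in> F" "v = u @ s" by blast
      show "v \<in> insert u (\<Union>i<length (ch (lbl a u)). {v \<in> F. \<exists>s. v = (u @ [i]) @ s})"
        using s nodes [OF s(1)] by (cases s) auto
    qed
    ultimately show False using that unfolding big_def by (meson finite_insert finite_subset)
  qed
  define nxt where "nxt u = u @ [SOME i. big (u @ [i])]" for u
  have big_nxt: "big u \<Longrightarrow> big (nxt u)" for u unfolding nxt_def using step by (rule someI_ex)
  define U where "U n = (nxt ^^ n) []" for n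
  have big_U: "big (U n)" for n
  proof (induction n)
    case 0
    then show ?case using inf by (simp add: U_def big_def)
  qed (simp add: U_def big_nxt)
  define p where "p n = last (U (Suc n))" for n
  have U: "U n = map p [0..<n]" for n
  proof (induction n)
    case (Suc n)
    have "U (Suc n) = nxt (U n)" by (simp add: U_def)
    then show ?case using Suc by (simp add: nxt_def p_def)
  qed (simp add: U_def)
  have in_F: "U n \<in> F" for n
  proof -
    have "{v \<in> F. \<exists>s. v = U n @ s} \<noteq> {}" using big_U [of n] unfolding big_def by (metis finite.emptyI)
    then show ?thesis using closed by blast
  qed
  then have "ends a p" using nodes U by (metis ends_if_all_prefixes_nodes)
  then show False using no_branch in_F U by metis
qed

end

section \<open>Paths running through a diagram\<close>

text \<open>One condition for either end of the wires: \<open>f\<close> is the frame side,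
  \<open>b\<close> the transistor side, and their lists partition \<open>W\<close> without
  repetition. Unlike a bijection on slots, it is easy to follow through renaming and
  deletion.\<close>

definition attached :: "nat set \<Rightarrow> nat list \<Rightarrow> (nat \<Rightarrow> nat list) \<Rightarrow> nat set \<Rightarrow> bool" where
  "attached T f b W \<longleftrightarrow> distinct f \<and> (\<forall>t\<in>T. distinct (b t) \<and> set f \<inter> set (b t) = {}) \<and>
     (\<forall>s\<in>T. \<forall>t\<in>T. s \<noteq> t \<longrightarrow> set (b s) \<inter> set (b t) = {}) \<and> W = set f \<union> (\<Union>t\<in>T. set (b t))"

lemma bij_betw_slots_iff_attached:
  fixes T f b W
  defines "slots \<equiv> {(None, k) | k. k < length f} \<union> {(Some t, k) | t k. t \<in> T \<and> k < length (b t)}"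
  defines "wire \<equiv> (\<lambda>s. case s of (None, k) \<Rightarrow> f ! k | (Some t, k) \<Rightarrow> b t ! k)"
  shows "bij_betw wire slots W \<longleftrightarrow> attached T f b W"
proof -
  have img: "wire ` slots = set f \<union> (\<Union>t\<in>T. set (b t))"
    by (force simp: slots_def wire_def image_Un set_conv_nth image_iff)
  have "inj_on wire slots \<longleftrightarrow> distinct f \<and> (\<forall>t\<in>T. distinct (b t) \<and> set f \<inter> set (b t) = {}) \<and>
     (\<forall>s\<in>T. \<forall>t\<in>T. s \<noteq> t \<longrightarrow> set (b s) \<inter> set (b t) = {})" (is "?L \<longleftrightarrow> ?R")
  proof
    assume ?L
    then have inj: "wire s = wire s' \<Longrightarrow> s \<in> slots \<Longrightarrow> s' \<in> slots \<Longrightarrow> s = s'" for s s'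
      by (auto simp: inj_on_def)
    have "distinct f"
      unfolding distinct_conv_nth using inj [of "(None, _)" "(None, _)"]
      by (auto simp: slots_def wire_def)
    moreover have "distinct (b t)" if "t \<in> T" for t
      unfolding distinct_conv_nth using inj [of "(Some t, _)" "(Some t, _)"] that
      by (auto simp: slots_def wire_def)
    moreover have "set f \<inter> set (b t) = {}" if "t \<in> T" for t
      using inj [of "(None, _)" "(Some t, _)"] that
      by (fastforce simp: slots_def wire_def in_set_conv_nth)
    moreover have "set (b s) \<inter> set (b t) = {}" if "s \<in> T" "t \<in> T" "s \<noteq> t" for s t
      using inj [of "(Some s, _)" "(Some t, _)"] that
      by (fastforce simp: slots_def wire_def in_set_conv_nth)
    ultimately show ?R by blast
  next
    assume R: ?R
    show ?L
    proof (rule inj_onI)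
      fix s s' assume s: "s \<in> slots" "s' \<in> slots" "wire s = wire s'"
      obtain a k a' k' where [simp]: "s = (a, k)" "s' = (a', k')" by fastforce
      show "s = s'"
        using s R
        by (cases a; cases a')
          (auto simp: slots_def wire_def distinct_conv_nth disjoint_iff in_set_conv_nth; metis)+
    qed
  qed
  then show ?thesis
    unfolding bij_betw_def attached_def img by blast
qed

lemma attached_wire: "attached T f b W \<Longrightarrow> w \<in> W \<longleftrightarrow> w \<in> set f \<or> (\<exists>t\<in>T. w \<in> set (b t))"
  by (auto simp: attached_def)

lemma attached_unique:
  "attached T f b W \<Longrightarrow> s \<in> T \<Longrightarrow> t \<in> T \<Longrightarrow> w \<in> set (b s) \<Longrightarrow> w \<in> set (b t) \<Longrightarrow> s = t"
  unfolding attached_def by blast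

lemma attached_frame: "attached T f b W \<Longrightarrow> t \<in> T \<Longrightarrow> w \<in> set (b t) \<Longrightarrow> w \<notin> set f"
  by (auto simp: attached_def)

lemma attached_disjoint:
  "attached T f b W \<Longrightarrow> s \<in> T \<Longrightarrow> t \<in> T \<Longrightarrow> s \<noteq> t \<Longrightarrow> set (b s) \<inter> set (b t) = {}"
  by (simp add: attached_def)

lemma attached_remove:
  assumes "attached T f b W" "U \<subseteq> T"
  shows "attached (T - U) f b (W - (\<Union>t\<in>U. set (b t)))"
proof -
  have "set (b s) \<inter> set (b t) = {}" if "s \<in> U" "t \<in> T - U" for s t
    using attached_disjoint [OF assms(1), of s t] that assms(2) by auto
  moreover have "set f \<inter> set (b t) = {}" if "t \<in> T" for t
    using assms(1) that by (simp add: attached_def)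
  ultimately have "W - (\<Union>t\<in>U. set (b t)) = set f \<union> (\<Union>t\<in>T - U. set (b t))"
    using assms by (auto simp: attached_def)
  then show ?thesis
    using assms(1) by (simp add: attached_def)
qed

lemma attached_nth_inject:
  "attached T f b W \<Longrightarrow> s \<in> T \<Longrightarrow> t \<in> T \<Longrightarrow> i < length (b s) \<Longrightarrow> j < length (b t) \<Longrightarrow>
    b s ! i = b t ! j \<longleftrightarrow> s = t \<and> i = j"
  by (metis attached_unique attached_def nth_eq_iff_index_eq nth_mem)

text \<open>Renaming by injective maps. It is applied to the two halves of a concatenation and to
  the gluing of wires across a removed dipole.\<close>

lemma attached_image:
  assumes "attached T f b W" "inj_on \<tau> W" "inj_on \<sigma> T"
    and "\<And>t. t \<in> T \<Longrightarrow> b' (\<sigma> t) = map \<tau> (b t)"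
  shows "attached (\<sigma> ` T) (map \<tau> f) b' (\<tau> ` W)"
proof -
  have sub: "set f \<subseteq> W" "\<And>t. t \<in> T \<Longrightarrow> set (b t) \<subseteq> W"
    using assms(1) by (auto simp: attached_def)
  have disj: "\<tau> ` A \<inter> \<tau> ` B = {}" if "A \<subseteq> W" "B \<subseteq> W" "A \<inter> B = {}" for A B
    using that assms(2) inj_on_image_Int [of \<tau> W A B] by auto
  have "distinct (map \<tau> f)" "\<And>t. t \<in> T \<Longrightarrow> distinct (map \<tau> (b t))"
    using assms(1,2) sub by (auto simp: attached_def distinct_map intro: inj_on_subset)
  moreover have "set (map \<tau> f) \<inter> set (map \<tau> (b t)) = {}" if "t \<in> T" for t
    using disj [of "set f" "set (b t)"] sub that assms(1) by (auto simp: attached_def)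
  moreover have "set (map \<tau> (b s)) \<inter> set (map \<tau> (b t)) = {}" if "s \<in> T" "t \<in> T" "s \<noteq> t" for s t
    using disj [of "set (b s)" "set (b t)"] sub that assms(1) by (auto simp: attached_def)
  moreover have "\<tau> ` W = set (map \<tau> f) \<union> (\<Union>t\<in>T. set (map \<tau> (b t)))"
    using assms(1) by (auto simp: attached_def)
  ultimately show ?thesis
    using assms(4) unfolding attached_def by (simp del: set_map) blast
qed

text \<open>The number of predecessors in the transitive closure is a rank. Acyclicity of a
  constructed diagram can then be shown by exhibiting a rank instead of chasing chains.\<close>

lemma irrefl_trancl_iff_rank:
  fixes r :: "('b \<times> 'b) set"
  assumes "finite r"
  shows "irrefl (r\<^sup>+) \<longleftrightarrow> (\<exists>\<rho>::'b \<Rightarrow> nat. \<forall>s t. (s, t) \<in> r \<longrightarrow> \<rho> s < \<rho> t)"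
proof
  assume irr: "irrefl (r\<^sup>+)"
  have "card {u. (u, s) \<in> r\<^sup>+} < card {u. (u, t) \<in> r\<^sup>+}" if "(s, t) \<in> r" for s t
  proof (rule psubset_card_mono)
    have "{u. (u, t) \<in> r\<^sup>+} \<subseteq> Domain (r\<^sup>+)" by (auto simp del: trancl_domain)
    then show "finite {u. (u, t) \<in> r\<^sup>+}"
      by (rule finite_subset) (simp add: finite_Domain assms)
    show "{u. (u, s) \<in> r\<^sup>+} \<subset> {u. (u, t) \<in> r\<^sup>+}"
      using that irr by (auto simp: irrefl_def psubset_eq set_eq_iff)
  qed
  then show "\<exists>\<rho>::'b \<Rightarrow> nat. \<forall>s t. (s, t) \<in> r \<longrightarrow> \<rho> s < \<rho> t"
    by (intro exI [of _ "\<lambda>t. card {u. (u, t) \<in> r\<^sup>+}"]) simp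
next
  assume "\<exists>\<rho>::'b \<Rightarrow> nat. \<forall>s t. (s, t) \<in> r \<longrightarrow> \<rho> s < \<rho> t"
  then obtain \<rho> :: "'b \<Rightarrow> nat" where \<rho>: "\<And>s t. (s, t) \<in> r \<Longrightarrow> \<rho> s < \<rho> t" by blast
  have "\<rho> s < \<rho> t" if "(s, t) \<in> r\<^sup>+" for s t
    using that by induction (auto dest: \<rho>)
  then show "irrefl (r\<^sup>+)" unfolding irrefl_def by blast
qed

text \<open>The diagram turned upside down: splits become merges and the action is inverted, so
  facts about merges and preimages follow from those about splits and images.\<close>

definition flip :: "'a bdiag \<Rightarrow> 'a bdiag" where
  "flip D = D\<lparr>ftop := fbot D, fbot := ftop D, ttop := tbot D, tbot := ttop D\<rparr>"

lemma flip_simps [simp]: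
  "trs (flip D) = trs D" "wrs (flip D) = wrs D" "lab (flip D) = lab D"
  "ftop (flip D) = fbot D" "fbot (flip D) = ftop D" "ttop (flip D) = tbot D" "tbot (flip D) = ttop D"
  "flip (flip D) = D"
  by (simp_all add: flip_def)

inductive step :: "'a bdiag \<Rightarrow> nat \<times> (nat \<Rightarrow> nat) \<Rightarrow> nat \<times> (nat \<Rightarrow> nat) \<Rightarrow> bool" for D where
  split: "t \<in> trs D \<Longrightarrow> ttop D t = [w] \<Longrightarrow> i < length (tbot D t) \<Longrightarrow>
    step D (w, scons i p) (tbot D t ! i, p)"
| merge: "t \<in> trs D \<Longrightarrow> tbot D t = [w] \<Longrightarrow> i < length (ttop D t) \<Longrightarrow>
    step D (ttop D t ! i, p) (w, scons i p)"

abbreviation steps :: "'a bdiag \<Rightarrow> nat \<times> (nat \<Rightarrow> nat) \<Rightarrow> nat \<times> (nat \<Rightarrow> nat) \<Rightarrow> bool" where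
  "steps D \<equiv> (step D)\<^sup>*\<^sup>*"

lemma step_iff:
  "step D (w, p) (w', p') \<longleftrightarrow>
     (\<exists>t\<in>trs D. \<exists>i. ttop D t = [w] \<and> i < length (tbot D t) \<and> w' = tbot D t ! i \<and> p = scons i p') \<or>
     (\<exists>t\<in>trs D. \<exists>i. tbot D t = [w'] \<and> i < length (ttop D t) \<and> w = ttop D t ! i \<and> p' = scons i p)"
  by (subst step.simps) blast

lemma step_flip: "step (flip D) s s' \<longleftrightarrow> step D s' s"
proof -
  have "step D s' s" if "step (flip D) s s'" for D :: "'a bdiag" and s s'
    using that by cases (auto intro: step.intros)
  from this [of D s s'] this [of "flip D" s' s] show ?thesis by auto
qed

lemma steps_flip: "steps (flip D) s s' \<longleftrightarrow> steps D s' s"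
proof -
  have "step (flip D) = (step D)\<inverse>\<inverse>" by (auto simp: fun_eq_iff step_flip)
  then show ?thesis by (simp add: rtranclp_conversep)
qed

text \<open>\<open>hd\<close> suffices because the diagrams of interest have one wire at the top and
  one at the bottom of the frame.\<close>

definition run :: "'a bdiag \<Rightarrow> (nat \<Rightarrow> nat) \<Rightarrow> (nat \<Rightarrow> nat) \<Rightarrow> bool" where
  "run D p q \<longleftrightarrow> steps D (hd (ftop D), p) (hd (fbot D), q)"

lemma run_flip: "run (flip D) p q \<longleftrightarrow> run D q p"
  by (simp add: run_def steps_flip)

text \<open>A tree-like set of relations amounts to the function \<open>ch\<close>: one relation for
  each letter with children, none for the leaves.\<close>

locale presentation = letter_tree ch for ch :: "'a \<Rightarrow> 'a list" +
  fixes S :: "'a set" and R :: "('a list \<times> 'a list) set"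
  assumes R_iff: "(u, v) \<in> R \<longleftrightarrow> (\<exists>a. u = [a] \<and> v = ch a \<and> ch a \<noteq> [])"
    and ch_closed: "a \<in> S \<Longrightarrow> set (ch a) \<subseteq> S"
begin

definition is_split :: "'a bdiag \<Rightarrow> nat \<Rightarrow> bool" where
  "is_split D t \<longleftrightarrow> (\<exists>w. ttop D t = [w] \<and> map (lab D) (tbot D t) = ch (lab D w) \<and> tbot D t \<noteq> [])"

lemma R_map_iff: "(map (lab D) (ttop D t), map (lab D) (tbot D t)) \<in> R \<longleftrightarrow> is_split D t"
  by (auto simp: R_iff is_split_def)

text \<open>The working form of validity: attachments are partitions, a merge is a split of the
  reflected diagram, and acyclicity is witnessed by a rank that grows upwards.\<close>

lemma valid_diag_iff:
  "valid_diag S R D \<longleftrightarrow> finite (trs D) \<and> finite (wrs D) \<and> wrs D \<noteq> {} \<and> lab D ` wrs D \<subseteq> S \<and>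
     attached (trs D) (ftop D) (tbot D) (wrs D) \<and> attached (trs D) (fbot D) (ttop D) (wrs D) \<and>
     (\<forall>t\<in>trs D. is_split D t \<or> is_split (flip D) t) \<and>
     (\<exists>\<rho>::nat \<Rightarrow> nat. \<forall>s\<in>trs D. \<forall>t\<in>trs D. set (ttop D s) \<inter> set (tbot D t) \<noteq> {} \<longrightarrow> \<rho> s < \<rho> t)"
proof -
  have top: "bij_betw (top_end_wire D) (top_end_slots D) (wrs D)
    \<longleftrightarrow> attached (trs D) (ftop D) (tbot D) (wrs D)"
    unfolding bij_betw_slots_iff_attached [symmetric] top_end_slots_def top_end_wire_def
    by (rule arg_cong [where f = "\<lambda>f. bij_betw f _ _"]) (rule ext, rule refl)
  have bot: "bij_betw (bot_end_wire D) (bot_end_slots D) (wrs D)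
    \<longleftrightarrow> attached (trs D) (fbot D) (ttop D) (wrs D)"
    unfolding bij_betw_slots_iff_attached [symmetric] bot_end_slots_def bot_end_wire_def
    by (rule arg_cong [where f = "\<lambda>f. bij_betw f _ _"]) (rule ext, rule refl)
  have rels: "(map (lab D) (ttop D t), map (lab D) (tbot D t)) \<in> R \<or>
       (map (lab D) (tbot D t), map (lab D) (ttop D t)) \<in> R \<longleftrightarrow> is_split D t \<or> is_split (flip D) t" for t
    using R_map_iff [of D t] R_map_iff [of "flip D" t] by simp
  have prec: "(s, t) \<in> diag_prec D \<longleftrightarrow> s \<in> trs D \<and> t \<in> trs D \<and> set (ttop D s) \<inter> set (tbot D t) \<noteq> {}"
    if "attached (trs D) (ftop D) (tbot D) (wrs D)" for s t
    using that by (auto simp: diag_prec_def attached_def)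
  have fin: "finite (diag_prec D)" if "finite (trs D)"
    by (rule finite_subset [of _ "trs D \<times> trs D"]) (use that in \<open>auto simp: diag_prec_def\<close>)
  show ?thesis
  proof (cases "finite (trs D) \<and> attached (trs D) (ftop D) (tbot D) (wrs D)")
    case True
    then have "irrefl ((diag_prec D)\<^sup>+) \<longleftrightarrow>
      (\<exists>\<rho>::nat \<Rightarrow> nat. \<forall>s\<in>trs D. \<forall>t\<in>trs D. set (ttop D s) \<inter> set (tbot D t) \<noteq> {} \<longrightarrow> \<rho> s < \<rho> t)"
      by (subst irrefl_trancl_iff_rank) (simp_all add: fin prec, blast)
    then show ?thesis unfolding valid_diag_def top bot rels by (auto simp: image_subset_iff)
  qed (auto simp: valid_diag_def top)
qed

lemma valid_flip [simp]: "valid_diag S R (flip D) \<longleftrightarrow> valid_diag S R D"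
proof -
  have "valid_diag S R (flip D)" if "valid_diag S R D" for D
  proof -
    have "diag_prec (flip D) = (diag_prec D)\<inverse>" by (auto simp: diag_prec_def)
    then have "irrefl ((diag_prec (flip D))\<^sup>+)"
      using that by (simp add: valid_diag_def trancl_converse irrefl_def)
    moreover have "top_end_wire (flip D) = bot_end_wire D" "bot_end_wire (flip D) = top_end_wire D"
      "top_end_slots (flip D) = bot_end_slots D" "bot_end_slots (flip D) = top_end_slots D"
      by (auto simp: top_end_wire_def bot_end_wire_def top_end_slots_def bot_end_slots_def fun_eq_iff
          split: option.split)
    ultimately show ?thesis using that by (auto simp: valid_diag_def)
  qed
  from this [of D] this [of "flip D"] show ?thesis by auto
qed

end

section \<open>The action of a single diagram on paths\<close>

locale diagram = presentation +
  fixes D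
  assumes valid: "valid_diag S R D"
begin

lemma flip_diagram: "diagram ch S R (flip D)"
  by unfold_locales (simp add: valid)

lemma finite_trs: "finite (trs D)" and finite_wrs: "finite (wrs D)"
  and lab_in: "w \<in> wrs D \<Longrightarrow> lab D w \<in> S"
  and top_att: "attached (trs D) (ftop D) (tbot D) (wrs D)"
  and bot_att: "attached (trs D) (fbot D) (ttop D) (wrs D)"
  and split_or_merge: "t \<in> trs D \<Longrightarrow> is_split D t \<or> is_split (flip D) t"
  using valid by (auto simp: valid_diag_iff)

lemma rankE:
  obtains \<rho> :: "nat \<Rightarrow> nat"
  where "\<And>s t. s \<in> trs D \<Longrightarrow> t \<in> trs D \<Longrightarrow> set (ttop D s) \<inter> set (tbot D t) \<noteq> {} \<Longrightarrow> \<rho> s < \<rho> t"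
  using valid unfolding valid_diag_iff by blast

lemma wires_in:
  "t \<in> trs D \<Longrightarrow> w \<in> set (ttop D t) \<Longrightarrow> w \<in> wrs D"
  "t \<in> trs D \<Longrightarrow> w \<in> set (tbot D t) \<Longrightarrow> w \<in> wrs D"
  "w \<in> set (ftop D) \<Longrightarrow> w \<in> wrs D"
  "w \<in> set (fbot D) \<Longrightarrow> w \<in> wrs D"
  using top_att bot_att by (auto simp: attached_def)

text \<open>A merge has as many wires on top as its letter has children, which is never one. So a
  single wire on top identifies a split.\<close>

lemma singleton_top_split:
  assumes "t \<in> trs D" "ttop D t = [w]"
  shows "map (lab D) (tbot D t) = ch (lab D w)" "tbot D t \<noteq> []" "length (tbot D t) = length (ch (lab D w))"
proof -
  have "\<not> is_split (flip D) t"
    using assms length_ch unfolding is_split_def by (metis flip_simps(6,7) length_Cons length_map list.size(3) One_nat_def)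
  then have "is_split D t" using assms split_or_merge by blast
  then show "map (lab D) (tbot D t) = ch (lab D w)" "tbot D t \<noteq> []"
    using assms by (auto simp: is_split_def)
  then show "length (tbot D t) = length (ch (lab D w))" by (metis length_map)
qed

lemma singleton_bot_merge:
  assumes "t \<in> trs D" "tbot D t = [w]"
  shows "map (lab D) (ttop D t) = ch (lab D w)" "ttop D t \<noteq> []" "length (ttop D t) = length (ch (lab D w))"
  using diagram.singleton_top_split [OF flip_diagram, of t w] assms by auto

lemma singleton_top_nth:
  "t \<in> trs D \<Longrightarrow> ttop D t = [w] \<Longrightarrow> i < length (tbot D t) \<Longrightarrow> lab D (tbot D t ! i) = ch (lab D w) ! i"
  by (metis nth_map singleton_top_split(1))

lemma singleton_bot_nth:
  "t \<in> trs D \<Longrightarrow> tbot D t = [w] \<Longrightarrow> i < length (ttop D t) \<Longrightarrow> lab D (ttop D t ! i) = ch (lab D w) ! i"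
  by (metis nth_map singleton_bot_merge(1))

lemma singleton_cases:
  assumes "t \<in> trs D"
  obtains w where "ttop D t = [w]" "length (tbot D t) > 1"
  | w where "tbot D t = [w]" "length (ttop D t) > 1"
proof -
  have gt: "length (ch a) > 1" if "ch a \<noteq> []" for a
    using that length_ch [of a] by (cases "length (ch a)") auto
  from split_or_merge [OF assms] consider w where "ttop D t = [w]" | w where "tbot D t = [w]"
    by (auto simp: is_split_def)
  then show ?thesis
  proof cases
    case 1
    with singleton_top_split [OF assms] gt show ?thesis by (metis length_0_conv that(1))
  next
    case 2
    with singleton_bot_merge [OF assms] gt show ?thesis by (metis length_0_conv that(2))
  qed
qed

definition st :: "nat \<times> (nat \<Rightarrow> nat) \<Rightarrow> bool" where
  "st s \<longleftrightarrow> fst s \<in> wrs D \<and> ends (lab D (fst s)) (snd s)"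

lemma step_st: "step D s s' \<Longrightarrow> st s \<longleftrightarrow> st s'"
proof (induction rule: step.induct)
  case (split t w i p)
  then show ?case
    using singleton_top_split [of t w] wires_in [of t] unfolding st_def
    by (metis ends_scons fst_conv list.set_intros(1) nth_map nth_mem snd_conv)
next
  case (merge t w i p)
  then show ?case
    using singleton_bot_merge [of t w] wires_in [of t] unfolding st_def
    by (metis ends_scons fst_conv list.set_intros(1) nth_map nth_mem snd_conv)
qed

lemma steps_st: "steps D s s' \<Longrightarrow> st s \<longleftrightarrow> st s'"
  by (induction rule: rtranclp_induct) (auto dest: step_st)

lemma step_source: "step D (w, p) s \<Longrightarrow> \<exists>t\<in>trs D. w \<in> set (ttop D t)"
  by (erule step.cases) force+

text \<open>The bottom end of a wire lies on at most one transistor. If that splits, the first step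
  of the path selects the exit; if it merges, there is only one exit.\<close>

lemma step_det:
  assumes "step D s s1" "step D s s2"
  shows "s1 = s2"
  using assms(1)
proof cases
  case (split t w i p)
  from assms(2) show ?thesis
  proof cases
    case (split t' w' i' p')
    then show ?thesis using \<open>s = (w, scons i p)\<close> \<open>s1 = _\<close> \<open>t \<in> trs D\<close> \<open>ttop D t = [w]\<close>
      using attached_unique [OF bot_att, of t t' w] by auto
  next
    case (merge t' w' i' p')
    then have "w \<in> set (ttop D t')" using \<open>s = (w, scons i p)\<close> by auto
    then have "t = t'" using attached_unique [OF bot_att, of t t' w] split merge by auto
    then show ?thesis using split merge singleton_cases [of t] by auto
  qed
next
  case (merge t w i p)
  from assms(2) show ?thesis
  proof cases
    case (split t' w' i' p')
    then have "w' \<in> set (ttop D t)" using merge by auto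
    then have "t = t'" using attached_unique [OF bot_att, of t t' w'] split merge by auto
    then show ?thesis using split merge singleton_cases [of t] by auto
  next
    case (merge t' w' i' p')
    then have "ttop D t ! i = ttop D t' ! i'" "p = p'" using \<open>s = (ttop D t ! i, p)\<close> by auto
    then have "t = t' \<and> i = i'"
      using attached_nth_inject [OF bot_att, of t t' i i'] merge \<open>t \<in> trs D\<close> \<open>i < length (ttop D t)\<close> by auto
    then show ?thesis using merge \<open>s1 = _\<close> \<open>tbot D t = [w]\<close> \<open>p = p'\<close> by auto
  qed
qed

text \<open>A run could only get stuck at a split by lacking a first step, but a wire that is split
  carries a letter with children.\<close>

lemma step_progress:
  assumes "st (w, p)" "w \<notin> set (fbot D)"
  shows "\<exists>s. step D (w, p) s"
proof -
  from assms obtain t where t: "t \<in> trs D" "w \<in> set (ttop D t)"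
    using attached_wire [OF bot_att] by (auto simp: st_def)
  from t(1) show ?thesis
  proof (cases rule: singleton_cases)
    case (1 w')
    with t have "ttop D t = [w]" by auto
    with t singleton_top_split [of t w] have "ch (lab D w) \<noteq> []" "length (tbot D t) = length (ch (lab D w))"
      by auto
    with assms(1) obtain i q where "i < length (tbot D t)" "p = scons i q"
      by (auto simp: st_def elim: ends_branchE)
    with t \<open>ttop D t = [w]\<close> show ?thesis by (blast intro: step.split)
  next
    case (2 w')
    from t(2) obtain i where "i < length (ttop D t)" "w = ttop D t ! i" by (metis in_set_conv_nth)
    with 2 t show ?thesis by (blast intro: step.merge)
  qed
qed

lemma step_rankE:
  obtains h :: "nat \<Rightarrow> nat" where "\<And>t w w'. t \<in> trs D \<Longrightarrow> w \<in> set (ttop D t) \<Longrightarrow> w' \<in> set (tbot D t) \<Longrightarrow> h w' < h w"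
proof -
  obtain \<rho> :: "nat \<Rightarrow> nat" where
    \<rho>: "\<And>s t. s \<in> trs D \<Longrightarrow> t \<in> trs D \<Longrightarrow> set (ttop D s) \<inter> set (tbot D t) \<noteq> {} \<Longrightarrow> \<rho> s < \<rho> t"
    using rankE by blast
  \<comment> \<open>The rank moves from transistors to wires: a wire gets one more than the
    transistor below it, which reserves 0 for the wires ending at the frame.\<close>
  define h where "h w = (if \<exists>t\<in>trs D. w \<in> set (ttop D t)
     then Suc (\<rho> (THE t. t \<in> trs D \<and> w \<in> set (ttop D t))) else 0)" for w
  have h: "h w = Suc (\<rho> t)" if "t \<in> trs D" "w \<in> set (ttop D t)" for t w
  proof -
    have "(THE t. t \<in> trs D \<and> w \<in> set (ttop D t)) = t"
      using that attached_unique [OF bot_att] by (intro the_equality) auto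
    then show ?thesis using that by (auto simp: h_def)
  qed
  have "h w' < h w" if "t \<in> trs D" "w \<in> set (ttop D t)" "w' \<in> set (tbot D t)" for t w w'
  proof (cases "\<exists>s\<in>trs D. w' \<in> set (ttop D s)")
    case True
    then obtain s where "s \<in> trs D" "w' \<in> set (ttop D s)" by blast
    with that show ?thesis using \<rho> [of s t] by (auto simp: h)
  next
    case False
    then have "h w' = 0" by (simp add: h_def)
    with h [OF that(1,2)] show ?thesis by simp
  qed
  then show thesis by (rule that)
qed

lemma steps_to_bottom:
  assumes "st s"
  shows "\<exists>w\<in>set (fbot D). \<exists>q. steps D s (w, q)"
proof -
  obtain h :: "nat \<Rightarrow> nat" where
    h: "\<And>t w w'. t \<in> trs D \<Longrightarrow> w \<in> set (ttop D t) \<Longrightarrow> w' \<in> set (tbot D t) \<Longrightarrow> h w' < h w"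
    using step_rankE by blast
  have h_step: "step D s s' \<Longrightarrow> h (fst s') < h (fst s)" for s s'
    by (induction rule: step.induct) (auto intro!: h)
  show ?thesis using assms
  proof (induction "h (fst s)" arbitrary: s rule: less_induct)
    case less
    obtain w p where s: "s = (w, p)" by fastforce
    show ?case
    proof (cases "w \<in> set (fbot D)")
      case False
      then obtain s' where s': "step D s s'" using step_progress less.prems s by blast
      with less.prems have "st s'" using step_st by blast
      with less.hyps [OF h_step [OF s']] show ?thesis
        using s' by (meson converse_rtranclp_into_rtranclp)
    qed (use s in auto)
  qed
qed

text \<open>Steps are deterministic and none leaves a wire at the bottom of the frame, so two runs
  from the same state that arrive there end in the same state.\<close>

lemma steps_bottom_unique:
  assumes "steps D s (w, q)" "w \<in> set (fbot D)" "steps D s (w', q')" "w' \<in> set (fbot D)"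
  shows "w = w' \<and> q = q'"
proof -
  have stuck: "s' = (w, q)" if "w \<in> set (fbot D)" "steps D (w, q) s'" for w q s'
    using that(2)
  proof (cases rule: converse_rtranclpE)
    case (step y)
    then show ?thesis using that(1) step_source attached_frame [OF bot_att] by blast
  qed simp
  have "steps D s1 s2" if "steps D s s1" "steps D s s2" "\<And>s'. steps D s2 s' \<Longrightarrow> s' = s2" for s1 s2
    using that(1)
  proof (induction rule: rtranclp_induct)
    case base
    then show ?case by (rule that)
  next
    case (step y z)
    from \<open>steps D y s2\<close> show ?case
    proof (cases rule: converse_rtranclpE)
      case base
      with step show ?thesis using that(3) [of z] by auto
    next
      case (step y')
      with \<open>step D y z\<close> show ?thesis using step_det by blast
    qed
  qed
  from this [OF assms(1,3)] stuck [OF assms(4)] stuck [OF assms(2)] show ?thesis by blast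
qed

text \<open>A run touches only finitely many steps of its path. The invariant says that so far
  \<open>u\<close> has been replaced by \<open>v\<close>, both leading to the same letter, and that
  the untouched rest may be exchanged for any other.\<close>

lemma steps_local:
  assumes "steps D (w, p) (w', q)" "st (w, p)"
  shows "\<exists>u v r. node (lab D w) u \<and> node (lab D w') v \<and> lbl (lab D w) u = lbl (lab D w') v \<and>
     ends (lbl (lab D w) u) r \<and> p = app u r \<and> q = app v r \<and>
     (\<forall>r. steps D (w, app u r) (w', app v r))"
  using assms(1)
proof (induction "(w', q)" arbitrary: w' q rule: rtranclp_induct)
  case base
  then show ?case using assms(2) by (intro exI [of _ "[]"] exI [of _ p]) (auto simp: st_def)
next
  case (step y w'' q')
  obtain w' q where y: "y = (w', q)" by fastforce
  from step.hyps(3) [OF y] obtain u v r where IH: "node (lab D w) u" "node (lab D w') v"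
    "lbl (lab D w) u = lbl (lab D w') v" "ends (lbl (lab D w) u) r" "p = app u r" "q = app v r"
    "\<And>r. steps D (w, app u r) (w', app v r)" by blast
  from step.hyps(2) [unfolded y step_iff] consider
    (split) t i where "t \<in> trs D" "ttop D t = [w']" "i < length (tbot D t)" "w'' = tbot D t ! i" "q = scons i q'"
  | (merge) t i where "t \<in> trs D" "tbot D t = [w'']" "i < length (ttop D t)" "w' = ttop D t ! i" "q' = scons i q"
    by blast
  then show ?case
  proof cases
    case split
    note q = split(5) and w'' = split(4)
    from split have len: "i < length (ch (lab D w'))" and lab: "lab D w'' = ch (lab D w') ! i"
      using singleton_top_split [of t w'] singleton_top_nth [of t w' i] w'' by simp_all
    show ?thesis
    \<comment> \<open>A split takes the first step off \<open>v\<close>. If \<open>v\<close> is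
      empty, that step comes from the untouched rest, and \<open>u\<close> has to be lengthened by
      it.\<close>
    proof (cases v)
      case Nil
      with IH q obtain r' where r: "r = scons i r'" "q' = r'" by auto
      have "steps D (w, app (u @ [i]) r) (w'', app [] r)" for r
        using IH(7) [of "scons i r"] Nil split
        by (auto intro!: rtranclp.rtrancl_into_rtrancl [where r = "step D", OF _ step.split])
      moreover have "node (lab D w) (u @ [i])" "node (lab D w'') []" using IH len Nil by auto
      moreover have "lbl (lab D w) (u @ [i]) = lbl (lab D w'') []" using IH lab Nil by auto
      moreover have "ends (lbl (lab D w) (u @ [i])) r'" using IH r len Nil by auto
      moreover have "p = app (u @ [i]) r'" "q' = app [] r'" using IH r by auto
      ultimately show ?thesis by blast
    next
      case (Cons j v')
      with IH q have [simp]: "j = i" and q': "q' = app v' r" by auto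
      have "steps D (w, app u r) (w'', app v' r)" for r
        using IH(7) [of r] Cons split
        by (auto intro!: rtranclp.rtrancl_into_rtrancl [where r = "step D", OF _ step.split])
      moreover have "node (lab D w'') v'" "lbl (lab D w) u = lbl (lab D w'') v'"
        using IH Cons lab by auto
      ultimately show ?thesis using IH q' by blast
    qed
  next
    case merge
    note q' = merge(5) and w' = merge(4)
    from merge have len: "i < length (ch (lab D w''))" and lab: "lab D w' = ch (lab D w'') ! i"
      using singleton_bot_merge [of t w''] singleton_bot_nth [of t w'' i] w' by simp_all
    have "steps D (w, app u r) (w'', app (i # v) r)" for r
      using IH(7) [of r] merge
      by (auto intro!: rtranclp.rtrancl_into_rtrancl [where r = "step D", OF _ step.merge])
    moreover have "node (lab D w'') (i # v)" "lbl (lab D w) u = lbl (lab D w'') (i # v)"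
      using IH len lab by auto
    moreover have "q' = app (i # v) r" using q' IH by simp
    ultimately show ?thesis using IH by blast
  qed
qed

end

text \<open>The two parts share exactly the wires on the frame \<open>f'\<close> of the second.
  These are already attached in the first part, so only \<open>f\<close> remains as a frame.\<close>

lemma attached_union:
  assumes "attached T f b W" "attached T' f' b W'" "W \<inter> W' = set f'" "T \<inter> T' = {}"
  shows "attached (T \<union> T') f b (W \<union> W')"
proof -
  have cross: "set (b s) \<inter> set (b t) = {}" if "s \<in> T" "t \<in> T'" for s t
    using assms that unfolding attached_def by blast
  have same: "set (b s) \<inter> set (b t) = {}" if "attached U g b V" "s \<in> U" "t \<in> U" "s \<noteq> t" for U g V s t
    using that unfolding attached_def by blast
  have "set f \<inter> set (b t) = {}" if "t \<in> T'" for t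
    using assms that unfolding attached_def by blast
  moreover have "W \<union> W' = set f \<union> (\<Union>t\<in>T \<union> T'. set (b t))"
    using assms by (auto simp: attached_def)
  moreover have "set (b s) \<inter> set (b t) = {}" if "s \<in> T \<union> T'" "t \<in> T \<union> T'" "s \<noteq> t" for s t
    using that cross [of s t] cross [of t s] same [OF assms(1), of s t] same [OF assms(2), of s t]
    by (auto simp: Int_commute)
  ultimately show ?thesis
    using assms(1,2) unfolding attached_def by auto
qed

locale rooted_presentation = presentation +
  fixes x
  assumes root: "x \<in> S"
begin

abbreviation "WW \<equiv> diagrams_ww S R [x]"

lemma WW_valid: "D \<in> WW \<Longrightarrow> valid_diag S R D"
  by (simp add: diagrams_ww_def)

lemma WW_diagram: "D \<in> WW \<Longrightarrow> diagram ch S R D"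
  by unfold_locales (rule WW_valid)

lemma WW_iff:
  "D \<in> WW \<longleftrightarrow> valid_diag S R D \<and> (\<exists>w. ftop D = [w] \<and> lab D w = x) \<and> (\<exists>w. fbot D = [w] \<and> lab D w = x)"
  by (auto simp: diagrams_ww_def top_label_def bot_label_def)

lemma flip_WW [simp]: "flip D \<in> WW \<longleftrightarrow> D \<in> WW"
  by (auto simp: WW_iff)

lemma run_ends:
  assumes "D \<in> WW" "run D p q"
  shows "ends x p \<longleftrightarrow> ends x q"
proof -
  interpret diagram ch S R D using assms(1) by (rule WW_diagram)
  show ?thesis
    using steps_st [of "(hd (ftop D), p)" "(hd (fbot D), q)"] assms wires_in(3,4)
    by (fastforce simp: run_def st_def WW_iff)
qed

lemma run_total:
  assumes "D \<in> WW" "ends x p"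
  shows "\<exists>q. run D p q"
proof -
  interpret diagram ch S R D using assms(1) by (rule WW_diagram)
  from assms(1) obtain w w' where w: "ftop D = [w]" "lab D w = x" "fbot D = [w']"
    by (auto simp: WW_iff)
  then have "st (w, p)" using assms(2) wires_in(3) [of w] by (auto simp: st_def)
  from steps_to_bottom [OF this] w show ?thesis by (auto simp: run_def)
qed

lemma run_functional:
  assumes "D \<in> WW" "run D p q" "run D p q'"
  shows "q = q'"
proof -
  interpret diagram ch S R D using assms(1) by (rule WW_diagram)
  from assms obtain w where "fbot D = [w]" by (auto simp: WW_iff)
  with steps_bottom_unique [of _ w q w q'] assms(2,3) show ?thesis by (auto simp: run_def)
qed

lemma run_injective:
  assumes "D \<in> WW" "run D p q" "run D p' q"
  shows "p = p'"
  using run_functional [of "flip D" q p p'] assms by (simp add: run_flip)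

lemma run_local:
  assumes "D \<in> WW" "ends x p" "run D p q"
  shows "\<exists>u v r. node x u \<and> node x v \<and> lbl x u = lbl x v \<and> ends (lbl x u) r \<and>
     p = app u r \<and> q = app v r \<and> (\<forall>r. run D (app u r) (app v r))"
proof -
  interpret diagram ch S R D using assms(1) by (rule WW_diagram)
  from assms(1) obtain w w' where w: "ftop D = [w]" "lab D w = x" "fbot D = [w']" "lab D w' = x"
    by (auto simp: WW_iff)
  then have "st (w, p)" using assms(2) wires_in(3) [of w] by (auto simp: st_def)
  from steps_local [OF _ this, of w' q] assms(3) show ?thesis by (simp add: run_def w)
qed

subsection \<open>Equivalence of diagrams\<close>

lemma steps_map:
  assumes "\<And>s s'. step D s s' \<Longrightarrow> steps D' (g s) (g s')" "steps D s s'"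
  shows "steps D' (g s) (g s')"
  using assms(2) by (induction rule: rtranclp_induct) (auto dest: assms(1))

lemma diag_iso_run:
  assumes "diag_iso D D'" "D \<in> WW" "run D p q"
  shows "run D' p q"
proof -
  obtain \<sigma> \<tau> where iso: "bij_betw \<sigma> (trs D) (trs D')" "ftop D' = map \<tau> (ftop D)" "fbot D' = map \<tau> (fbot D)"
    "\<And>t. t \<in> trs D \<Longrightarrow> ttop D' (\<sigma> t) = map \<tau> (ttop D t) \<and> tbot D' (\<sigma> t) = map \<tau> (tbot D t)"
    using assms(1) unfolding diag_iso_def by blast
  have "step D' (\<tau> (fst s), snd s) (\<tau> (fst s'), snd s')" if "step D s s'" for s s'
    using that
  proof cases
    case (split t w i p)
    then show ?thesis using iso(4) [of t] bij_betwE [OF iso(1)] step.split [of "\<sigma> t" D' "\<tau> w" i p]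
      by auto
  next
    case (merge t w i p)
    then show ?thesis using iso(4) [of t] bij_betwE [OF iso(1)] step.merge [of "\<sigma> t" D' "\<tau> w" i p]
      by auto
  qed
  then have "steps D' (\<tau> (fst s), snd s) (\<tau> (fst s'), snd s')" if "steps D s s'" for s s'
    using that steps_map [of D D' "\<lambda>s. (\<tau> (fst s), snd s)"] by blast
  from this [of "(hd (ftop D), p)" "(hd (fbot D), q)"] show ?thesis
    using assms(2,3) iso(2,3) by (auto simp: run_def WW_iff)
qed

text \<open>The two renamings are controlled only on existing transistors and wires. Validity
  guarantees that the attachment lists mention nothing else, so the inverse renamings undo
  them.\<close>

lemma diag_iso_sym:
  assumes "diag_iso D D'" "valid_diag S R D"
  shows "diag_iso D' D"
proof -
  interpret diagram ch S R D using assms(2) by unfold_locales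
  obtain \<sigma> \<tau> where iso: "bij_betw \<sigma> (trs D) (trs D')" "bij_betw \<tau> (wrs D) (wrs D')"
    "ftop D' = map \<tau> (ftop D)" "fbot D' = map \<tau> (fbot D)" "\<And>w. w \<in> wrs D \<Longrightarrow> lab D' (\<tau> w) = lab D w"
    "\<And>t. t \<in> trs D \<Longrightarrow> ttop D' (\<sigma> t) = map \<tau> (ttop D t) \<and> tbot D' (\<sigma> t) = map \<tau> (tbot D t)"
    using assms(1) unfolding diag_iso_def by blast
  define \<sigma>' \<tau>' where "\<sigma>' = inv_into (trs D) \<sigma>" and "\<tau>' = inv_into (wrs D) \<tau>"
  have bij: "bij_betw \<sigma>' (trs D') (trs D)" "bij_betw \<tau>' (wrs D') (wrs D)"
    using iso(1,2) by (simp_all add: \<sigma>'_def \<tau>'_def bij_betw_inv_into)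
  have \<tau>': "\<tau>' (\<tau> w) = w" if "w \<in> wrs D" for w
    unfolding \<tau>'_def using that iso(2) by (simp add: bij_betw_inv_into_left)
  have \<tau>'_map: "map \<tau>' (map \<tau> ws) = ws" if "set ws \<subseteq> wrs D" for ws
    using that \<tau>' by (induction ws) auto
  have \<sigma>': "\<exists>t'\<in>trs D. t = \<sigma> t' \<and> \<sigma>' t = t'" if "t \<in> trs D'" for t
    using that iso(1) bij(1) unfolding \<sigma>'_def by (metis bij_betwE bij_betw_inv_into_right)
  have tt: "ttop D (\<sigma>' t) = map \<tau>' (ttop D' t) \<and> tbot D (\<sigma>' t) = map \<tau>' (tbot D' t)" if t: "t \<in> trs D'" for t
  proof -
    obtain t' where t': "t' \<in> trs D" "t = \<sigma> t'" "\<sigma>' t = t'" using \<sigma>' [OF t] by blast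
    have "set (ttop D t') \<subseteq> wrs D" "set (tbot D t') \<subseteq> wrs D"
      using wires_in(1,2) [OF t'(1)] by auto
    with t' iso(6) [OF t'(1)] \<tau>'_map show ?thesis by simp
  qed
  have "lab D (\<tau>' w) = lab D' w" if w: "w \<in> wrs D'" for w
  proof -
    have "\<tau>' w \<in> wrs D" "\<tau> (\<tau>' w) = w"
      using w bij(2) iso(2) by (auto simp: \<tau>'_def bij_betw_inv_into_right bij_betwE)
    with iso(5) show ?thesis by metis
  qed
  moreover have "ftop D = map \<tau>' (ftop D')" "fbot D = map \<tau>' (fbot D')"
    unfolding iso(3,4) by (rule \<tau>'_map [symmetric], use wires_in(3,4) in blast)+
  ultimately show ?thesis
    unfolding diag_iso_def using bij tt by blast
qed

end

section \<open>Removal of a dipole: validity and effect on paths\<close>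

lemma distinct_map_of_zip_nth:
  assumes "distinct xs" "length xs = length ys" "k < length xs"
  shows "map_of (zip xs ys) (xs ! k) = Some (ys ! k)"
  using assms by (simp add: map_of_zip_nth)

locale dipole = diagram +
  fixes t1 t2
  assumes dip: "is_dipole D t1 t2"
begin

lemma dipole_trs: "t1 \<in> trs D" "t2 \<in> trs D" "t1 \<noteq> t2"
  and dipole_lab: "map (lab D) (tbot D t1) = map (lab D) (ttop D t2)"
  and dipole_mid: "tbot D t2 = ttop D t1" "ttop D t1 \<noteq> []"
  using dip by (auto simp: is_dipole_def diag_prec_def)

lemma dipole_length: "length (tbot D t1) = length (ttop D t2)"
  using dipole_lab by (rule map_eq_imp_length_eq)

abbreviation "glue \<equiv> dipole_glue D t1 t2"

lemma glue_nth: "k < length (tbot D t1) \<Longrightarrow> glue (tbot D t1 ! k) = ttop D t2 ! k"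
  using top_att dipole_trs dipole_length
  by (simp add: dipole_glue_def attached_def distinct_map_of_zip_nth)

lemma glue_other: "w \<notin> set (tbot D t1) \<Longrightarrow> glue w = w"
  using dipole_length by (simp add: dipole_glue_def map_of_zip_is_None [THEN iffD2])

lemma glue_lab: "lab D (glue w) = lab D w"
proof (cases "w \<in> set (tbot D t1)")
  case True
  then obtain k where "k < length (tbot D t1)" "w = tbot D t1 ! k" by (metis in_set_conv_nth)
  then show ?thesis using dipole_lab dipole_length glue_nth by (metis nth_map)
qed (simp add: glue_other)

lemma glue_image: "glue ` set (tbot D t1) = set (ttop D t2)"
proof -
  have "map glue (tbot D t1) = ttop D t2"
    by (rule nth_equalityI) (simp_all add: glue_nth dipole_length)
  then show ?thesis by (metis set_map)
qed

lemma glue_inj: "inj_on glue (set (tbot D t1))"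
proof (rule inj_onI)
  fix v w assume vw: "v \<in> set (tbot D t1)" "w \<in> set (tbot D t1)" "glue v = glue w"
  then obtain j k where "j < length (tbot D t1)" "k < length (tbot D t1)" "v = tbot D t1 ! j" "w = tbot D t1 ! k"
    by (metis in_set_conv_nth)
  with vw(3) glue_nth dipole_length attached_nth_inject [OF bot_att dipole_trs(2) dipole_trs(2), of j k]
  show "v = w" by simp
qed

lemma reduce_simps [simp]:
  "trs (reduce_dipole D t1 t2) = trs D - {t1, t2}"
  "wrs (reduce_dipole D t1 t2) = wrs D - set (tbot D t2) - set (tbot D t1)"
  "lab (reduce_dipole D t1 t2) = lab D" "ftop (reduce_dipole D t1 t2) = ftop D"
  "tbot (reduce_dipole D t1 t2) = tbot D" "fbot (reduce_dipole D t1 t2) = map glue (fbot D)"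
  "ttop (reduce_dipole D t1 t2) t = map glue (ttop D t)"
  by (simp_all add: reduce_dipole_def)

text \<open>The wires above \<open>t2\<close> survive and inherit the lower ends of the wires below
  \<open>t1\<close>; the latter vanish together with the wires between the two transistors.\<close>

lemma reduce_valid:
  assumes "ftop D \<noteq> []"
  shows "valid_diag S R (reduce_dipole D t1 t2)"
proof -
  let ?D = "reduce_dipole D t1 t2"
  obtain \<rho> :: "nat \<Rightarrow> nat" where
    \<rho>: "\<And>s t. s \<in> trs D \<Longrightarrow> t \<in> trs D \<Longrightarrow> set (ttop D s) \<inter> set (tbot D t) \<noteq> {} \<Longrightarrow> \<rho> s < \<rho> t"
    using rankE by blast
  have lt: "\<rho> t1 < \<rho> t2" using \<rho> [of t1 t2] dipole_trs dipole_mid by auto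
  have acyc: "set (ttop D t1) \<inter> set (tbot D t1) = {}" "set (ttop D t2) \<inter> set (tbot D t2) = {}"
    "set (ttop D t2) \<inter> set (tbot D t1) = {}"
    using \<rho> [of t1 t1] \<rho> [of t2 t2] \<rho> [of t2 t1] lt dipole_trs
    by (meson less_irrefl less_asym)+
  have tops: "set (ttop D t1) \<inter> set (ttop D t2) = {}" "set (tbot D t1) \<inter> set (tbot D t2) = {}"
    using attached_disjoint [OF bot_att dipole_trs] attached_disjoint [OF top_att dipole_trs] by auto
  have att: "attached (trs ?D) (ftop ?D) (tbot ?D) (wrs ?D)"
    using attached_remove [OF top_att, of "{t1, t2}"] dipole_trs
    by (simp add: Un_commute Diff_eq Int_ac)
  \<comment> \<open>\<open>A\<close> consists of the wires whose lower end does not lie on the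
    dipole. It contains the wires below \<open>t1\<close>, and \<open>glue\<close> turns these into
    the wires above \<open>t2\<close>, which are the ones missing from \<open>A\<close>.\<close>
  define A where "A = wrs D - set (ttop D t1) - set (ttop D t2)"
  have "attached (trs D - {t1, t2}) (fbot D) (ttop D) A"
    using attached_remove [OF bot_att, of "{t1, t2}"] dipole_trs
    by (simp add: A_def Diff_eq Int_ac)
  moreover have "inj_on glue A"
  proof -
    have A: "A = (A - set (tbot D t1)) \<union> (A \<inter> set (tbot D t1))" by blast
    have "glue ` (A - set (tbot D t1)) = A - set (tbot D t1)" by (auto simp: glue_other image_iff)
    moreover have "glue ` (A \<inter> set (tbot D t1)) \<inter> A = {}"
      using glue_image unfolding A_def by blast
    ultimately show ?thesis
      by (subst A, subst inj_on_Un)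
        (auto simp: inj_on_def glue_other dest: inj_onD [OF glue_inj])
  qed
  ultimately have "attached (id ` (trs D - {t1, t2})) (map glue (fbot D)) (ttop ?D) (glue ` A)"
    by (rule attached_image) auto
  moreover have "glue ` A = wrs ?D"
  proof -
    have "set (tbot D t1) \<subseteq> A"
      using acyc tops wires_in(2) dipole_trs unfolding A_def by blast
    then have "A = (A - set (tbot D t1)) \<union> set (tbot D t1)" by blast
    then have "glue ` A = glue ` (A - set (tbot D t1)) \<union> glue ` set (tbot D t1)" by (metis image_Un)
    also have "glue ` (A - set (tbot D t1)) = A - set (tbot D t1)" by (auto simp: glue_other image_iff)
    finally show ?thesis
      using glue_image acyc wires_in(1) dipole_trs dipole_mid unfolding A_def by auto
  qed
  ultimately have batt: "attached (trs ?D) (fbot ?D) (ttop ?D) (wrs ?D)" by simp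
  have "is_split ?D t \<or> is_split (flip ?D) t" if "t \<in> trs ?D" for t
    using that split_or_merge [of t] by (auto simp: is_split_def glue_lab comp_def)
  \<comment> \<open>The old rank still works: across a glued wire, \<open>s\<close> was below
    \<open>t1\<close> and \<open>t\<close> above \<open>t2\<close>, and \<open>t1\<close> is itself
    below \<open>t2\<close>.\<close>
  moreover have "\<rho> s < \<rho> t"
    if st: "s \<in> trs ?D" "t \<in> trs ?D" "set (ttop ?D s) \<inter> set (tbot ?D t) \<noteq> {}" for s t
  proof -
    from st obtain w where w: "w \<in> set (ttop D s)" "glue w \<in> set (tbot D t)" by auto
    show ?thesis
    proof (cases "w \<in> set (tbot D t1)")
      case True
      then have "glue w \<in> set (ttop D t2)" using glue_image by blast
      then show ?thesis using lt \<rho> [of s t1] \<rho> [of t2 t] st w True dipole_trs by fastforce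
    next
      case False
      then show ?thesis using \<rho> [of s t] st w by (auto simp: glue_other)
    qed
  qed
  moreover have "wrs ?D \<noteq> {}"
    using assms att unfolding attached_def by auto
  moreover have "lab ?D ` wrs ?D \<subseteq> S" using lab_in by auto
  ultimately show ?thesis
    unfolding valid_diag_iff using att batt finite_trs finite_wrs
    by (intro conjI exI [of _ \<rho>] ballI impI) simp_all
qed

text \<open>The dipole undoes itself along each path. If the merge is on top, the step it adds is
  taken off again by the split; if the split is on top, the path must have a first step to lose,
  which is where \<open>ends\<close> enters.\<close>

lemma glue_steps:
  assumes "w \<in> set (tbot D t1)" "ends (lab D w) p"
  shows "steps D (glue w, p) (w, p)"
proof -
  obtain k where k: "k < length (tbot D t1)" "w = tbot D t1 ! k"
    using assms(1) by (metis in_set_conv_nth)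
  have gw: "glue w = ttop D t2 ! k" using k glue_nth by simp
  show ?thesis using dipole_trs(1)
  proof (cases rule: singleton_cases)
    case (1 v)
    have "step D (glue w, p) (v, scons k p)"
      unfolding gw by (rule step.merge) (use 1 dipole_trs dipole_mid dipole_length k in auto)
    moreover have "step D (v, scons k p) (w, p)"
      unfolding k by (rule step.split) (use 1 dipole_trs k in auto)
    ultimately show ?thesis by auto
  next
    case (2 v)
    then have "length (ttop D t2) = 1" using dipole_length by simp
    then obtain u where u: "ttop D t2 = [u]" by (auto simp: length_Suc_conv)
    have w: "w = v" "k = 0" "glue w = u" using k 2 gw u by auto
    then have "lab D u = lab D w" using glue_lab by metis
    with singleton_top_split [OF dipole_trs(2) u]
    have "ch (lab D w) \<noteq> []" "length (tbot D t2) = length (ch (lab D w))" by auto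
    with assms(2) obtain i q where iq: "i < length (tbot D t2)" "p = scons i q"
      by (metis ends_branchE)
    have "step D (glue w, p) (tbot D t2 ! i, q)"
      unfolding w(3) iq(2) by (rule step.split) (use u dipole_trs iq in auto)
    moreover have "step D (tbot D t2 ! i, q) (w, p)"
      unfolding dipole_mid w(1) iq(2) by (rule step.merge) (use 2 dipole_trs dipole_mid iq in auto)
    ultimately show ?thesis by auto
  qed
qed

lemma glue_steps':
  assumes "w \<in> wrs D" "ends (lab D w) p"
  shows "steps D (glue w, p) (w, p)"
  using assms glue_steps glue_other by (cases "w \<in> set (tbot D t1)") auto

text \<open>A step of the reduced diagram starts on a possibly glued wire; in \<open>D\<close> it is
  preceded by a passage through the dipole.\<close>

lemma reduce_step:
  assumes "step (reduce_dipole D t1 t2) s s'" "diagram.st ch (reduce_dipole D t1 t2) s" "ftop D \<noteq> []"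
  shows "steps D s s'"
proof -
  interpret D': diagram ch S R "reduce_dipole D t1 t2"
    using reduce_valid [OF assms(3)] by unfold_locales
  from assms(1) show ?thesis
  proof cases
    case (split t w i p)
    then obtain v where v: "ttop D t = [v]" "w = glue v" "t \<in> trs D" by auto
    have "v \<in> wrs D" "ends (lab D v) (scons i p)"
      using v split assms(2) wires_in(1) [of t v] by (auto simp: D'.st_def glue_lab)
    then have "steps D (w, scons i p) (v, scons i p)" unfolding v(2) by (rule glue_steps')
    also have "step D (v, scons i p) (tbot D t ! i, p)"
      by (rule step.split) (use v split in auto)
    finally show ?thesis using split by simp
  next
    case (merge t w i p)
    then have t: "t \<in> trs D" "tbot D t = [w]" "i < length (ttop D t)" "s = (glue (ttop D t ! i), p)" by auto
    have "ttop D t ! i \<in> wrs D" "ends (lab D (ttop D t ! i)) p"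
      using t assms(2) wires_in(1) [of t "ttop D t ! i"] by (auto simp: D'.st_def glue_lab)
    then have "steps D s (ttop D t ! i, p)" unfolding t(4) by (rule glue_steps')
    also have "step D (ttop D t ! i, p) (w, scons i p)"
      by (rule step.merge) (use t in auto)
    finally show ?thesis using merge by simp
  qed
qed

end

context rooted_presentation
begin

lemma reduce_WW:
  assumes "D \<in> WW" "is_dipole D t1 t2"
  shows "reduce_dipole D t1 t2 \<in> WW"
proof -
  interpret dipole ch S R D t1 t2
    using assms by unfold_locales (auto simp: WW_iff)
  show ?thesis using reduce_valid assms by (auto simp: WW_iff glue_lab)
qed

lemma reduce_run:
  assumes "D \<in> WW" "is_dipole D t1 t2" "ends x p" "run (reduce_dipole D t1 t2) p q"
  shows "run D p q"
proof -
  interpret dipole ch S R D t1 t2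
    using assms by unfold_locales (auto simp: WW_iff)
  let ?D = "reduce_dipole D t1 t2"
  have ne: "ftop D \<noteq> []" using assms(1) by (auto simp: WW_iff)
  have D': "?D \<in> WW" using assms(1,2) by (rule reduce_WW)
  interpret D': diagram ch S R ?D using D' by (rule WW_diagram)
  have sim: "steps D s s'" if "steps ?D s s'" "D'.st s" for s s'
    using that
  proof (induction rule: rtranclp_induct)
    case (step y z)
    then have "D'.st y" using D'.steps_st by blast
    with step reduce_step [OF _ _ ne, of y z] show ?case by (meson rtranclp_trans)
  qed simp
  obtain a b where ab: "ftop D = [a]" "lab D a = x" "fbot D = [b]" "lab D b = x"
    using assms(1) by (auto simp: WW_iff)
  have "D'.st (a, p)" using D'.wires_in(3) [of a] ab assms(3) by (auto simp: D'.st_def)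
  then have "steps D (a, p) (glue b, q)" using sim assms(4) ab by (auto simp: run_def)
  \<comment> \<open>The wire at the bottom of the frame may itself have been glued; the run in
    \<open>D\<close> then still has to cross the dipole.\<close>
  moreover have "ends x q" using run_ends [OF D' assms(4)] assms(3) by blast
  then have "steps D (glue b, q) (b, q)"
    using glue_steps' [of b q] ab wires_in(4) [of b] by auto
  ultimately show ?thesis using ab by (simp add: run_def)
qed

text \<open>\<open>f\<close> is constrained on the paths from \<open>x\<close> only; its other
  values are arbitrary.\<close>

definition realizes :: "'a bdiag \<Rightarrow> ((nat \<Rightarrow> nat) \<Rightarrow> nat \<Rightarrow> nat) \<Rightarrow> bool" where
  "realizes D f \<longleftrightarrow> D \<in> WW \<and> (\<forall>p\<in>E x. run D p (f p))"

lemma realizesD: "realizes D f \<Longrightarrow> ends x p \<Longrightarrow> run D p q \<longleftrightarrow> q = f p"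
  unfolding realizes_def using run_functional by blast

lemma realizes_iso: "realizes D f \<Longrightarrow> diag_iso D D' \<Longrightarrow> D' \<in> WW \<Longrightarrow> realizes D' f"
  by (auto simp: realizes_def diag_iso_run)

text \<open>Only runs of the reduced diagram have been simulated. The converse is free: the reduced
  diagram runs on every path, and the result must agree with that of the deterministic
  \<open>D\<close>.\<close>

lemma realizes_reduce:
  assumes "D \<in> WW" "is_dipole D t1 t2"
  shows "realizes (reduce_dipole D t1 t2) f \<longleftrightarrow> realizes D f"
proof
  assume f: "realizes D f"
  have "run (reduce_dipole D t1 t2) p (f p)" if "ends x p" for p
    using run_total [OF reduce_WW [OF assms] that] reduce_run [OF assms that] realizesD [OF f that] by metis
  then show "realizes (reduce_dipole D t1 t2) f" using reduce_WW [OF assms] by (simp add: realizes_def)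
qed (use assms in \<open>auto simp: realizes_def intro: reduce_run\<close>)

lemma realizes_equiv:
  assumes "(D, D') \<in> diag_equiv S R [x]" "realizes D f"
  shows "realizes D' f"
  using assms unfolding diag_equiv_def
proof (induction rule: rtrancl_induct)
  case (step y z)
  then have "y \<in> WW" "z \<in> WW" "realizes y f" "diag_iso y z \<or> dipole_red y z \<or> dipole_red z y" by auto
  then show ?case using realizes_iso realizes_reduce unfolding dipole_red_def by blast
qed simp

lemma diag_equiv_sym: "(D, D') \<in> diag_equiv S R [x] \<Longrightarrow> (D', D) \<in> diag_equiv S R [x]"
  unfolding diag_equiv_def
  by (erule symD [OF sym_rtrancl, rotated]) (auto simp: sym_def intro: diag_iso_sym dest: WW_valid)

lemma diag_equiv_trans:
  "(D, D') \<in> diag_equiv S R [x] \<Longrightarrow> (D', D'') \<in> diag_equiv S R [x] \<Longrightarrow> (D, D'') \<in> diag_equiv S R [x]"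
  unfolding diag_equiv_def by (rule rtrancl_trans)

definition dipole_free :: "'a bdiag \<Rightarrow> bool" where
  "dipole_free D \<longleftrightarrow> (\<nexists>t1 t2. is_dipole D t1 t2)"

text \<open>Each removal of a dipole lowers the number of transistors, so reduction terminates; its
  outcome need not be known to be unique here.\<close>

lemma dipole_free_representative:
  assumes "realizes D f"
  shows "\<exists>D'. realizes D' f \<and> dipole_free D' \<and> (D, D') \<in> diag_equiv S R [x]"
  using assms
proof (induction "card (trs D)" arbitrary: D rule: less_induct)
  case less
  show ?case
  proof (cases "dipole_free D")
    case False
    then obtain t1 t2 where dip: "is_dipole D t1 t2" by (auto simp: dipole_free_def)
    have D: "D \<in> WW" using less.prems by (simp add: realizes_def)
    let ?D = "reduce_dipole D t1 t2"
    have "t1 \<in> trs D" "finite (trs D)" using dip D by (auto simp: is_dipole_def WW_iff valid_diag_iff)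
    then have "card (trs ?D) < card (trs D)"
      by (intro psubset_card_mono) (auto simp: reduce_dipole_def)
    moreover have D': "realizes ?D f" using realizes_reduce [OF D dip] less.prems by blast
    ultimately obtain D' where "realizes D' f" "dipole_free D'" "(?D, D') \<in> diag_equiv S R [x]"
      using less.hyps by blast
    moreover have "(D, ?D) \<in> diag_equiv S R [x]"
      unfolding diag_equiv_def using D reduce_WW [OF D dip] dip
      by (intro r_into_rtrancl) (auto simp: dipole_red_def)
    ultimately show ?thesis using diag_equiv_trans by blast
  qed (use less.prems in \<open>auto simp: diag_equiv_def\<close>)
qed

subsection \<open>Concatenation\<close>

text \<open>The copies of \<open>D1\<close> and \<open>D2\<close> share a single wire, the exit
  \<open>b1\<close> of the one and the entrance \<open>a2\<close> of the other. A run crosses it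
  unchanged, so the two actions are composed.\<close>

lemma
  assumes "D1 \<in> WW" "D2 \<in> WW"
  shows concat_WW: "diag_concat D1 D2 \<in> WW"
    and concat_run: "run D1 p q \<Longrightarrow> run D2 q r \<Longrightarrow> run (diag_concat D1 D2) p r"
proof -
  interpret D1: diagram ch S R D1 using assms(1) by (rule WW_diagram)
  interpret D2: diagram ch S R D2 using assms(2) by (rule WW_diagram)
  obtain a1 b1 where ab1: "ftop D1 = [a1]" "lab D1 a1 = x" "fbot D1 = [b1]" "lab D1 b1 = x"
    using assms(1) by (auto simp: WW_iff)
  obtain a2 b2 where ab2: "ftop D2 = [a2]" "lab D2 a2 = x" "fbot D2 = [b2]" "lab D2 b2 = x"
    using assms(2) by (auto simp: WW_iff)
  have in_wrs: "b1 \<in> wrs D1" "a2 \<in> wrs D2"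
    using D1.wires_in(4) [of b1] D2.wires_in(3) [of a2] ab1 ab2 by auto
  let ?C = "diag_concat D1 D2" and ?cw = "concat_wire D1 D2"
  have cw: "?cw w = (if w = a2 then 2 * b1 else 2 * w + 1)" for w
    by (simp add: concat_wire_def ab1 ab2)
  have inj_cw: "inj_on ?cw A" for A
  proof (rule inj_onI)
    fix v w assume "?cw v = ?cw w"
    then show "v = w"
      unfolding cw by (cases "v = a2"; cases "w = a2") (simp_all, presburger+)
  qed
  have C_simps: "trs ?C = (\<lambda>t. 2 * t) ` trs D1 \<union> (\<lambda>t. 2 * t + 1) ` trs D2"
    "wrs ?C = (\<lambda>w. 2 * w) ` wrs D1 \<union> ?cw ` wrs D2"
    "ftop ?C = map (\<lambda>w. 2 * w) (ftop D1)" "fbot ?C = map ?cw (fbot D2)"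
    "\<And>t. ttop ?C (2 * t) = map (\<lambda>w. 2 * w) (ttop D1 t)" "\<And>t. tbot ?C (2 * t) = map (\<lambda>w. 2 * w) (tbot D1 t)"
    "\<And>t. ttop ?C (Suc (2 * t)) = map ?cw (ttop D2 t)" "\<And>t. tbot ?C (Suc (2 * t)) = map ?cw (tbot D2 t)"
    "\<And>w. lab ?C (2 * w) = lab D1 w" "\<And>w. lab ?C (?cw w) = lab D2 w"
    by (auto simp: diag_concat_def cw ab1 ab2)
  have meet: "(\<lambda>w. 2 * w) ` wrs D1 \<inter> ?cw ` wrs D2 = {2 * b1}"
  proof (intro equalityI subsetI)
    fix y assume "y \<in> (\<lambda>w. 2 * w) ` wrs D1 \<inter> ?cw ` wrs D2"
    then obtain v w where "y = 2 * v" "y = ?cw w" by blast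
    then have "2 * v = ?cw w" by simp
    then have "v = b1" unfolding cw by (cases "w = a2") (simp_all, presburger)
    with \<open>y = 2 * v\<close> show "y \<in> {2 * b1}" by simp
  next
    have "2 * b1 = ?cw a2" by (simp add: cw)
    then have "2 * b1 \<in> ?cw ` wrs D2" using in_wrs by (metis imageI)
    moreover fix y assume "y \<in> {2 * b1}"
    ultimately show "y \<in> (\<lambda>w. 2 * w) ` wrs D1 \<inter> ?cw ` wrs D2" using in_wrs by simp
  qed
  have parity: "(\<lambda>t. 2 * t) ` T \<inter> (\<lambda>t. 2 * t + 1) ` T' = {}" for T T' :: "nat set"
    by (auto simp: image_iff) presburger
  have top: "attached (trs ?C) (ftop ?C) (tbot ?C) (wrs ?C)"
    unfolding C_simps(1-4)
  proof (rule attached_union)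
    show "attached ((\<lambda>t. 2 * t) ` trs D1) (map (\<lambda>w. 2 * w) (ftop D1)) (tbot ?C) ((\<lambda>w. 2 * w) ` wrs D1)"
      using D1.top_att by (rule attached_image) (auto simp: inj_on_def C_simps)
    show "attached ((\<lambda>t. 2 * t + 1) ` trs D2) (map ?cw (ftop D2)) (tbot ?C) (?cw ` wrs D2)"
      using D2.top_att inj_cw by (rule attached_image) (auto simp: inj_on_def C_simps)
  qed (use meet parity ab2 cw in auto)
  have bot: "attached (trs ?C) (fbot ?C) (ttop ?C) (wrs ?C)"
    \<comment> \<open>For the lower ends the roles are exchanged: the bottom of the frame of
      \<open>D2\<close> remains, that of \<open>D1\<close> is absorbed.\<close>
    unfolding C_simps(1-4) Un_commute [of "(\<lambda>w. 2 * w) ` _"]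
  proof (rule attached_union)
    show "attached ((\<lambda>t. 2 * t) ` trs D1) (map (\<lambda>w. 2 * w) (fbot D1)) (ttop ?C) ((\<lambda>w. 2 * w) ` wrs D1)"
      using D1.bot_att by (rule attached_image) (auto simp: inj_on_def C_simps)
    show "attached ((\<lambda>t. 2 * t + 1) ` trs D2) (map ?cw (fbot D2)) (ttop ?C) (?cw ` wrs D2)"
      using D2.bot_att inj_cw by (rule attached_image) (auto simp: inj_on_def C_simps)
  qed (use meet parity [of "trs D1" "trs D2"] ab1 in \<open>auto simp: Int_commute\<close>)
  have splits: "is_split ?C t \<or> is_split (flip ?C) t" if "t \<in> trs ?C" for t
  proof -
    from that consider s where "s \<in> trs D1" "t = 2 * s" | s where "s \<in> trs D2" "t = Suc (2 * s)"
      by (auto simp: C_simps)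
    then show ?thesis
    proof cases
      case 1
      from D1.split_or_merge [OF 1(1)] show ?thesis
        by (auto simp: is_split_def 1 C_simps comp_def)
    next
      case 2
      from D2.split_or_merge [OF 2(1)] show ?thesis
        by (auto simp: is_split_def 2 C_simps comp_def)
    qed
  qed
  have rank: "\<exists>\<rho>::nat \<Rightarrow> nat. \<forall>s\<in>trs ?C. \<forall>t\<in>trs ?C. set (ttop ?C s) \<inter> set (tbot ?C t) \<noteq> {} \<longrightarrow> \<rho> s < \<rho> t"
  proof -
    obtain \<rho>1 :: "nat \<Rightarrow> nat" where \<rho>1: "\<And>s t. s \<in> trs D1 \<Longrightarrow> t \<in> trs D1 \<Longrightarrow>
        set (ttop D1 s) \<inter> set (tbot D1 t) \<noteq> {} \<Longrightarrow> \<rho>1 s < \<rho>1 t"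
      using D1.rankE by blast
    obtain \<rho>2 :: "nat \<Rightarrow> nat" where \<rho>2: "\<And>s t. s \<in> trs D2 \<Longrightarrow> t \<in> trs D2 \<Longrightarrow>
        set (ttop D2 s) \<inter> set (tbot D2 t) \<noteq> {} \<Longrightarrow> \<rho>2 s < \<rho>2 t"
      using D2.rankE by blast
    obtain K where K: "\<And>t. t \<in> trs D2 \<Longrightarrow> \<rho>2 t < K"
      using D2.finite_trs finite_nat_set_iff_bounded [of "\<rho>2 ` trs D2"] by auto
    \<comment> \<open>\<open>D1\<close> lies on top, so its ranks are lifted above the bound
      \<open>K\<close> of all ranks of \<open>D2\<close>.\<close>
    define \<rho> where "\<rho> t = (if even t then K + \<rho>1 (t div 2) else \<rho>2 (t div 2))" for t
    have \<rho>: "\<rho> (2 * t) = K + \<rho>1 t" "\<rho> (Suc (2 * t)) = \<rho>2 t" for t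
      by (simp_all add: \<rho>_def)
    have "\<rho> s < \<rho> t" if "s \<in> trs ?C" "t \<in> trs ?C" "set (ttop ?C s) \<inter> set (tbot ?C t) \<noteq> {}" for s t
    proof -
      from that(1,2) consider
        (1) s' t' where "s' \<in> trs D1" "s = 2 * s'" "t' \<in> trs D1" "t = 2 * t'"
      | (2) s' t' where "s' \<in> trs D2" "s = Suc (2 * s')" "t' \<in> trs D2" "t = Suc (2 * t')"
      | (3) s' t' where "s' \<in> trs D2" "s = Suc (2 * s')" "t' \<in> trs D1" "t = 2 * t'"
      | (4) s' t' where "s' \<in> trs D1" "s = 2 * s'" "t' \<in> trs D2" "t = Suc (2 * t')"
        by (auto simp: C_simps)
      then show ?thesis
      proof cases
        case 1
        then have "set (ttop D1 s') \<inter> set (tbot D1 t') \<noteq> {}" using that(3) by (auto simp: C_simps)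
        with 1 \<rho>1 show ?thesis by (simp add: \<rho>)
      next
        case 2
        with that(3) obtain v w where vw: "v \<in> set (ttop D2 s')" "w \<in> set (tbot D2 t')" "?cw v = ?cw w"
          by (auto simp: C_simps)
        then have "v = w" using inj_onD [OF inj_cw [of UNIV]] by simp
        with vw have "set (ttop D2 s') \<inter> set (tbot D2 t') \<noteq> {}" by blast
        with 2 \<rho>2 show ?thesis by (simp add: \<rho>)
      next
        case 3
        then show ?thesis using K [of s'] by (simp add: \<rho>)
      next
        case 4
        \<comment> \<open>A transistor of \<open>D1\<close> below one of \<open>D2\<close> would
          have to be joined to it by the shared wire, but within \<open>D2\<close> that wire starts
          at the frame.\<close>
        with that(3) obtain v w where vw: "v \<in> set (ttop D1 s')" "w \<in> set (tbot D2 t')" "2 * v = ?cw w"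
          by (auto simp: C_simps)
        from vw(3) have "w = a2" unfolding cw by (cases "w = a2") (simp_all, presburger)
        then show ?thesis using attached_frame [OF D2.top_att 4(3)] vw ab2 by auto
      qed
    qed
    then show ?thesis by blast
  qed
  have "lab ?C ` wrs ?C \<subseteq> S" using D1.lab_in D2.lab_in by (auto simp: C_simps)
  then have "valid_diag S R ?C"
    unfolding valid_diag_iff using top bot splits rank D1.finite_trs D2.finite_trs D1.finite_wrs D2.finite_wrs in_wrs
    by (auto simp: C_simps(1,2))
  then show "?C \<in> WW" by (auto simp: WW_iff C_simps ab1 ab2)
  assume "run D1 p q" "run D2 q r"
  then have pq: "steps D1 (a1, p) (b1, q)" and qr: "steps D2 (a2, q) (b2, r)"
    by (simp_all add: run_def ab1 ab2)
  have "step ?C (2 * fst s, snd s) (2 * fst s', snd s')" if "step D1 s s'" for s s'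
    using that
  proof cases
    case (split t w i p)
    then show ?thesis using step.split [of "2 * t" ?C "2 * w" i p] by (auto simp: C_simps)
  next
    case (merge t w i p)
    then show ?thesis using step.merge [of "2 * t" ?C "2 * w" i p] by (auto simp: C_simps)
  qed
  then have "steps ?C (2 * a1, p) (2 * b1, q)"
    using steps_map [of D1 ?C "\<lambda>s. (2 * fst s, snd s)"] pq by fastforce
  moreover have "step ?C (?cw (fst s), snd s) (?cw (fst s'), snd s')" if "step D2 s s'" for s s'
    using that
  proof cases
    case (split t w i p)
    then show ?thesis using step.split [of "Suc (2 * t)" ?C "?cw w" i p] by (auto simp: C_simps)
  next
    case (merge t w i p)
    then show ?thesis using step.merge [of "Suc (2 * t)" ?C "?cw w" i p] by (auto simp: C_simps)
  qed
  then have "steps ?C (?cw a2, q) (?cw b2, r)"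
    using steps_map [of D2 ?C "\<lambda>s. (?cw (fst s), snd s)"] qr by fastforce
  moreover have "?cw a2 = 2 * b1" by (simp add: cw)
  ultimately show "run ?C p r" by (simp add: run_def C_simps ab1 ab2)
qed

end

section \<open>The canonical diagram of a local prefix swap\<close>

context rooted_presentation
begin

definition swaps :: "((nat \<Rightarrow> nat) \<Rightarrow> nat \<Rightarrow> nat) \<Rightarrow> nat list \<Rightarrow> nat list \<Rightarrow> bool" where
  "swaps g u v \<longleftrightarrow> node x u \<and> node x v \<and> lbl x u = lbl x v \<and>
     (\<forall>r. ends (lbl x u) r \<longrightarrow> g (app u r) = app v r)"

definition good :: "((nat \<Rightarrow> nat) \<Rightarrow> nat \<Rightarrow> nat) \<Rightarrow> nat list \<Rightarrow> bool" where
  "good g u \<longleftrightarrow> (\<exists>v. swaps g u v)"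

text \<open>The domain tree of the smallest pair of trees for \<open>g\<close>, obtained by
  splitting as long as no prefix swap appears. Its good members are the leaves;
  \<open>inner_nodes\<close> are the nodes that have to be split.\<close>

definition minimal_nodes :: "((nat \<Rightarrow> nat) \<Rightarrow> nat \<Rightarrow> nat) \<Rightarrow> nat list set" where
  "minimal_nodes g = {u. node x u \<and> (\<forall>v s. u = v @ s \<and> s \<noteq> [] \<longrightarrow> \<not> good g v)}"

definition inner_nodes :: "((nat \<Rightarrow> nat) \<Rightarrow> nat \<Rightarrow> nat) \<Rightarrow> nat list set" where
  "inner_nodes g = {u \<in> minimal_nodes g. \<not> good g u}"

lemma swaps_append: "swaps g u v \<Longrightarrow> node (lbl x u) s \<Longrightarrow> swaps g (u @ s) (v @ s)"
  by (simp add: swaps_def)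

lemma swaps_unique: "swaps g u v \<Longrightarrow> swaps g u v' \<Longrightarrow> v = v'"
  unfolding swaps_def by (metis swap_inject)

lemma minimal_nodes_Nil: "[] \<in> minimal_nodes g"
  by (simp add: minimal_nodes_def)

lemma minimal_nodes_append: "u @ v \<in> minimal_nodes g \<Longrightarrow> u \<in> minimal_nodes g"
  unfolding minimal_nodes_def by auto

lemma minimal_nodes_snoc_iff:
  "u @ [i] \<in> minimal_nodes g \<longleftrightarrow> u \<in> inner_nodes g \<and> i < length (ch (lbl x u))"
proof
  assume L: "u @ [i] \<in> minimal_nodes g"
  then show "u \<in> inner_nodes g \<and> i < length (ch (lbl x u))"
    using minimal_nodes_append [OF L] by (auto simp: minimal_nodes_def inner_nodes_def)
next
  assume R: "u \<in> inner_nodes g \<and> i < length (ch (lbl x u))"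
  have "\<not> good g v" if vs: "u @ [i] = v @ s" "s \<noteq> []" for v s
  proof (cases s rule: rev_cases)
    case (snoc s' j)
    then have "u = v @ s'" using vs by simp
    then show ?thesis using R by (cases "s' = []") (auto simp: inner_nodes_def minimal_nodes_def)
  qed (use vs in simp)
  then show "u @ [i] \<in> minimal_nodes g" using R by (auto simp: minimal_nodes_def inner_nodes_def)
qed

lemma minimal_nodes_induct [consumes 1, case_names Nil snoc]:
  assumes "u \<in> minimal_nodes g" "P []"
    and "\<And>u i. u \<in> inner_nodes g \<Longrightarrow> i < length (ch (lbl x u)) \<Longrightarrow> P u \<Longrightarrow> P (u @ [i])"
  shows "P u"
  using assms(1)
proof (induction u rule: rev_induct)
  case (snoc i u)
  then show ?case using assms(3) by (auto simp: minimal_nodes_snoc_iff inner_nodes_def)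
qed (rule assms(2))

text \<open>Every node but the root hangs below the transistor of its parent. The numberings
  \<open>e\<close> and \<open>c\<close> are left open because the lower tree of the canonical
  diagram borrows wires from the upper one.\<close>

lemma attached_tree:
  assumes "inj_on e (minimal_nodes g)" "inj_on c (inner_nodes g)"
    and "\<And>u. u \<in> inner_nodes g \<Longrightarrow> b (c u) = map (\<lambda>i. e (u @ [i])) [0..<length (ch (lbl x u))]"
  shows "attached (c ` inner_nodes g) [e []] b (e ` minimal_nodes g)"
proof -
  have e: "e u = e v \<longleftrightarrow> u = v" if "u \<in> minimal_nodes g" "v \<in> minimal_nodes g" for u v
    using that assms(1) by (auto simp: inj_on_def)
  have set_b: "set (b (c u)) = (\<lambda>i. e (u @ [i])) ` {..<length (ch (lbl x u))}" if "u \<in> inner_nodes g" for u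
    using assms(3) [OF that] by (auto simp: atLeast0LessThan)
  have "distinct (b (c u))" if "u \<in> inner_nodes g" for u
    using that assms(3) [OF that] by (auto simp: distinct_map inj_on_def e minimal_nodes_snoc_iff)
  moreover have "set [e []] \<inter> set (b (c u)) = {}" if "u \<in> inner_nodes g" for u
    using that by (auto simp: set_b e minimal_nodes_snoc_iff minimal_nodes_Nil)
  moreover have "set (b (c u)) \<inter> set (b (c v)) = {}"
    if "u \<in> inner_nodes g" "v \<in> inner_nodes g" "c u \<noteq> c v" for u v
    using that by (auto simp: set_b e minimal_nodes_snoc_iff)
  moreover have "e ` minimal_nodes g = {e []} \<union> (\<Union>u\<in>inner_nodes g. set (b (c u)))"
  proof -
    have "e u \<in> {e []} \<union> (\<Union>u\<in>inner_nodes g. set (b (c u)))" if "u \<in> minimal_nodes g" for u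
      using that by (cases u rule: rev_cases) (auto simp: set_b minimal_nodes_snoc_iff)
    moreover have "e [] \<in> e ` minimal_nodes g" using minimal_nodes_Nil by blast
    ultimately show ?thesis by (auto simp: set_b minimal_nodes_snoc_iff)
  qed
  ultimately show ?thesis by (auto simp: attached_def)
qed

end

definition tw :: "nat list \<Rightarrow> nat" where "tw u = 2 * to_nat u"
definition ow :: "nat list \<Rightarrow> nat" where "ow u = Suc (2 * to_nat u)"

lemma tw_eq [simp]: "tw u = tw v \<longleftrightarrow> u = v" and ow_eq [simp]: "ow u = ow v \<longleftrightarrow> u = v"
  and tw_ow [simp]: "tw u \<noteq> ow v" "ow u \<noteq> tw v"
  and even_tw [simp]: "even (tw u)" and odd_ow [simp]: "odd (ow v)"
  and tw_div [simp]: "from_nat (tw u div 2) = u" and ow_div [simp]: "from_nat (ow u div 2) = u"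
  unfolding tw_def ow_def by (simp_all, presburger+)

text \<open>The inverse \<open>f'\<close> is carried along so that results on the upper tree, proved
  for \<open>f\<close>, can be reused for the lower tree through
  \<open>inverse_swap_pair\<close>.\<close>

locale swap_pair = rooted_presentation +
  fixes f f'
  assumes f_ends: "ends x p \<Longrightarrow> ends x (f p)" and f'_ends: "ends x p \<Longrightarrow> ends x (f' p)"
    and f'_f: "ends x p \<Longrightarrow> f' (f p) = p" and f_f': "ends x p \<Longrightarrow> f (f' p) = p"
    and local_swap: "ends x p \<Longrightarrow> \<exists>u v r. swaps f u v \<and> p = app u r"
begin

lemma swaps_inverse: "swaps f u v \<longleftrightarrow> swaps f' v u"
proof
  assume *: "swaps f u v"
  have "f' (app v r) = app u r" if "ends (lbl x v) r" for r
    using * that f'_f [of "app u r"] by (auto simp: swaps_def)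
  with * show "swaps f' v u" by (auto simp: swaps_def)
next
  assume *: "swaps f' v u"
  have "f (app u r) = app v r" if "ends (lbl x u) r" for r
    using * that f_f' [of "app v r"] by (auto simp: swaps_def)
  with * show "swaps f u v" by (auto simp: swaps_def)
qed

lemma local_swap': "ends x p \<Longrightarrow> \<exists>u v r. swaps f' u v \<and> p = app u r"
proof -
  assume p: "ends x p"
  then obtain u v r where uv: "swaps f u v" "f' p = app u r" using local_swap f'_ends by blast
  then have "ends (lbl x u) r" using f'_ends [OF p] by (auto simp: swaps_def)
  then have "p = app v r" using uv f_f' [OF p] by (auto simp: swaps_def)
  then show ?thesis using uv swaps_inverse by blast
qed

lemma inverse_swap_pair: "swap_pair ch S R x f' f"
  using local_swap' by unfold_locales (simp_all add: f_ends f'_ends f_f' f'_f)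

text \<open>A single path runs through a leaf. The swap around it uses a prefix that cannot extend
  beyond the leaf, so this swap can be lengthened to one at the leaf.\<close>

lemma leaf_good:
  assumes "node x u" "ch (lbl x u) = []"
  shows "good f u"
proof -
  obtain u0 v0 r where s: "swaps f u0 v0" "app u (\<lambda>_. 0) = app u0 r"
    using local_swap [of "app u (\<lambda>_. 0)"] assms by auto
  from app_eq_comparable [OF s(2)] consider w where "u = u0 @ w" | w where "u0 = u @ w" by blast
  then show ?thesis
  proof cases
    case 1
    then show ?thesis using swaps_append [OF s(1), of w] assms by (auto simp: good_def)
  next
    case 2
    then have "w = []" using s(1) assms by (cases w) (auto simp: swaps_def)
    with 2 s show ?thesis by (auto simp: good_def)
  qed
qed

lemma inner_node_branches: "u \<in> inner_nodes f \<Longrightarrow> ch (lbl x u) \<noteq> []"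
  using leaf_good by (auto simp: inner_nodes_def minimal_nodes_def)

lemma minimal_good_prefix:
  assumes "ends x p"
  shows "\<exists>u r. p = app u r \<and> u \<in> minimal_nodes f \<and> good f u \<and> ends (lbl x u) r"
proof -
  define P where "P u \<longleftrightarrow> good f u \<and> (\<exists>r. p = app u r)" for u
  have "\<exists>u. P u" using local_swap [OF assms] by (auto simp: P_def good_def)
  then obtain u where u: "P u" "\<And>v. P v \<Longrightarrow> length u \<le> length v"
    using ex_has_least_nat [of P _ length] by blast
  then obtain r where r: "good f u" "p = app u r" by (auto simp: P_def)
  then have "node x u" by (auto simp: good_def swaps_def)
  have "\<not> good f v" if "u = v @ s" "s \<noteq> []" for v s
    using u(2) [of v] that r by (auto simp: P_def)
  then have "u \<in> minimal_nodes f" using \<open>node x u\<close> by (auto simp: minimal_nodes_def)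
  then show ?thesis using r assms \<open>node x u\<close> by auto
qed

text \<open>Koenig's lemma turns local swapping into finitely many swaps, since every path leaves
  the tree just after its shortest good prefix.\<close>

lemma finite_minimal_nodes: "finite (minimal_nodes f)"
proof (rule koenig [of _ x])
  fix p assume "ends x p"
  then obtain u r where ur: "p = app u r" "good f u" using minimal_good_prefix by blast
  \<comment> \<open>One step more than the good prefix is needed, because \<open>u\<close> itself
    still belongs to the tree as a leaf.\<close>
  have "map p [0..<Suc (length u)] = u @ [r 0]"
    by (rule nth_equalityI) (auto simp: ur app_nth nth_append simp del: upt_Suc)
  then show "\<exists>n. map p [0..<n] \<notin> minimal_nodes f"
    using ur by (intro exI [of _ "Suc (length u)"]) (auto simp: minimal_nodes_snoc_iff inner_nodes_def simp del: upt_Suc)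
qed (auto simp: minimal_nodes_def dest: minimal_nodes_append)

text \<open>A good node strictly above \<open>v\<close> would be carried back to a good node
  strictly above \<open>u\<close>. Hence the leaves of the trees of \<open>f\<close> and
  \<open>f'\<close> correspond.\<close>

lemma minimal_partner:
  assumes "swaps f u v" "u \<in> minimal_nodes f"
  shows "v \<in> minimal_nodes f'"
proof -
  have "\<not> good f' w" if ws: "v = w @ s" "s \<noteq> []" for w s
  proof
    assume "good f' w"
    then obtain w' where w': "swaps f' w w'" by (auto simp: good_def)
    have "node (lbl x w) s" using assms(1) ws by (auto simp: swaps_def)
    then have "swaps f' v (w' @ s)" using swaps_append [OF w'] ws by simp
    then have "u = w' @ s" using assms(1) swaps_inverse swaps_unique by blast
    then show False using assms(2) w' ws(2) swaps_inverse by (auto simp: minimal_nodes_def good_def)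
  qed
  then show ?thesis using assms(1) by (auto simp: minimal_nodes_def swaps_def)
qed

definition bw :: "nat list \<Rightarrow> nat" where
  "bw v = (if good f' v then tw (THE u. swaps f u v) else ow v)"

text \<open>Wires and splitting transistors of the upper half are coded by even numbers, those
  of the lower half by odd numbers; a good lower node shares the wire of its upper partner.\<close>
definition canon :: "'a bdiag" where
  "canon = \<lparr> trs = tw ` inner_nodes f \<union> ow ` inner_nodes f',
     wrs = tw ` minimal_nodes f \<union> ow ` inner_nodes f',
     lab = (\<lambda>w. lbl x (from_nat (w div 2))),
     ftop = [tw []], fbot = [bw []],
     ttop = (\<lambda>t. if even t then [t]
       else map (\<lambda>i. bw (from_nat (t div 2) @ [i])) [0..<length (ch (lbl x (from_nat (t div 2))))]),
     tbot = (\<lambda>t. if odd t then [t]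
       else map (\<lambda>i. tw (from_nat (t div 2) @ [i])) [0..<length (ch (lbl x (from_nat (t div 2))))]) \<rparr>"

lemma canon_simps [simp]:
  "trs canon = tw ` inner_nodes f \<union> ow ` inner_nodes f'"
  "wrs canon = tw ` minimal_nodes f \<union> ow ` inner_nodes f'"
  "lab canon (tw u) = lbl x u" "lab canon (ow u) = lbl x u"
  "ftop canon = [tw []]" "fbot canon = [bw []]"
  "ttop canon (tw u) = [tw u]" "tbot canon (ow u) = [ow u]"
  "ttop canon (ow u) = map (\<lambda>i. bw (u @ [i])) [0..<length (ch (lbl x u))]"
  "tbot canon (tw u) = map (\<lambda>i. tw (u @ [i])) [0..<length (ch (lbl x u))]"
  by (simp_all add: canon_def)

lemma bw_partner: "swaps f u v \<Longrightarrow> bw v = tw u"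
proof -
  assume uv: "swaps f u v"
  then have "(THE u. swaps f u v) = u"
    using swaps_inverse swaps_unique by (intro the_equality) blast+
  then show ?thesis using uv swaps_inverse by (auto simp: bw_def good_def)
qed

lemma bw_inner: "v \<in> inner_nodes f' \<Longrightarrow> bw v = ow v"
  by (simp add: bw_def inner_nodes_def)

lemma bw_cases:
  assumes "v \<in> minimal_nodes f'"
  obtains u where "swaps f u v" "u \<in> minimal_nodes f" "good f u" "bw v = tw u"
  | "v \<in> inner_nodes f'" "bw v = ow v"
proof (cases "good f' v")
  case True
  then obtain u where "swaps f u v" using swaps_inverse by (auto simp: good_def)
  moreover have "u \<in> minimal_nodes f"
    using swap_pair.minimal_partner [OF inverse_swap_pair] calculation assms swaps_inverse by blast
  ultimately show ?thesis using that(1) bw_partner by (auto simp: good_def)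
qed (use assms that(2) in \<open>auto simp: inner_nodes_def bw_def\<close>)

lemma lab_bw: "v \<in> minimal_nodes f' \<Longrightarrow> lab canon (bw v) = lbl x v"
  by (erule bw_cases) (auto simp: swaps_def)

lemma inj_bw: "inj_on bw (minimal_nodes f')"
proof (rule inj_onI)
  fix v w assume vw: "v \<in> minimal_nodes f'" "w \<in> minimal_nodes f'" "bw v = bw w"
  from vw(1) show "v = w"
  proof (cases rule: bw_cases)
    case (1 u)
    from vw(2) 1 vw(3) show ?thesis by (cases rule: bw_cases) (auto intro: swaps_unique)
  next
    case 2
    from vw(2) 2 vw(3) show ?thesis by (cases rule: bw_cases) auto
  qed
qed

lemma canon_split_wire: "tw u \<in> bw ` minimal_nodes f' \<longleftrightarrow> u \<in> minimal_nodes f \<and> good f u"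
proof
  assume "tw u \<in> bw ` minimal_nodes f'"
  then obtain v where "v \<in> minimal_nodes f'" "bw v = tw u" by auto
  then show "u \<in> minimal_nodes f \<and> good f u" by (auto elim: bw_cases)
next
  assume u: "u \<in> minimal_nodes f \<and> good f u"
  then obtain v where "swaps f u v" by (auto simp: good_def)
  then show "tw u \<in> bw ` minimal_nodes f'" using bw_partner minimal_partner u by (metis imageI)
qed

text \<open>The wires of the lower tree are the leaves of the upper tree together with the inner
  nodes of the lower one. All other wires belong to upper inner nodes and end at their own
  splits.\<close>

lemma bw_image: "bw ` minimal_nodes f' = tw ` (minimal_nodes f - inner_nodes f) \<union> ow ` inner_nodes f'"
proof (intro equalityI subsetI)
  fix w assume w: "w \<in> bw ` minimal_nodes f'"
  then obtain v where v: "v \<in> minimal_nodes f'" "w = bw v" by blast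
  from v(1) show "w \<in> tw ` (minimal_nodes f - inner_nodes f) \<union> ow ` inner_nodes f'"
    by (cases rule: bw_cases) (auto simp: v(2) inner_nodes_def)
next
  fix w assume "w \<in> tw ` (minimal_nodes f - inner_nodes f) \<union> ow ` inner_nodes f'"
  then consider u where "w = tw u" "u \<in> minimal_nodes f" "good f u" | v where "w = ow v" "v \<in> inner_nodes f'"
    by (auto simp: inner_nodes_def)
  then show "w \<in> bw ` minimal_nodes f'"
  proof cases
    case 2
    then show ?thesis using bw_inner by (metis (no_types, lifting) imageI inner_nodes_def mem_Collect_eq)
  qed (simp add: canon_split_wire)
qed

lemma canon_WW: "canon \<in> WW"
proof -
  interpret inv: swap_pair ch S R x f' f by (rule inverse_swap_pair)
  have fin: "finite (minimal_nodes f)" "finite (minimal_nodes f')"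
    using finite_minimal_nodes inv.finite_minimal_nodes by auto
  have fin_inner: "finite (inner_nodes f)" "finite (inner_nodes f')"
    using fin by (auto simp: inner_nodes_def)
  have sub: "inner_nodes g \<subseteq> minimal_nodes g" for g by (auto simp: inner_nodes_def)
  have inj: "inj_on tw A" "inj_on ow A" for A by (auto simp: inj_on_def)
  have "attached (tw ` inner_nodes f \<union> ow ` inner_nodes f') [tw []] (tbot canon) (tw ` minimal_nodes f \<union> ow ` inner_nodes f')"
  proof (rule attached_union)
    show "attached (tw ` inner_nodes f) [tw []] (tbot canon) (tw ` minimal_nodes f)"
      by (rule attached_tree) (simp_all add: inj)
    show "attached (ow ` inner_nodes f') [] (tbot canon) (ow ` inner_nodes f')"
      by (auto simp: attached_def)
  qed auto
  then have top: "attached (trs canon) (ftop canon) (tbot canon) (wrs canon)" by simp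
  have "attached (ow ` inner_nodes f' \<union> tw ` inner_nodes f) [bw []] (ttop canon) (bw ` minimal_nodes f' \<union> tw ` inner_nodes f)"
  proof (rule attached_union)
    show "attached (ow ` inner_nodes f') [bw []] (ttop canon) (bw ` minimal_nodes f')"
      by (rule attached_tree) (simp_all add: inj inj_bw)
    show "attached (tw ` inner_nodes f) [] (ttop canon) (tw ` inner_nodes f)"
      by (auto simp: attached_def)
  qed (auto simp: bw_image)
  moreover have "bw ` minimal_nodes f' \<union> tw ` inner_nodes f = wrs canon"
    using sub [of f] by (auto simp: bw_image)
  ultimately have bot: "attached (trs canon) (fbot canon) (ttop canon) (wrs canon)"
    by (simp add: Un_commute)
  have splits: "is_split canon t \<or> is_split (flip canon) t" if "t \<in> trs canon" for t
  proof -
    from that consider u where "u \<in> inner_nodes f" "t = tw u" | v where "v \<in> inner_nodes f'" "t = ow v" by auto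
    then show ?thesis
    proof cases
      case 1
      then have "is_split canon t"
        using inner_node_branches [of u] by (auto simp: is_split_def comp_def intro: nth_equalityI)
      then show ?thesis ..
    next
      case 2
      have "lab canon (bw (v @ [i])) = ch (lbl x v) ! i" if "i < length (ch (lbl x v))" for i
        using lab_bw [of "v @ [i]"] 2 that by (simp add: minimal_nodes_snoc_iff)
      then have "is_split (flip canon) t"
        using inv.inner_node_branches [of v] 2 by (auto simp: is_split_def comp_def intro: nth_equalityI)
      then show ?thesis ..
    qed
  qed
  obtain K where K: "\<And>u. u \<in> minimal_nodes f \<union> minimal_nodes f' \<Longrightarrow> length u < K"
    using fin finite_nat_set_iff_bounded [of "length ` (minimal_nodes f \<union> minimal_nodes f')"] by auto
  \<comment> \<open>Ranks must grow upwards: in the upper tree they fall with the depth, in the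
    lower tree they grow with it. As \<open>K\<close> exceeds all depths, upper values are above
    \<open>K\<close> and lower values below it.\<close>
  define \<rho> where "\<rho> t = (if even t then 2 * K - length (from_nat (t div 2) :: nat list)
    else length (from_nat (t div 2) :: nat list))" for t
  have \<rho>: "\<rho> (tw u) = 2 * K - length u" "\<rho> (ow u) = length u" for u by (simp_all add: \<rho>_def)
  have rank: "\<rho> s < \<rho> t" if st: "s \<in> trs canon" "t \<in> trs canon" "set (ttop canon s) \<inter> set (tbot canon t) \<noteq> {}" for s t
  proof -
    from st(1,2) consider
      (1) u v where "u \<in> inner_nodes f" "s = tw u" "v \<in> inner_nodes f" "t = tw v"
    | (2) u v where "u \<in> inner_nodes f'" "s = ow u" "v \<in> inner_nodes f'" "t = ow v"
    | (3) u v where "u \<in> inner_nodes f'" "s = ow u" "v \<in> inner_nodes f" "t = tw v"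
    | (4) u v where "u \<in> inner_nodes f" "s = tw u" "v \<in> inner_nodes f'" "t = ow v"
      by auto
    then show ?thesis
    proof cases
      case 1
      with st(3) have "v \<in> inner_nodes f" "length u = Suc (length v)" by auto
      moreover have "length u < K" using K [of u] 1 sub by blast
      ultimately show ?thesis using 1 by (simp add: \<rho>)
    next
      case 2
      with st(3) obtain i where i: "i < length (ch (lbl x u))" "bw (u @ [i]) = ow v" by auto
      then have "u @ [i] \<in> minimal_nodes f'" using 2 by (simp add: minimal_nodes_snoc_iff)
      then have "u @ [i] = v" using i(2) by (cases rule: bw_cases) auto
      then show ?thesis using 2 by (auto simp: \<rho>)
    next
      case 3
      then show ?thesis using K [of u] K [of v] sub by (force simp: \<rho>)
    qed (use st(3) in auto)
  qed
  have node_S: "node a u \<Longrightarrow> a \<in> S \<Longrightarrow> lbl a u \<in> S" for a u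
  proof (induction u arbitrary: a)
    case (Cons i u)
    then have "ch a ! i \<in> S" using ch_closed [of a] by auto
    with Cons show ?case by simp
  qed simp
  have "lab canon ` wrs canon \<subseteq> S"
    using node_S [OF _ root] by (auto simp: minimal_nodes_def inner_nodes_def)
  moreover have "finite (trs canon)" "finite (wrs canon)" "wrs canon \<noteq> {}"
    using fin fin_inner minimal_nodes_Nil by auto
  ultimately have "valid_diag S R canon"
    unfolding valid_diag_iff using top bot splits rank by blast
  then show ?thesis using lab_bw [OF minimal_nodes_Nil] by (simp add: WW_iff)
qed

text \<open>A path loses its shortest good prefix \<open>u\<close> in the upper tree, arrives on the
  wire shared with the partner \<open>v\<close>, and there the merges spell out \<open>v\<close>
  from its last step to its first.\<close>

lemma canon_realizes: "realizes canon f"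
proof -
  have top: "steps canon (tw [], app u r) (tw u, r)" if "u \<in> minimal_nodes f" for u r
    using that
  proof (induction u arbitrary: r rule: minimal_nodes_induct)
    case (snoc u i)
    have "step canon (tw u, scons i r) (tbot canon (tw u) ! i, r)"
      by (rule step.split) (use snoc in auto)
    with snoc(3) [of "scons i r"] snoc(2) show ?case by simp
  qed simp
  have bot: "steps canon (bw v, r) (bw [], app v r)" if "v \<in> minimal_nodes f'" for v r
    using that
  proof (induction v arbitrary: r rule: minimal_nodes_induct)
    case (snoc v i)
    have "step canon (ttop canon (ow v) ! i, r) (ow v, scons i r)"
      by (rule step.merge) (use snoc in auto)
    with snoc(3) [of "scons i r"] snoc(1,2) show ?case
      by (simp add: bw_inner converse_rtranclp_into_rtranclp)
  qed simp
  have "run canon p (f p)" if p: "ends x p" for p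
  proof -
    obtain u r where u: "p = app u r" "u \<in> minimal_nodes f" "good f u" "ends (lbl x u) r"
      using minimal_good_prefix [OF p] by blast
    then obtain v where v: "swaps f u v" by (auto simp: good_def)
    have "f p = app v r" using u v by (auto simp: swaps_def)
    moreover have "steps canon (tw u, r) (bw [], app v r)"
      using bot [OF minimal_partner [OF v u(2)], of r] bw_partner [OF v] by simp
    ultimately show ?thesis
      using top [OF u(2), of r] u(1) by (simp add: run_def)
  qed
  then show ?thesis using canon_WW by (simp add: realizes_def)
qed

end

section \<open>Dipole-free diagrams are canonical\<close>

text \<open>The address of a wire reached from the top of the frame through splits alone. For
  \<open>flip D\<close> it is the address read from the bottom through merges.\<close>

inductive top_address :: "'a bdiag \<Rightarrow> nat list \<Rightarrow> nat \<Rightarrow> bool" for D where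
  Nil: "ftop D = [w] \<Longrightarrow> top_address D [] w"
| snoc: "top_address D u w \<Longrightarrow> t \<in> trs D \<Longrightarrow> ttop D t = [w] \<Longrightarrow> i < length (tbot D t) \<Longrightarrow>
    top_address D (u @ [i]) (tbot D t ! i)"

definition split_below :: "'a bdiag \<Rightarrow> nat \<Rightarrow> bool" where
  "split_below D w \<longleftrightarrow> (\<exists>t\<in>trs D. ttop D t = [w])"

lemma is_dipole_flip: "is_dipole (flip D) t1 t2 \<longleftrightarrow> is_dipole D t2 t1"
  by (auto simp: is_dipole_def diag_prec_def)

context diagram
begin

lemma not_split_and_merge: "t \<in> trs D \<Longrightarrow> ttop D t = [w] \<Longrightarrow> tbot D t = [w'] \<Longrightarrow> False"
  using singleton_top_split(3) [of t w] length_ch [of "lab D w"] by simp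

lemma top_address_functional: "top_address D u w \<Longrightarrow> top_address D u w' \<Longrightarrow> w = w'"
proof (induction arbitrary: w' rule: top_address.induct)
  case (Nil w)
  from \<open>top_address D [] w'\<close> show ?case by (cases rule: top_address.cases) (use Nil in auto)
next
  case (snoc u w t i)
  from \<open>top_address D (u @ [i]) w'\<close> show ?case
  proof (cases rule: top_address.cases)
    case (snoc u' v t' i')
    then have "v = w" using snoc.IH by simp
    then have "t = t'" using attached_unique [OF bot_att, of t t' w] snoc snoc.hyps by auto
    with snoc show ?thesis by simp
  qed simp
qed

lemma top_address_inject: "top_address D u w \<Longrightarrow> top_address D u' w \<Longrightarrow> u = u'"
proof (induction arbitrary: u' rule: top_address.induct)
  case (Nil w)
  from \<open>top_address D u' w\<close> show ?case
  proof (cases rule: top_address.cases)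
    case (snoc u v t i)
    then have "w \<in> set (tbot D t)" by simp
    then show ?thesis using attached_frame [OF top_att \<open>t \<in> trs D\<close>] Nil by auto
  qed simp
next
  case (snoc u w t i)
  from \<open>top_address D u' (tbot D t ! i)\<close> show ?case
  proof (cases rule: top_address.cases)
    case Nil
    then show ?thesis using attached_frame [OF top_att \<open>t \<in> trs D\<close>, of "tbot D t ! i"] snoc.hyps by auto
  next
    case (snoc v w' t' i')
    then have "t = t' \<and> i = i'"
      using attached_nth_inject [OF top_att, of t t' i i'] snoc.hyps by auto
    then show ?thesis using snoc snoc.IH snoc.hyps by auto
  qed
qed

text \<open>Going down from the frame, the first wire without an address would have to leave a
  merge. A split directly below a merge is always a dipole, as both are given by the letter of the
  wire between them.\<close>

lemma address_or_merge_above: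
  assumes top: "ftop D = [a]" and free: "\<nexists>t1 t2. is_dipole D t1 t2" and w: "w \<in> wrs D"
  shows "(\<exists>u. top_address D u w) \<or> (\<exists>t\<in>trs D. tbot D t = [w])"
proof -
  obtain h :: "nat \<Rightarrow> nat" where
    h: "\<And>t w w'. t \<in> trs D \<Longrightarrow> w \<in> set (tbot D t) \<Longrightarrow> w' \<in> set (ttop D t) \<Longrightarrow> h w' < h w"
    using diagram.step_rankE [OF flip_diagram] by (metis flip_simps(1,6,7))
  show ?thesis using w
  proof (induction "h w" arbitrary: w rule: less_induct)
    case less
    from less.prems consider "w \<in> set (ftop D)" | t where "t \<in> trs D" "w \<in> set (tbot D t)"
      using attached_wire [OF top_att] by blast
    then show ?case
    proof cases
      case 1
      then show ?thesis using top by (auto intro: top_address.Nil)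
    next
      case 2
      from 2(1) show ?thesis
      proof (cases rule: singleton_cases)
        case (1 w')
        from 2(2) obtain i where i: "i < length (tbot D t)" "w = tbot D t ! i" by (metis in_set_conv_nth)
        have "h w' < h w" "w' \<in> wrs D" using h [OF 2] wires_in(1) [OF 2(1)] 1 by auto
        from less.hyps [OF this] show ?thesis
        proof
          assume "\<exists>u. top_address D u w'"
          then show ?thesis using top_address.snoc [of D _ w' t i] 2 1 i by blast
        next
          assume "\<exists>t\<in>trs D. tbot D t = [w']"
          then obtain t' where t': "t' \<in> trs D" "tbot D t' = [w']" by blast
          have "is_dipole D t t'"
            using t' 2 1 wires_in(1) [OF 2(1), of w'] singleton_top_split [OF 2(1) 1(1)] singleton_bot_merge [OF t']
            by (auto simp: is_dipole_def diag_prec_def)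
          then show ?thesis using free by blast
        qed
      qed (use 2 in auto)
    qed
  qed
qed

end

locale reduced_diagram = swap_pair + diagram +
  assumes free: "\<nexists>t1 t2. is_dipole D t1 t2" and real: "realizes D f"
begin

lemma D_WW: "D \<in> WW"
  using real by (simp add: realizes_def)

lemma flip_reduced: "reduced_diagram ch S R x f' f (flip D)"
proof -
  have "run (flip D) p (f' p)" if "ends x p" for p
    using realizesD [OF real, of "f' p" p] f'_ends [OF that] f_f' [OF that] by (simp add: run_flip)
  then have "realizes (flip D) f'" using D_WW by (simp add: realizes_def)
  moreover have "\<nexists>t1 t2. is_dipole (flip D) t1 t2" using free by (simp add: is_dipole_flip)
  ultimately show ?thesis
    by (intro reduced_diagram.intro inverse_swap_pair flip_diagram reduced_diagram_axioms.intro swap_pair.axioms(1))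
qed

abbreviation "TA \<equiv> top_address D"
abbreviation "BA \<equiv> top_address (flip D)"

lemma TA_wire: "TA u w \<Longrightarrow> w \<in> wrs D \<and> node x u \<and> lab D w = lbl x u \<and>
    (\<forall>r. steps D (hd (ftop D), app u r) (w, r))"
proof (induction rule: top_address.induct)
  case (Nil w)
  then show ?case using D_WW wires_in(3) [of w] by (auto simp: WW_iff)
next
  case (snoc u w t i)
  then have "i < length (ch (lbl x u))" using singleton_top_split [of t w] by auto
  moreover have "step D (w, scons i r) (tbot D t ! i, r)" for r
    using snoc by (intro step.split) auto
  then have "steps D (hd (ftop D), app (u @ [i]) r) (tbot D t ! i, r)" for r
    using snoc.IH by (auto intro: rtranclp.rtrancl_into_rtrancl)
  ultimately show ?case
    using snoc singleton_top_nth [of t w i] wires_in(2) [of t] by auto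
qed

lemma TA_in: "TA u w \<Longrightarrow> w \<in> wrs D" and TA_node: "TA u w \<Longrightarrow> node x u"
  and TA_lab: "TA u w \<Longrightarrow> lab D w = lbl x u"
  and TA_steps: "TA u w \<Longrightarrow> steps D (hd (ftop D), app u r) (w, r)"
  using TA_wire by blast+

lemma BA_merge_above:
  assumes "BA v w" shows "\<not> split_below D w"
  using assms
proof cases
  case Nil
  then have "w \<in> set (fbot D)" by simp
  then show ?thesis using attached_frame [OF bot_att, of _ w] by (fastforce simp: split_below_def)
next
  case (snoc v' w' t i)
  show ?thesis
  proof
    assume "split_below D w"
    then obtain s where s: "s \<in> trs D" "ttop D s = [w]" by (auto simp: split_below_def)
    then have "s = t" using attached_unique [OF bot_att, of s t w] snoc by auto
    with s snoc not_split_and_merge [of t w w'] show False by simp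
  qed
qed

lemma BA_if_no_split:
  assumes "w \<in> wrs D" "\<not> split_below D w"
  shows "\<exists>v. BA v w"
proof -
  obtain b where "ftop (flip D) = [b]" using D_WW by (auto simp: WW_iff)
  moreover have "\<nexists>t1 t2. is_dipole (flip D) t1 t2" using free by (simp add: is_dipole_flip)
  ultimately show ?thesis
    using diagram.address_or_merge_above [OF flip_diagram, of b w] assms by (auto simp: split_below_def)
qed

text \<open>A wire of the upper tree that is not split also has an address from the bottom, and the
  runs through it exchange exactly these two prefixes.\<close>

lemma no_split_swaps:
  assumes "TA u w" "\<not> split_below D w"
  shows "\<exists>v. BA v w \<and> swaps f u v"
proof -
  interpret inv: reduced_diagram ch S R x f' f "flip D" by (rule flip_reduced)
  obtain v where v: "BA v w" using BA_if_no_split assms TA_in by blast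
  have "f (app u r) = app v r" if "ends (lbl x u) r" for r
  proof -
    have "steps D (w, r) (hd (fbot D), app v r)" using inv.TA_steps [OF v] by (simp add: steps_flip)
    then have "run D (app u r) (app v r)" using TA_steps [OF assms(1), of r] by (simp add: run_def)
    then show ?thesis using realizesD [OF real, of "app u r"] TA_node [OF assms(1)] that by simp
  qed
  then show ?thesis
    using v TA_node [OF assms(1)] TA_lab [OF assms(1)] inv.TA_node [OF v] inv.TA_lab [OF v]
    by (auto simp: swaps_def)
qed

text \<open>A good node that is split would, at its deepest splitting descendant, be followed by a
  merge of the very same wires, which is a dipole.\<close>
lemma split_not_good:
  assumes "TA u w" "swaps f u v" "t \<in> trs D" "ttop D t = [w]"
  shows False
proof -
  interpret inv: reduced_diagram ch S R x f' f "flip D" by (rule flip_reduced)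
  obtain h :: "nat \<Rightarrow> nat" where
    h: "\<And>t w w'. t \<in> trs D \<Longrightarrow> w \<in> set (ttop D t) \<Longrightarrow> w' \<in> set (tbot D t) \<Longrightarrow> h w' < h w"
    using step_rankE by blast
  show ?thesis using assms
  proof (induction "h w" arbitrary: u v w t rule: less_induct)
    case less
    note t = less.prems(3,4)
    note len = singleton_top_split [OF t]
    have TA_child: "TA (u @ [i]) (tbot D t ! i)" if "i < length (tbot D t)" for i
      using less.prems that by (intro top_address.snoc) auto
    have labw: "lab D w = lbl x u" using TA_lab less.prems(1) .
    have swap_child: "swaps f (u @ [i]) (v @ [i])" if "i < length (tbot D t)" for i
      using less.prems(2) that len(3) labw by (intro swaps_append) auto
    have BA_child: "BA (v @ [i]) (tbot D t ! i)" if i: "i < length (tbot D t)" for i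
    proof -
      have "\<not> split_below D (tbot D t ! i)"
      proof
        assume "split_below D (tbot D t ! i)"
        then obtain s where "s \<in> trs D" "ttop D s = [tbot D t ! i]" by (auto simp: split_below_def)
        then show False
          using less.hyps [OF _ TA_child [OF i] swap_child [OF i]] h [OF t(1), of w "tbot D t ! i"] t i by auto
      qed
      then obtain v' where "BA v' (tbot D t ! i)" "swaps f (u @ [i]) v'"
        using no_split_swaps TA_child [OF i] by blast
      then show ?thesis using swaps_unique swap_child [OF i] by blast
    qed
    have parent: "\<exists>s w'. BA v w' \<and> s \<in> trs D \<and> tbot D s = [w'] \<and> i < length (ttop D s) \<and> tbot D t ! i = ttop D s ! i"
      if "i < length (tbot D t)" for i
      using BA_child [OF that] by cases auto
    have "0 < length (tbot D t)" using len(2) by simp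
    from parent [OF this] obtain s w' where s: "BA v w'" "s \<in> trs D" "tbot D s = [w']" by blast
    \<comment> \<open>The children of \<open>w\<close> have bottom addresses that differ only in the
      last step, so the merges receiving them have the same address and are one transistor.\<close>
    have same: "i < length (ttop D s) \<and> tbot D t ! i = ttop D s ! i" if i: "i < length (tbot D t)" for i
    proof -
      from parent [OF i] obtain s' w'' where s': "BA v w''" "s' \<in> trs D" "tbot D s' = [w'']"
        "i < length (ttop D s')" "tbot D t ! i = ttop D s' ! i" by blast
      have "w'' = w'" using diagram.top_address_functional [OF flip_diagram s'(1) s(1)] .
      then have "s' = s" using attached_unique [OF top_att, of s' s w'] s s' by auto
      with s' show ?thesis by simp
    qed
    have labw': "lab D w' = lab D w"
      using inv.TA_lab [OF s(1)] labw less.prems(2) by (simp add: swaps_def)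
    then have "length (ttop D s) = length (tbot D t)"
      using singleton_bot_merge(3) [OF s(2,3)] len(3) by simp
    then have eq: "tbot D t = ttop D s" using same by (intro nth_equalityI) auto
    have "s \<noteq> t" using t s not_split_and_merge by blast
    moreover have "\<exists>w\<in>wrs D. w \<in> set (tbot D t) \<and> w \<in> set (ttop D s)"
      using len(2) eq wires_in(2) [OF t(1)] by (metis hd_in_set)
    ultimately have "is_dipole D s t"
      using t s eq labw' by (auto simp: is_dipole_def diag_prec_def)
    then show False using free by blast
  qed
qed

text \<open>The diagram splits exactly where \<open>f\<close> demands it, so its upper tree is the
  tree of minimal nodes and contains no choice.\<close>

lemma TA_good_iff: "TA u w \<Longrightarrow> good f u \<longleftrightarrow> \<not> split_below D w"
  using split_not_good no_split_swaps unfolding good_def split_below_def by blast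

lemma TA_prefix: "TA (u @ s) w \<Longrightarrow> s \<noteq> [] \<Longrightarrow> \<exists>w'. TA u w' \<and> split_below D w'"
proof (induction s arbitrary: w rule: rev_induct)
  case (snoc i s)
  from \<open>TA (u @ s @ [i]) w\<close> obtain w' t where "TA (u @ s) w'" "t \<in> trs D" "ttop D t = [w']"
    by cases auto
  with snoc.IH show ?case by (cases "s = []") (auto simp: split_below_def)
qed simp

lemma TA_minimal: "TA u w \<Longrightarrow> u \<in> minimal_nodes f"
  using TA_prefix TA_good_iff TA_node unfolding minimal_nodes_def by blast

lemma TA_exists: "u \<in> minimal_nodes f \<Longrightarrow> \<exists>w. TA u w"
proof (induction rule: minimal_nodes_induct)
  case Nil
  then show ?case using D_WW by (auto simp: WW_iff intro: top_address.Nil)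
next
  case (snoc u i)
  then obtain w where w: "TA u w" by blast
  then obtain t where t: "t \<in> trs D" "ttop D t = [w]"
    using TA_good_iff snoc(1) by (auto simp: inner_nodes_def split_below_def)
  then show ?case
    using top_address.snoc [OF w t, of i] snoc(2) TA_lab [OF w] singleton_top_split(3) [OF t] by auto
qed

text \<open>A wire with a merge above and a split below would lie inside a dipole. So a wire that is
  split belongs to the upper tree, and any other can be reached from the bottom.\<close>

lemma TA_or_BA: "w \<in> wrs D \<Longrightarrow> (\<exists>u. TA u w \<and> split_below D w) \<or> (\<exists>v. BA v w)"
proof (cases "split_below D w")
  case True
  interpret inv: reduced_diagram ch S R x f' f "flip D" by (rule flip_reduced)
  assume w: "w \<in> wrs D"
  have "\<not> split_below (flip D) w"
  proof
    assume "split_below (flip D) w"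
    then obtain s where s: "s \<in> trs D" "tbot D s = [w]" by (auto simp: split_below_def)
    from True obtain t where t: "t \<in> trs D" "ttop D t = [w]" by (auto simp: split_below_def)
    have "s \<noteq> t" using s t not_split_and_merge by blast
    then have "is_dipole D t s"
      using s t w singleton_top_split [OF t] singleton_bot_merge [OF s]
      by (auto simp: is_dipole_def diag_prec_def)
    then show False using free by blast
  qed
  then show ?thesis using inv.BA_if_no_split w True by auto
qed (use BA_if_no_split in blast)

text \<open>Addresses determine wires, and wires with a split or a merge determine that transistor.
  Since the two trees depend on \<open>f\<close> alone, sending each canonical node to the wire with
  its address is an isomorphism.\<close>

lemma canon_iso: "diag_iso canon D"
proof -
  interpret inv: reduced_diagram ch S R x f' f "flip D" by (rule flip_reduced)
  define T where "T u = (THE w. TA u w)" for u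
  define B where "B v = (THE w. BA v w)" for v
  have T: "TA u (T u)" if "u \<in> minimal_nodes f" for u
    unfolding T_def using TA_exists [OF that] top_address_functional by (rule theI'[OF ex_ex1I])
  have B: "BA v (B v)" if "v \<in> minimal_nodes f'" for v
    unfolding B_def using inv.TA_exists [OF that] diagram.top_address_functional [OF flip_diagram]
    by (rule theI'[OF ex_ex1I])
  have T_eq: "T u = w" if "TA u w" for u w
    using T [OF TA_minimal [OF that]] that top_address_functional by blast
  have B_eq: "B v = w" if "BA v w" for v w
    using B [OF inv.TA_minimal [OF that]] that diagram.top_address_functional [OF flip_diagram] by blast
  define Ts where "Ts u = (THE t. t \<in> trs D \<and> ttop D t = [T u])" for u
  define Bs where "Bs v = (THE t. t \<in> trs D \<and> tbot D t = [B v])" for v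
  have Ts_eq: "Ts u = t" if "t \<in> trs D" "ttop D t = [T u]" for u t
    unfolding Ts_def using that attached_unique [OF bot_att, of _ _ "T u"] by (intro the_equality) auto
  have Bs_eq: "Bs v = t" if "t \<in> trs D" "tbot D t = [B v]" for v t
    unfolding Bs_def using that attached_unique [OF top_att, of _ _ "B v"] by (intro the_equality) auto
  have Ts: "Ts u \<in> trs D \<and> ttop D (Ts u) = [T u]" if "u \<in> inner_nodes f" for u
    using TA_good_iff [OF T, of u] that Ts_eq unfolding inner_nodes_def split_below_def by fastforce
  have Bs: "Bs v \<in> trs D \<and> tbot D (Bs v) = [B v]" if "v \<in> inner_nodes f'" for v
    using inv.TA_good_iff [OF B, of v] that Bs_eq unfolding inner_nodes_def split_below_def by fastforce
  have sub: "inner_nodes g \<subseteq> minimal_nodes g" for g by (auto simp: inner_nodes_def)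
  define \<tau> where "\<tau> n = (if even n then T (from_nat (n div 2)) else B (from_nat (n div 2)))" for n :: nat
  define \<sigma> where "\<sigma> n = (if even n then Ts (from_nat (n div 2)) else Bs (from_nat (n div 2)))" for n :: nat
  have \<tau>_tw: "\<tau> (tw u) = T u" and \<tau>_ow: "\<tau> (ow u) = B u" and \<sigma>_tw: "\<sigma> (tw u) = Ts u" and \<sigma>_ow: "\<sigma> (ow u) = Bs u" for u
    by (simp_all add: \<tau>_def \<sigma>_def)
  \<comment> \<open>A leaf of the upper tree also has the bottom address of its partner; this is the
    same sharing of wires that \<open>bw\<close> builds into the canonical diagram.\<close>
  have T_B: "T u = B v" if uv: "swaps f u v" "u \<in> minimal_nodes f" for u v
  proof -
    have "\<not> split_below D (T u)" using TA_good_iff [OF T] uv by (auto simp: good_def)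
    with no_split_swaps [OF T [OF uv(2)]] obtain v' where "BA v' (T u)" "swaps f u v'" by blast
    then show ?thesis using B_eq swaps_unique uv by metis
  qed
  have \<tau>_bw: "\<tau> (bw v) = B v" if "v \<in> minimal_nodes f'" for v
    using that by (cases rule: bw_cases) (auto simp: \<tau>_tw \<tau>_ow T_B)
  \<comment> \<open>A coincidence would provide a partner for \<open>v\<close>, which is an inner
    node and hence not good.\<close>
  have T_neq_B: "T u \<noteq> B v" if "u \<in> minimal_nodes f" "v \<in> inner_nodes f'" for u v
  proof
    assume eq: "T u = B v"
    have v: "v \<in> minimal_nodes f'" using that sub by blast
    have "\<not> split_below D (T u)" using BA_merge_above [OF B [OF v]] eq by simp
    with no_split_swaps [OF T [OF that(1)]] obtain v' where v': "BA v' (T u)" "swaps f u v'" by blast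
    then have "v' = v" using diagram.top_address_inject [OF flip_diagram] B [OF v] eq by metis
    then show False using v' that swaps_inverse by (auto simp: inner_nodes_def good_def)
  qed
  have T_inj: "T u = T u' \<longleftrightarrow> u = u'" if "u \<in> minimal_nodes f" "u' \<in> minimal_nodes f" for u u'
    using T [OF that(1)] T [OF that(2)] top_address_inject by metis
  have B_inj: "B v = B v' \<longleftrightarrow> v = v'" if "v \<in> minimal_nodes f'" "v' \<in> minimal_nodes f'" for v v'
    using B [OF that(1)] B [OF that(2)] diagram.top_address_inject [OF flip_diagram] by metis
  have bij_\<tau>: "bij_betw \<tau> (wrs canon) (wrs D)"
  proof (rule bij_betw_imageI)
    show "inj_on \<tau> (wrs canon)"
      using sub by (auto simp: inj_on_def \<tau>_tw \<tau>_ow T_inj B_inj T_neq_B T_neq_B [symmetric] subset_iff)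
    have "w \<in> \<tau> ` wrs canon" if w: "w \<in> wrs D" for w
      using TA_or_BA [OF w]
    proof
      assume "\<exists>u. TA u w \<and> split_below D w"
      then obtain u where "TA u w" by blast
      then have "w = \<tau> (tw u)" "u \<in> minimal_nodes f" using T_eq TA_minimal by (auto simp: \<tau>_tw)
      then show ?thesis by auto
    next
      assume "\<exists>v. BA v w"
      then obtain v where v: "BA v w" by blast
      then have "w = \<tau> (bw v)" "v \<in> minimal_nodes f'"
        using B_eq inv.TA_minimal \<tau>_bw by auto
      moreover have "bw v \<in> wrs canon"
        using bw_image calculation(2) by auto
      ultimately show ?thesis by blast
    qed
    moreover have "\<tau> ` wrs canon \<subseteq> wrs D"
      using TA_in [OF T] inv.TA_in [OF B] by (auto simp: \<tau>_tw \<tau>_ow inner_nodes_def)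
    ultimately show "\<tau> ` wrs canon = wrs D" by blast
  qed
  have bij_\<sigma>: "bij_betw \<sigma> (trs canon) (trs D)"
  proof (rule bij_betw_imageI)
    have "Ts u \<noteq> Bs v" if "u \<in> inner_nodes f" "v \<in> inner_nodes f'" for u v
      using Ts [OF that(1)] Bs [OF that(2)] not_split_and_merge by metis
    moreover have "u = u'" if "u \<in> inner_nodes f" "u' \<in> inner_nodes f" "Ts u = Ts u'" for u u'
      using Ts [OF that(1)] Ts [OF that(2)] that T_inj sub by auto
    moreover have "v = v'" if "v \<in> inner_nodes f'" "v' \<in> inner_nodes f'" "Bs v = Bs v'" for v v'
      using Bs [OF that(1)] Bs [OF that(2)] that B_inj sub by auto
    ultimately show "inj_on \<sigma> (trs canon)"
      by (auto simp: inj_on_def \<sigma>_tw \<sigma>_ow) metis+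
    have "t \<in> \<sigma> ` trs canon" if t: "t \<in> trs D" for t
      using t
    proof (cases rule: singleton_cases)
      case (1 w)
      then have sb: "split_below D w" using t by (auto simp: split_below_def)
      then obtain u where u: "TA u w"
        using TA_or_BA [of w] BA_merge_above wires_in(1) [OF t] 1 by fastforce
      then have "u \<in> inner_nodes f" using TA_good_iff TA_minimal sb by (auto simp: inner_nodes_def)
      moreover have "Ts u = t" using Ts_eq [OF t] T_eq [OF u] 1 by simp
      ultimately show ?thesis by (auto simp: \<sigma>_tw intro!: image_eqI [of _ _ "tw u"])
    next
      case (2 w)
      then have sb: "split_below (flip D) w" using t by (auto simp: split_below_def)
      then obtain v where v: "BA v w"
        using inv.TA_or_BA [of w] inv.BA_merge_above wires_in(2) [OF t] 2 by fastforce
      then have "v \<in> inner_nodes f'" using inv.TA_good_iff inv.TA_minimal sb by (auto simp: inner_nodes_def)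
      moreover have "Bs v = t" using Bs_eq [OF t] B_eq [OF v] 2 by simp
      ultimately show ?thesis by (auto simp: \<sigma>_ow intro!: image_eqI [of _ _ "ow v"])
    qed
    then show "\<sigma> ` trs canon = trs D" using Ts Bs by (auto simp: \<sigma>_tw \<sigma>_ow)
  qed
  have labs: "lab D (\<tau> w) = lab canon w" if "w \<in> wrs canon" for w
    using that TA_lab [OF T] inv.TA_lab [OF B] by (auto simp: \<tau>_tw \<tau>_ow inner_nodes_def)
  have frames: "ftop D = map \<tau> (ftop canon)" "fbot D = map \<tau> (fbot canon)"
  proof -
    obtain a b where ab: "ftop D = [a]" "fbot D = [b]" using D_WW by (auto simp: WW_iff)
    then have "TA [] a" "BA [] b" by (auto intro: top_address.Nil)
    then show "ftop D = map \<tau> (ftop canon)" "fbot D = map \<tau> (fbot canon)"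
      using ab T_eq B_eq \<tau>_bw [OF minimal_nodes_Nil] by (auto simp: \<tau>_tw)
  qed
  have upper: "ttop D (Ts u) = map \<tau> (ttop canon (tw u)) \<and> tbot D (Ts u) = map \<tau> (tbot canon (tw u))"
    if u: "u \<in> inner_nodes f" for u
  proof -
    have TAu: "TA u (T u)" using T u sub by blast
    note t = Ts [OF u, THEN conjunct1] Ts [OF u, THEN conjunct2]
    have len: "length (tbot D (Ts u)) = length (ch (lbl x u))"
      using singleton_top_split(3) [OF t] TA_lab [OF TAu] by simp
    have "tbot D (Ts u) ! i = T (u @ [i])" if "i < length (ch (lbl x u))" for i
      using T_eq [OF top_address.snoc [OF TAu t]] that len by simp
    then show ?thesis
      using t len by (auto intro!: nth_equalityI simp: \<tau>_tw)
  qed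
  have lower: "ttop D (Bs v) = map \<tau> (ttop canon (ow v)) \<and> tbot D (Bs v) = map \<tau> (tbot canon (ow v))"
    if v: "v \<in> inner_nodes f'" for v
  proof -
    have BAv: "BA v (B v)" using B v sub by blast
    note t = Bs [OF v, THEN conjunct1] Bs [OF v, THEN conjunct2]
    have len: "length (ttop D (Bs v)) = length (ch (lbl x v))"
      using singleton_bot_merge(3) [OF t] inv.TA_lab [OF BAv] by simp
    have "ttop D (Bs v) ! i = B (v @ [i])" if "i < length (ch (lbl x v))" for i
      using B_eq [of "v @ [i]"] top_address.snoc [of "flip D" v "B v" "Bs v" i] BAv t that len by simp
    moreover have "\<tau> (bw (v @ [i])) = B (v @ [i])" if "i < length (ch (lbl x v))" for i
      using \<tau>_bw [of "v @ [i]"] that v by (simp add: minimal_nodes_snoc_iff)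
    ultimately show ?thesis
      using t len by (auto intro!: nth_equalityI simp: \<tau>_ow)
  qed
  have "ttop D (\<sigma> t) = map \<tau> (ttop canon t) \<and> tbot D (\<sigma> t) = map \<tau> (tbot canon t)" if "t \<in> trs canon" for t
    using that upper lower by (auto simp: \<sigma>_tw \<sigma>_ow)
  then show ?thesis
    unfolding diag_iso_def using bij_\<sigma> bij_\<tau> labs frames by blast
qed

end

context rooted_presentation
begin

text \<open>Reduction leads from any diagram acting like \<open>f\<close> to a dipole-free one,
  which is the canonical diagram up to isomorphism. This takes the place of a confluence
  argument.\<close>

lemma realizes_canon_equiv:
  assumes "swap_pair ch S R x f f'" "realizes D f"
  shows "(swap_pair.canon ch x f f', D) \<in> diag_equiv S R [x]"
proof -
  interpret swap_pair ch S R x f f' by (rule assms(1))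
  obtain D' where D': "realizes D' f" "dipole_free D'" "(D, D') \<in> diag_equiv S R [x]"
    using dipole_free_representative [OF assms(2)] by blast
  then have "D' \<in> WW" by (simp add: realizes_def)
  then interpret D': diagram ch S R D' by (rule WW_diagram)
  interpret reduced_diagram ch S R x f f' D'
    using D' by unfold_locales (auto simp: dipole_free_def)
  have "(canon, D') \<in> diag_equiv S R [x]"
    unfolding diag_equiv_def using canon_iso canon_WW \<open>D' \<in> WW\<close> by (intro r_into_rtrancl) auto
  with D'(3) show ?thesis using diag_equiv_sym diag_equiv_trans by blast
qed

end

section \<open>The group of local prefix swaps\<close>

text \<open>Closure of \<open>G\<close> under multiplication is all that inverting an isomorphism
  takes, so the group axioms of the structures do not have to be established.\<close>

lemma iso_symI:
  assumes "h \<in> iso G H" "\<And>a b. a \<in> carrier G \<Longrightarrow> b \<in> carrier G \<Longrightarrow> a \<otimes>\<^bsub>G\<^esub> b \<in> carrier G"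
  shows "H \<cong> G"
proof -
  let ?k = "inv_into (carrier G) h"
  have h: "h \<in> hom G H" "bij_betw h (carrier G) (carrier H)" using assms(1) by (auto simp: iso_def)
  have k: "bij_betw ?k (carrier H) (carrier G)" using h(2) by (rule bij_betw_inv_into)
  have "?k (a \<otimes>\<^bsub>H\<^esub> b) = ?k a \<otimes>\<^bsub>G\<^esub> ?k b" if "a \<in> carrier H" "b \<in> carrier H" for a b
  proof -
    have in_G: "?k a \<in> carrier G" "?k b \<in> carrier G" using that k by (auto dest: bij_betwE)
    have "h (?k a \<otimes>\<^bsub>G\<^esub> ?k b) = a \<otimes>\<^bsub>H\<^esub> b"
      using hom_mult [OF h(1) in_G] that h(2) by (simp add: bij_betw_inv_into_right)
    then show ?thesis
      using assms(2) [OF in_G] h(2) by (metis bij_betw_inv_into_left)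
  qed
  then have "?k \<in> iso H G" using k by (auto simp: iso_def hom_def dest: bij_betwE)
  then show ?thesis by (auto simp: is_iso_def)
qed

context rooted_presentation
begin

text \<open>Values outside \<open>E x\<close> follow the convention of \<open>Gamma_set\<close>, so
  that equality of maps is equality on paths.\<close>

definition swap_maps :: "((nat \<Rightarrow> nat) \<Rightarrow> nat \<Rightarrow> nat) set" where
  "swap_maps = {g \<in> extensional (E x). bij_betw g (E x) (E x) \<and>
     (\<forall>p. ends x p \<longrightarrow> (\<exists>u v r. swaps g u v \<and> p = app u r))}"

definition swap_group :: "((nat \<Rightarrow> nat) \<Rightarrow> nat \<Rightarrow> nat) monoid" where
  "swap_group = \<lparr>carrier = swap_maps, mult = (\<lambda>g h. restrict (g \<circ> h) (E x)), one = restrict id (E x)\<rparr>"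

lemma swap_maps_pair:
  assumes "g \<in> swap_maps"
  shows "swap_pair ch S R x g (inv_into (E x) g)"
proof -
  have bij: "bij_betw g (E x) (E x)" using assms by (simp add: swap_maps_def)
  note bij_betw_inv_into_left [OF bij] bij_betw_inv_into_right [OF bij]
    bij_betwE [OF bij] bij_betwE [OF bij_betw_inv_into [OF bij]]
  with assms show ?thesis
    by unfold_locales (auto simp: swap_maps_def)
qed

text \<open>Totality and determinism make the action a function; applied to the reflected diagram
  they give surjectivity and injectivity, and \<open>run_local\<close> gives the swaps.\<close>

lemma realizes_some:
  assumes "D \<in> WW"
  shows "\<exists>g\<in>swap_maps. realizes D g"
proof -
  define g where "g = restrict (\<lambda>p. THE q. run D p q) (E x)"
  have g: "run D p q \<longleftrightarrow> q = g p" if p: "ends x p" for p q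
  proof -
    obtain q' where q': "run D p q'" using run_total [OF assms p] by blast
    then have "(THE q. run D p q) = q'" using run_functional [OF assms] by blast
    then show ?thesis using q' p run_functional [OF assms] by (auto simp: g_def)
  qed
  have "bij_betw g (E x) (E x)"
  proof (rule bij_betw_imageI)
    show "inj_on g (E x)" using g run_injective [OF assms] by (metis inj_onI mem_Collect_eq)
    have "\<exists>p. ends x p \<and> q = g p" if q: "ends x q" for q
    proof -
      obtain p where p: "run D p q" using run_total [of "flip D" q] assms q by (auto simp: run_flip)
      then show ?thesis using q g run_ends [OF assms p] by blast
    qed
    moreover have "ends x (g p)" if "ends x p" for p using g [OF that] run_ends [OF assms] that by blast
    ultimately show "g ` E x = E x" by auto
  qed
  moreover have "\<exists>u v r. swaps g u v \<and> p = app u r" if "ends x p" for p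
    using run_local [OF assms that, of "g p"] g that unfolding swaps_def by (metis ends_app)
  moreover have "g \<in> extensional (E x)" by (simp add: g_def)
  ultimately have "g \<in> swap_maps" by (simp add: swap_maps_def)
  moreover have "realizes D g" using g assms by (auto simp: realizes_def)
  ultimately show ?thesis by blast
qed

lemma realizes_same_equiv:
  assumes "realizes D f" "realizes D' f"
  shows "(D, D') \<in> diag_equiv S R [x]"
proof -
  obtain g where g: "g \<in> swap_maps" "realizes D g"
    using realizes_some assms(1) unfolding realizes_def by blast
  have "realizes D' g"
    using assms realizesD [OF g(2)] by (auto simp: realizes_def)
  with realizes_canon_equiv [OF swap_maps_pair [OF g(1)]] g(2) show ?thesis
    using diag_equiv_sym diag_equiv_trans by blast
qed

text \<open>Concatenation runs the upper diagram first, so the group multiplication corresponds to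
  reading diagrams from the bottom to the top.\<close>
definition upward :: "((nat \<Rightarrow> nat) \<Rightarrow> nat \<Rightarrow> nat) \<Rightarrow> 'a bdiag set" where
  "upward g = {D. realizes (flip D) g}"

lemma upward_iff: "D \<in> upward g \<longleftrightarrow> D \<in> WW \<and> (\<forall>p. ends x p \<longrightarrow> run D (g p) p)"
  by (auto simp: upward_def realizes_def run_flip)

lemma upward_unique:
  assumes "D \<in> upward g" "D \<in> upward h" "g \<in> extensional (E x)" "h \<in> extensional (E x)"
  shows "g = h"
  using assms(3,4)
proof (rule extensionalityI)
  show "g p = h p" if "p \<in> E x" for p
    using assms(1,2) that run_injective by (auto simp: upward_iff)
qed

text \<open>\<open>D\<close> realizes some \<open>f\<close>, which inverts \<open>g\<close> on
  paths. The diagrams in \<open>upward g\<close> are then exactly those realizing \<open>f\<close>,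
  and these form one equivalence class.\<close>

lemma upward_class:
  assumes "D \<in> upward g"
  shows "diag_equiv S R [x] `` {D} = upward g"
proof -
  have D: "D \<in> WW" using assms by (simp add: upward_iff)
  obtain f where f: "realizes D f" using realizes_some [OF D] by blast
  have f_g: "f (g p) = p" if "ends x p" for p
    using assms that realizesD [OF f, of "g p" p] run_ends [OF D] by (auto simp: upward_iff)
  have iff: "D' \<in> upward g \<longleftrightarrow> realizes D' f" for D'
  proof
    assume D': "D' \<in> upward g"
    then have D'_WW: "D' \<in> WW" by (simp add: upward_iff)
    have "run D' q (f q)" if "ends x q" for q
    proof -
      have r: "run D q (f q)" "ends x (f q)"
        using f that run_ends [OF D] by (auto simp: realizes_def)
      then have "q = g (f q)" using assms run_injective [OF D] by (auto simp: upward_iff)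
      then show ?thesis using D' r(2) by (metis upward_iff)
    qed
    then show "realizes D' f" using D'_WW by (simp add: realizes_def)
  next
    assume D': "realizes D' f"
    have "run D' (g p) p" if "ends x p" for p
      using realizesD [OF D', of "g p" p] f_g [OF that] assms that run_ends [OF D] by (auto simp: upward_iff)
    then show "D' \<in> upward g" using D' by (auto simp: upward_iff realizes_def)
  qed
  show ?thesis
    using f realizes_equiv [OF _ f] realizes_same_equiv [OF f] by (auto simp: iff)
qed

lemma upward_nonempty:
  assumes "g \<in> swap_maps"
  obtains D where "D \<in> upward g"
proof -
  interpret swap_pair ch S R x g "inv_into (E x) g" using assms by (rule swap_maps_pair)
  show ?thesis using canon_realizes by (intro that [of "flip canon"]) (simp add: upward_def)
qed

lemma upward_some:
  assumes "D \<in> WW"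
  shows "\<exists>g\<in>swap_maps. D \<in> upward g"
  using realizes_some [of "flip D"] assms by (simp add: upward_def)

lemma upward_concat:
  assumes "D1 \<in> upward g" "D2 \<in> upward h"
  shows "diag_concat D1 D2 \<in> upward (restrict (g \<circ> h) (E x))"
proof -
  have WW: "D1 \<in> WW" "D2 \<in> WW" using assms by (auto simp: upward_iff)
  have "run (diag_concat D1 D2) (g (h p)) p" if "ends x p" for p
  proof -
    have h: "run D2 (h p) p" using assms(2) that by (simp add: upward_iff)
    then have "ends x (h p)" using run_ends [OF WW(2)] that by blast
    then have "run D1 (g (h p)) (h p)" using assms(1) by (simp add: upward_iff)
    with h show ?thesis using concat_run [OF WW] by blast
  qed
  then show ?thesis using concat_WW [OF WW] by (simp add: upward_iff)
qed

text \<open>Instead of matching the swaps of \<open>g\<close> and \<open>h\<close> by hand, closure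
  is read off from diagrams: the concatenation acts by the composite, and every action of a diagram
  is a swap map.\<close>

lemma swap_maps_closed:
  assumes "g \<in> swap_maps" "h \<in> swap_maps"
  shows "restrict (g \<circ> h) (E x) \<in> swap_maps"
proof -
  obtain D1 D2 where "D1 \<in> upward g" "D2 \<in> upward h" using assms by (meson upward_nonempty)
  then have D: "diag_concat D1 D2 \<in> upward (restrict (g \<circ> h) (E x))" by (rule upward_concat)
  then obtain k where "k \<in> swap_maps" "diag_concat D1 D2 \<in> upward k"
    using upward_some upward_iff by blast
  then show ?thesis using upward_unique [OF D, of k] by (auto simp: swap_maps_def)
qed

theorem swap_group_iso: "upward \<in> iso swap_group (braided_diagram_group S R [x])"
proof -
  let ?B = "braided_diagram_group S R [x]"
  have in_B: "upward g \<in> carrier ?B" if g: "g \<in> swap_maps" for g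
  proof -
    obtain D where D: "D \<in> upward g" using upward_nonempty [OF g] .
    then have "D \<in> WW" by (simp add: upward_iff)
    then show ?thesis
      unfolding braided_diagram_group_def upward_class [OF D, symmetric] by (simp add: quotientI)
  qed
  have mult: "upward (restrict (g \<circ> h) (E x)) = upward g \<otimes>\<^bsub>?B\<^esub> upward h"
    if gh: "g \<in> swap_maps" "h \<in> swap_maps" for g h
  proof -
    have "diag_equiv S R [x] `` {diag_concat D1 D2} = upward (restrict (g \<circ> h) (E x))"
      if "D1 \<in> upward g" "D2 \<in> upward h" for D1 D2
      using upward_class [OF upward_concat [OF that]] .
    moreover obtain D1 D2 where "D1 \<in> upward g" "D2 \<in> upward h" using gh by (meson upward_nonempty)
    ultimately show ?thesis by (auto simp: braided_diagram_group_def)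
  qed
  have inj: "inj_on upward swap_maps"
  proof (rule inj_onI)
    fix g h assume gh: "g \<in> swap_maps" "h \<in> swap_maps" "upward g = upward h"
    obtain D where "D \<in> upward g" using upward_nonempty [OF gh(1)] .
    with gh show "g = h" using upward_unique [of D g h] by (auto simp: swap_maps_def)
  qed
  have surj: "\<exists>g\<in>swap_maps. c = upward g" if "c \<in> carrier ?B" for c
  proof -
    from that obtain D where "D \<in> WW" "c = diag_equiv S R [x] `` {D}"
      by (auto simp: braided_diagram_group_def elim: quotientE)
    then show ?thesis using upward_some upward_class by metis
  qed
  have "bij_betw upward swap_maps (carrier ?B)"
    using inj in_B surj by (auto intro!: bij_betw_imageI)
  then show ?thesis
    using in_B mult by (auto simp: iso_def hom_def swap_group_def)
qed

lemma swap_group_closed: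
  "a \<in> carrier swap_group \<Longrightarrow> b \<in> carrier swap_group \<Longrightarrow> a \<otimes>\<^bsub>swap_group\<^esub> b \<in> carrier swap_group"
  by (simp add: swap_group_def swap_maps_closed)

end

section \<open>Similarity structures coded by paths\<close>

locale ultrametric_space =
  fixes X :: "'p set" and d :: "'p \<Rightarrow> 'p \<Rightarrow> real"
  assumes ultra: "ultrametric X d"

sublocale ultrametric_space \<subseteq> Metric_space X d
  using ultra by (simp add: ultrametric_def)

context ultrametric_space
begin

lemma strong_triangle: "x \<in> X \<Longrightarrow> y \<in> X \<Longrightarrow> z \<in> X \<Longrightarrow> d x z \<le> max (d x y) (d y z)"
  using ultra by (simp add: ultrametric_def)

lemma ballsE:
  assumes "B \<in> balls X d"
  obtains c r where "c \<in> X" "r > 0" "B = mcball c r"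
  using assms by (auto simp: balls_def)

lemma ballsI: "c \<in> X \<Longrightarrow> r > 0 \<Longrightarrow> mcball c r \<in> balls X d"
  by (auto simp: balls_def)

lemma ball_subset: "B \<in> balls X d \<Longrightarrow> B \<subseteq> X"
  by (auto simp: balls_def)

lemma ball_nonempty: "B \<in> balls X d \<Longrightarrow> B \<noteq> {}"
  by (metis ballsE centre_in_mcball_iff empty_iff less_imp_le)

lemma mcball_recentre:
  assumes "y \<in> mcball c r"
  shows "mcball c r = mcball y r"
proof -
  have *: "z \<in> mcball y r" if "z \<in> mcball c r" "y \<in> mcball c r" for y z c
    using that strong_triangle [of y c z] by (auto simp: commute [of y])
  have "0 \<le> r" using assms order_trans [OF nonneg] by auto
  then have "c \<in> mcball c r" using assms by auto
  then have "c \<in> mcball y r" using * assms by blast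
  then show ?thesis using * assms by blast
qed

lemma ball_centredE:
  assumes "B \<in> balls X d" "y \<in> B"
  obtains r where "r > 0" "B = mcball y r"
  using assms mcball_recentre by (metis ballsE)

lemma balls_nested_or_disjoint:
  assumes "A \<in> balls X d" "B \<in> balls X d"
  shows "A \<subseteq> B \<or> B \<subseteq> A \<or> A \<inter> B = {}"
proof (cases "A \<inter> B = {}")
  case False
  then obtain y where y: "y \<in> A" "y \<in> B" by blast
  obtain r s where "A = mcball y r" "B = mcball y s"
    using ball_centredE assms y by metis
  then show ?thesis by (cases "r \<le> s") (auto simp: mcball_def)
qed simp

lemma locally_similar_continuous:
  assumes "g ` X \<subseteq> X"
    and loc: "\<And>x. x \<in> X \<Longrightarrow> \<exists>B\<in>balls X d. x \<in> B \<and> (\<exists>c. \<forall>y\<in>B. \<forall>z\<in>B. d (g y) (g z) = c * d y z)"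
  shows "continuous_map mtopology mtopology g"
proof -
  have "\<exists>\<delta>>0. \<forall>y. y \<in> X \<and> d x y < \<delta> \<longrightarrow> d (g x) (g y) < \<epsilon>" if x: "x \<in> X" and "\<epsilon> > 0" for x \<epsilon>
  proof -
    obtain B c where B: "B \<in> balls X d" "x \<in> B" and c: "\<And>y z. y \<in> B \<Longrightarrow> z \<in> B \<Longrightarrow> d (g y) (g z) = c * d y z"
      using loc [OF x] by blast
    obtain r where r: "r > 0" "B = mcball x r" using ball_centredE [OF B] .
    \<comment> \<open>The bound \<open>r\<close> keeps \<open>y\<close> in the ball where
      \<open>g\<close> scales by \<open>c\<close>; the summand 1 keeps the denominator positive
      whatever \<open>c\<close> is.\<close>
    have "d (g x) (g y) < \<epsilon>" if y: "y \<in> X" "d x y < min r (\<epsilon> / (\<bar>c\<bar> + 1))" for y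
    proof -
      have "y \<in> B" using y x r by simp
      then have "d (g x) (g y) = c * d x y" using c B by blast
      also have "\<dots> \<le> (\<bar>c\<bar> + 1) * d x y" by (intro mult_right_mono) auto
      also have "\<dots> < \<epsilon>" using y(2) by (simp add: field_simps)
      finally show ?thesis .
    qed
    then show ?thesis
      using r(1) \<open>\<epsilon> > 0\<close> by (intro exI [of _ "min r (\<epsilon> / (\<bar>c\<bar> + 1))"]) auto
  qed
  then show ?thesis
    using assms(1) by (auto simp: metric_continuous_map [OF Metric_space_axioms])
qed

end

locale sim_space = ultrametric_space X d for X :: "'p set" and d :: "'p \<Rightarrow> 'p \<Rightarrow> real" +
  fixes Sim :: "'p set \<Rightarrow> 'p set \<Rightarrow> ('p \<Rightarrow> 'p) set"
  assumes sim: "finite_sim_structure X d Sim"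
begin

lemma sim_similarity:
  "A \<in> balls X d \<Longrightarrow> B \<in> balls X d \<Longrightarrow> f \<in> Sim A B \<Longrightarrow> surj_similarity d A B f"
  using sim by (simp add: finite_sim_structure_def)

lemma sim_scale:
  "A \<in> balls X d \<Longrightarrow> B \<in> balls X d \<Longrightarrow> f \<in> Sim A B \<Longrightarrow>
    \<exists>c>0. \<forall>x\<in>A. \<forall>y\<in>A. d (f x) (f y) = c * d x y"
  using sim_similarity [of A B f] by (simp add: surj_similarity_def)

lemma sim_scaleE:
  assumes "A \<in> balls X d" "B \<in> balls X d" "f \<in> Sim A B"
  obtains c where "c > 0" "\<forall>y\<in>A. \<forall>z\<in>A. d (f y) (f z) = c * d y z"
  using sim_scale [OF assms] by (elim exE conjE) (rule that)

lemma sim_id: "B \<in> balls X d \<Longrightarrow> restrict id B \<in> Sim B B"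
  using sim by (simp add: finite_sim_structure_def)

lemma sim_inverse:
  "A \<in> balls X d \<Longrightarrow> B \<in> balls X d \<Longrightarrow> f \<in> Sim A B \<Longrightarrow> restrict (inv_into A f) B \<in> Sim B A"
  using sim by (simp add: finite_sim_structure_def)

lemma sim_compose:
  "A \<in> balls X d \<Longrightarrow> B \<in> balls X d \<Longrightarrow> C \<in> balls X d \<Longrightarrow> f \<in> Sim A B \<Longrightarrow> g \<in> Sim B C \<Longrightarrow>
    restrict (g \<circ> f) A \<in> Sim A C"
  using sim by (simp add: finite_sim_structure_def)

lemma sim_restrict:
  "A \<in> balls X d \<Longrightarrow> B \<in> balls X d \<Longrightarrow> f \<in> Sim A B \<Longrightarrow> C \<in> balls X d \<Longrightarrow> C \<subseteq> A \<Longrightarrow>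
    restrict f C \<in> Sim C (f ` C)"
  using sim by (simp add: finite_sim_structure_def)

text \<open>Continuity comes for free: \<open>g\<close> scales distances on small balls, and its
  inverse does so on their images, which are again balls. A bijection with the local condition is
  therefore a homeomorphism.\<close>

lemma Gamma_set_iff:
  "g \<in> Gamma_set X d Sim \<longleftrightarrow> g \<in> extensional X \<and> bij_betw g X X \<and>
     (\<forall>x\<in>X. \<exists>B\<in>balls X d. x \<in> B \<and> g ` B \<in> balls X d \<and> restrict g B \<in> Sim B (g ` B))"
proof
  assume "g \<in> Gamma_set X d Sim"
  then show "g \<in> extensional X \<and> bij_betw g X X \<and>
     (\<forall>x\<in>X. \<exists>B\<in>balls X d. x \<in> B \<and> g ` B \<in> balls X d \<and> restrict g B \<in> Sim B (g ` B))"
    by (auto simp: Gamma_set_def homeomorphic_eq_everything_map bij_betw_def)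
next
  assume *: "g \<in> extensional X \<and> bij_betw g X X \<and>
     (\<forall>x\<in>X. \<exists>B\<in>balls X d. x \<in> B \<and> g ` B \<in> balls X d \<and> restrict g B \<in> Sim B (g ` B))"
  then have bij: "bij_betw g X X" by blast
  let ?k = "inv_into X g"
  have k: "bij_betw ?k X X" using bij by (rule bij_betw_inv_into)
  have loc: "\<exists>B\<in>balls X d. x \<in> B \<and> g ` B \<in> balls X d \<and>
      (\<exists>c>0. \<forall>y\<in>B. \<forall>z\<in>B. d (g y) (g z) = c * d y z)" if x: "x \<in> X" for x
  proof -
    obtain B where B: "B \<in> balls X d" "x \<in> B" "g ` B \<in> balls X d" "restrict g B \<in> Sim B (g ` B)"
      using bspec [OF conjunct2 [OF conjunct2 [OF *]] x] by (elim bexE conjE)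
    obtain c where c: "c > 0" "\<forall>y\<in>B. \<forall>z\<in>B. d (restrict g B y) (restrict g B z) = c * d y z"
      using B(1,3,4) by (rule sim_scaleE)
    then have "\<forall>y\<in>B. \<forall>z\<in>B. d (g y) (g z) = c * d y z" by simp
    then show ?thesis using B(1-3) c(1) by metis
  qed
  have "continuous_map mtopology mtopology g"
  proof (rule locally_similar_continuous)
    show "g ` X \<subseteq> X" using bij by (simp add: bij_betw_def)
    show "\<exists>B\<in>balls X d. y \<in> B \<and> (\<exists>c. \<forall>u\<in>B. \<forall>v\<in>B. d (g u) (g v) = c * d u v)" if "y \<in> X" for y
      using loc [OF that] by (elim bexE conjE exE) (rule bexI, rule conjI, assumption, rule exI, assumption+)
  qed
  moreover have "continuous_map mtopology mtopology ?k"
  proof (rule locally_similar_continuous)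
    show "?k ` X \<subseteq> X" using k by (simp add: bij_betw_def)
    fix y assume y: "y \<in> X"
    then have "?k y \<in> X" using k by (auto dest: bij_betwE)
    from loc [OF this] obtain B c where B: "B \<in> balls X d" "?k y \<in> B" "g ` B \<in> balls X d"
      and c: "c > 0" "\<And>u v. u \<in> B \<Longrightarrow> v \<in> B \<Longrightarrow> d (g u) (g v) = c * d u v" by blast
    have k_g: "?k (g u) = u" if "u \<in> B" for u
      using that ball_subset [OF B(1)] bij by (auto simp: bij_betw_inv_into_left)
    have "g (?k y) = y" using bij y by (rule bij_betw_inv_into_right)
    with B(2) have "y \<in> g ` B" by force
    \<comment> \<open>The inverse scales by the reciprocal ratio, which exists because members of
      \<open>Sim\<close> have positive ratio.\<close>
    moreover have "\<forall>u\<in>g ` B. \<forall>v\<in>g ` B. d (?k u) (?k v) = (1 / c) * d u v"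
      using k_g c by auto
    ultimately show "\<exists>B\<in>balls X d. y \<in> B \<and> (\<exists>c. \<forall>u\<in>B. \<forall>v\<in>B. d (?k u) (?k v) = c * d u v)"
      using B(3) by blast
  qed
  moreover have "open_map mtopology mtopology g \<longleftrightarrow> continuous_map mtopology mtopology ?k"
  proof (rule open_eq_continuous_inverse_map)
    show "g y \<in> topspace mtopology \<and> ?k (g y) = y" if "y \<in> topspace mtopology" for y
      using that bij_betw_inv_into_left [OF bij] bij_betwE [OF bij] by simp
    show "?k y \<in> topspace mtopology \<and> g (?k y) = y" if "y \<in> topspace mtopology" for y
      using that bij_betw_inv_into_right [OF bij] bij_betwE [OF k] by simp
  qed
  ultimately have "homeomorphic_map mtopology mtopology g"
    using bij by (intro bijective_open_imp_homeomorphic_map) (auto simp: bij_betw_def)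
  then show "g \<in> Gamma_set X d Sim" using * by (auto simp: Gamma_set_def bij_betw_def)
qed

end

text \<open>The meeting point of both halves of the theorem: points are paths, balls are cylinders,
  and the similarities are exactly the prefix swaps between nodes with the same letter.\<close>

locale coded_sim_space =
  rooted_presentation ch S R x + sim_space X d Sim
  for ch :: "'a \<Rightarrow> 'a list" and S R x and X :: "'p set" and d Sim +
  fixes \<Psi> :: "(nat \<Rightarrow> nat) \<Rightarrow> 'p" and Bl :: "nat list \<Rightarrow> 'p set"
  defines "Bl \<equiv> (\<lambda>u. \<Psi> ` app u ` E (lbl x u))"
  assumes \<Psi>_bij: "bij_betw \<Psi> (E x) X"
    and balls_coded: "balls X d = Bl ` {u. node x u}"
    and Sim_coded: "node x u \<Longrightarrow> node x v \<Longrightarrow> f \<in> Sim (Bl u) (Bl v) \<longleftrightarrow>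
       lbl x u = lbl x v \<and> f \<in> extensional (Bl u) \<and>
       (\<forall>r. ends (lbl x u) r \<longrightarrow> f (\<Psi> (app u r)) = \<Psi> (app v r))"
begin

definition transport :: "((nat \<Rightarrow> nat) \<Rightarrow> nat \<Rightarrow> nat) \<Rightarrow> 'p \<Rightarrow> 'p" where
  "transport g = restrict (\<lambda>y. \<Psi> (g (inv_into (E x) \<Psi> y))) X"

lemma \<Psi>_in: "ends x p \<Longrightarrow> \<Psi> p \<in> X"
  using \<Psi>_bij by (auto dest: bij_betwE)

lemma \<Psi>_obtain:
  assumes "y \<in> X" obtains p where "ends x p" "y = \<Psi> p"
  using \<Psi>_bij assms by (auto simp: bij_betw_def)

lemma \<Psi>_inject: "ends x p \<Longrightarrow> ends x q \<Longrightarrow> \<Psi> p = \<Psi> q \<longleftrightarrow> p = q"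
  using \<Psi>_bij by (auto simp: bij_betw_def inj_on_def)

lemma transport_\<Psi>: "ends x p \<Longrightarrow> transport g (\<Psi> p) = \<Psi> (g p)"
  using \<Psi>_bij by (simp add: transport_def \<Psi>_in bij_betw_inv_into_left)

lemma transport_in_Gamma:
  assumes g: "g \<in> swap_maps"
  shows "transport g \<in> Gamma_set X d Sim"
proof -
  have bij: "bij_betw g (E x) (E x)" using g by (simp add: swap_maps_def)
  then have g_ends: "ends x p \<Longrightarrow> ends x (g p)" for p by (auto dest: bij_betwE)
  have "bij_betw (transport g) X X"
  proof (rule bij_betw_imageI)
    show "inj_on (transport g) X"
    proof (rule inj_onI)
      fix y z assume yz: "y \<in> X" "z \<in> X" "transport g y = transport g z"
      obtain p q where pq: "ends x p" "y = \<Psi> p" "ends x q" "z = \<Psi> q" using yz \<Psi>_obtain by metis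
      then have "g p = g q" using yz(3) by (simp add: transport_\<Psi> \<Psi>_inject g_ends)
      then show "y = z" using pq bij by (auto simp: bij_betw_def inj_on_def)
    qed
    have "y \<in> transport g ` X" if y: "y \<in> X" for y
    proof -
      obtain q where q: "ends x q" "y = \<Psi> q" using \<Psi>_obtain [OF y] .
      then obtain p where "ends x p" "q = g p" using bij by (auto simp: bij_betw_def)
      then have "y = transport g (\<Psi> p)" "\<Psi> p \<in> X" using q by (auto simp: transport_\<Psi> \<Psi>_in)
      then show ?thesis by blast
    qed
    moreover have "transport g y \<in> X" if y: "y \<in> X" for y
      using \<Psi>_obtain [OF y] by (metis transport_\<Psi> \<Psi>_in g_ends)
    ultimately show "transport g ` X = X" by blast
  qed
  moreover have "\<exists>B\<in>balls X d. y \<in> B \<and> transport g ` B \<in> balls X d \<and> restrict (transport g) B \<in> Sim B (transport g ` B)"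
    if y: "y \<in> X" for y
  proof -
    obtain p where p: "ends x p" "y = \<Psi> p" using \<Psi>_obtain [OF y] .
    then obtain u v r where uv: "swaps g u v" "p = app u r" using g by (auto simp: swap_maps_def)
    then have nodes: "node x u" "node x v" "lbl x u = lbl x v"
      and g_app: "\<And>r. ends (lbl x u) r \<Longrightarrow> g (app u r) = app v r" by (auto simp: swaps_def)
    have t: "transport g (\<Psi> (app u r)) = \<Psi> (app v r)" if "ends (lbl x u) r" for r
      using that nodes g_app by (simp add: transport_\<Psi>)
    then have img: "transport g ` Bl u = Bl v"
      unfolding Bl_def image_image nodes(3) [symmetric] by (intro image_cong) auto
    moreover have "y \<in> Bl u" using p uv nodes by (auto simp: Bl_def)
    moreover have "restrict (transport g) (Bl u) \<in> Sim (Bl u) (Bl v)"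
      using t nodes Sim_coded [OF nodes(1,2)] by (auto simp: Bl_def)
    ultimately show ?thesis using nodes balls_coded by (intro bexI [of _ "Bl u"]) auto
  qed
  ultimately show ?thesis by (simp add: Gamma_set_iff transport_def)
qed

text \<open>Around each point \<open>h\<close> restricts to a member of \<open>Sim\<close> between
  two balls. Under the coding these are cylinders, and membership says that \<open>h\<close>
  exchanges their prefixes.\<close>

lemma transport_surj:
  assumes h: "h \<in> Gamma_set X d Sim"
  shows "\<exists>g\<in>swap_maps. h = transport g"
proof -
  define g where "g = restrict (\<lambda>p. inv_into (E x) \<Psi> (h (\<Psi> p))) (E x)"
  have hb: "bij_betw h X X" and h_ext: "h \<in> extensional X" using h by (auto simp: Gamma_set_iff)
  have gb: "bij_betw g (E x) (E x)"
  proof -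
    have "bij_betw (inv_into (E x) \<Psi> \<circ> (h \<circ> \<Psi>)) (E x) (E x)"
      using \<Psi>_bij hb by (meson bij_betw_inv_into bij_betw_trans)
    then show ?thesis
      by (subst bij_betw_cong [of _ _ "inv_into (E x) \<Psi> \<circ> (h \<circ> \<Psi>)"]) (simp_all add: g_def)
  qed
  have g: "\<Psi> (g p) = h (\<Psi> p)" if "ends x p" for p
    using that hb \<Psi>_bij \<Psi>_in [OF that] by (simp add: g_def bij_betw_inv_into_right bij_betwE)
  have "\<exists>u v r. swaps g u v \<and> p = app u r" if p: "ends x p" for p
  proof -
    obtain B where B: "B \<in> balls X d" "\<Psi> p \<in> B" "h ` B \<in> balls X d" "restrict h B \<in> Sim B (h ` B)"
      using bspec [OF conjunct2 [OF conjunct2 [OF h [unfolded Gamma_set_iff]]] \<Psi>_in [OF p]] by (elim bexE conjE)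
    from B(1,3) obtain u v where uv: "node x u" "B = Bl u" "node x v" "h ` B = Bl v"
      by (auto simp: balls_coded)
    have s: "lbl x u = lbl x v" "\<And>r. ends (lbl x u) r \<Longrightarrow> restrict h (Bl u) (\<Psi> (app u r)) = \<Psi> (app v r)"
      using B(4) uv by (auto simp: Sim_coded)
    have "g (app u r) = app v r" if r: "ends (lbl x u) r" for r
    proof -
      have "\<Psi> (app u r) \<in> Bl u" using r by (auto simp: Bl_def)
      then have "\<Psi> (g (app u r)) = \<Psi> (app v r)" using s(2) [OF r] g r uv by simp
      moreover have "ends x (g (app u r))" using gb r uv by (auto dest: bij_betwE)
      ultimately show ?thesis using \<Psi>_inject r s uv by simp
    qed
    then have "swaps g u v" using uv s by (simp add: swaps_def)
    moreover obtain r where "ends (lbl x u) r" "\<Psi> p = \<Psi> (app u r)"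
      using B(2) uv by (auto simp: Bl_def)
    then have "p = app u r" using \<Psi>_inject p uv by simp
    ultimately show ?thesis by blast
  qed
  then have "g \<in> swap_maps" using gb by (simp add: swap_maps_def g_def)
  moreover have "h = transport g"
  proof (rule extensionalityI [OF h_ext])
    show "transport g \<in> extensional X" by (simp add: transport_def)
    fix y assume "y \<in> X"
    then show "h y = transport g y" using \<Psi>_obtain g transport_\<Psi> by metis
  qed
  ultimately show ?thesis by blast
qed

theorem transport_iso: "transport \<in> iso swap_group (Gamma X d Sim)"
proof -
  have "transport (restrict (g \<circ> h) (E x)) = restrict (transport g \<circ> transport h) X"
    if gh: "g \<in> swap_maps" "h \<in> swap_maps" for g h
  proof (rule extensionalityI [of _ X])
    fix y assume "y \<in> X"
    then obtain p where p: "ends x p" "y = \<Psi> p" using \<Psi>_obtain by metis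
    then have "ends x (h p)" using gh by (auto simp: swap_maps_def dest: bij_betwE)
    then show "transport (restrict (g \<circ> h) (E x)) y = restrict (transport g \<circ> transport h) X y"
      using p \<open>y \<in> X\<close> by (simp add: transport_\<Psi>)
  qed (simp_all add: transport_def)
  moreover have "inj_on transport swap_maps"
  proof (rule inj_onI)
    fix g h assume gh: "g \<in> swap_maps" "h \<in> swap_maps" "transport g = transport h"
    show "g = h"
    proof (rule extensionalityI [of _ "E x"])
      fix p assume "p \<in> E x"
      then have p: "ends x p" "ends x (g p)" "ends x (h p)"
        using gh by (auto simp: swap_maps_def dest: bij_betwE)
      then have "\<Psi> (g p) = \<Psi> (h p)" using gh(3) transport_\<Psi> by metis
      then show "g p = h p" using p \<Psi>_inject by simp
    qed (use gh in \<open>auto simp: swap_maps_def\<close>)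
  qed
  moreover have "transport ` swap_maps = Gamma_set X d Sim"
    using transport_in_Gamma transport_surj by blast
  ultimately show ?thesis
    by (auto simp: iso_def hom_def swap_group_def Gamma_def bij_betw_def)
qed

end

section \<open>The path space of a tree-like presentation\<close>

text \<open>The standard metric on sequences. All distances are powers of 1/2 or zero, so closed
  balls only see how many initial steps agree.\<close>

definition path_dist :: "(nat \<Rightarrow> nat) \<Rightarrow> (nat \<Rightarrow> nat) \<Rightarrow> real" where
  "path_dist p q = (if p = q then 0 else (1/2) ^ (LEAST n. p n \<noteq> q n))"

definition path_less :: "(nat \<Rightarrow> nat) \<Rightarrow> (nat \<Rightarrow> nat) \<Rightarrow> bool" where
  "path_less p q \<longleftrightarrow> (\<exists>n. (\<forall>k<n. p k = q k) \<and> p n < q n)"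

lemma first_difference:
  fixes p q :: "nat \<Rightarrow> nat"
  assumes "p \<noteq> q"
  obtains n where "p n \<noteq> q n" "\<And>k. k < n \<Longrightarrow> p k = q k"
proof (rule that)
  show "p (LEAST n. p n \<noteq> q n) \<noteq> q (LEAST n. p n \<noteq> q n)"
    using assms by (intro LeastI_ex [of "\<lambda>n. p n \<noteq> q n"]) (auto simp: fun_eq_iff)
qed (use not_less_Least [of _ "\<lambda>n. p n \<noteq> q n"] in blast)

lemma path_dist_eqI:
  assumes "p n \<noteq> q n" "\<And>k. k < n \<Longrightarrow> p k = q k"
  shows "path_dist p q = (1/2) ^ n"
proof -
  have "(LEAST n. p n \<noteq> q n) = n" using assms by (intro Least_equality) (auto simp: not_less [symmetric])
  then show ?thesis using assms(1) by (auto simp: path_dist_def)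
qed

lemma path_dist_self [simp]: "path_dist p p = 0"
  by (simp add: path_dist_def)

lemma path_dist_nonneg: "0 \<le> path_dist p q"
  by (simp add: path_dist_def)

lemma path_dist_commute: "path_dist p q = path_dist q p"
  by (simp add: path_dist_def eq_commute)

lemma path_dist_eq_0 [simp]: "path_dist p q = 0 \<longleftrightarrow> p = q"
  by (simp add: path_dist_def)

lemma path_dist_ge: "p n \<noteq> q n \<Longrightarrow> (1/2) ^ n \<le> path_dist p q"
  by (auto simp: path_dist_def intro!: power_decreasing Least_le)

lemma path_dist_le_iff: "path_dist p q \<le> (1/2) ^ n \<longleftrightarrow> (\<forall>k<n. p k = q k)"
proof
  assume le: "path_dist p q \<le> (1/2) ^ n"
  show "\<forall>k<n. p k = q k"
  proof (intro allI impI, rule ccontr)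
    fix k assume "k < n" "p k \<noteq> q k"
    then have "(1/2) ^ k \<le> path_dist p q" by (simp add: path_dist_ge)
    moreover have "(1/2::real) ^ n < (1/2) ^ k" using \<open>k < n\<close> by (intro power_strict_decreasing) auto
    ultimately show False using le by simp
  qed
next
  assume eq: "\<forall>k<n. p k = q k"
  show "path_dist p q \<le> (1/2) ^ n"
  proof (cases "p = q")
    case False
    then obtain m where m: "p m \<noteq> q m" "\<And>k. k < m \<Longrightarrow> p k = q k" by (rule first_difference) blast
    then have "n \<le> m" using eq by (metis not_le)
    then show ?thesis using path_dist_eqI [of p m q, OF m] by (simp add: power_decreasing)
  qed simp
qed

text \<open>The strict bound costs one more coordinate: the next smaller possible distance is half
  of the bound.\<close>

lemma path_dist_less_iff: "path_dist p q < (1/2) ^ n \<longleftrightarrow> (\<forall>k\<le>n. p k = q k)"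
proof -
  have "path_dist p q < (1/2) ^ n \<longleftrightarrow> path_dist p q \<le> (1/2) ^ Suc n"
  proof
    assume lt: "path_dist p q < (1/2) ^ n"
    then have "\<forall>k<Suc n. p k = q k"
      using path_dist_ge [of p _ q] path_dist_le_iff [of p q n] by (metis less_antisym less_imp_le not_le)
    then show "path_dist p q \<le> (1/2) ^ Suc n" by (simp only: path_dist_le_iff)
  next
    assume "path_dist p q \<le> (1/2) ^ Suc n"
    also have "\<dots> < (1/2) ^ n" by simp
    finally show "path_dist p q < (1/2) ^ n" .
  qed
  then show ?thesis by (simp only: path_dist_le_iff less_Suc_eq_le)
qed

lemma path_dist_strong_triangle: "path_dist p r \<le> max (path_dist p q) (path_dist q r)"
proof (cases "p = r")
  case False
  then obtain n where n: "p n \<noteq> r n" "\<And>k. k < n \<Longrightarrow> p k = r k" by (rule first_difference) blast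
  then have "p n \<noteq> q n \<or> q n \<noteq> r n" by auto
  then show ?thesis
    using path_dist_eqI [of p n r, OF n] path_dist_ge [of p n q] path_dist_ge [of q n r] by auto
qed (simp add: path_dist_nonneg le_max_iff_disj)

lemma path_dist_scons: "path_dist (scons i p) (scons i q) = path_dist p q / 2"
proof (cases "p = q")
  case False
  then obtain n where n: "p n \<noteq> q n" "\<And>k. k < n \<Longrightarrow> p k = q k" by (rule first_difference) blast
  have "path_dist (scons i p) (scons i q) = (1/2) ^ Suc n"
  proof (rule path_dist_eqI)
    show "scons i p k = scons i q k" if "k < Suc n" for k
      using n(2) that by (cases k) auto
  qed (use n in simp)
  then show ?thesis using path_dist_eqI [of p n q, OF n] by simp
qed simp

lemma path_dist_app: "path_dist (app u p) (app u q) = (1/2) ^ length u * path_dist p q"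
  by (induction u) (simp_all add: path_dist_scons)

lemma path_less_scons: "path_less (scons i p) (scons i q) \<longleftrightarrow> path_less p q"
proof
  assume "path_less (scons i p) (scons i q)"
  then obtain n where n: "\<forall>k<n. scons i p k = scons i q k" "scons i p n < scons i q n"
    by (auto simp: path_less_def)
  then obtain m where "n = Suc m" by (cases n) auto
  with n have "\<forall>k<m. p k = q k" "p m < q m" by auto
  then show "path_less p q" by (auto simp: path_less_def)
next
  assume "path_less p q"
  then obtain n where n: "\<forall>k<n. p k = q k" "p n < q n" by (auto simp: path_less_def)
  have "\<forall>k<Suc n. scons i p k = scons i q k"
  proof (intro allI impI)
    fix k assume "k < Suc n"
    then show "scons i p k = scons i q k" using n by (cases k) auto
  qed
  then show "path_less (scons i p) (scons i q)" using n by (auto simp: path_less_def intro!: exI [of _ "Suc n"])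
qed

lemma path_less_app: "path_less (app u p) (app u q) \<longleftrightarrow> path_less p q"
  by (induction u) (simp_all add: path_less_scons)

lemma path_less_irrefl: "\<not> path_less p p"
  by (simp add: path_less_def)

lemma path_less_trans:
  assumes "path_less p q" "path_less q r"
  shows "path_less p r"
proof -
  obtain m where m: "\<forall>k<m. p k = q k" "p m < q m" using assms(1) by (auto simp: path_less_def)
  obtain n where n: "\<forall>k<n. q k = r k" "q n < r n" using assms(2) by (auto simp: path_less_def)
  consider "m < n" | "m = n" | "n < m" by linarith
  then show ?thesis
  proof cases
    case 1
    then show ?thesis using m n unfolding path_less_def by (intro exI [of _ m]) auto
  next
    case 2
    then show ?thesis using m n unfolding path_less_def by (intro exI [of _ m]) auto
  next
    case 3
    then show ?thesis using m n unfolding path_less_def by (intro exI [of _ n]) auto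
  qed
qed

lemma path_less_total: "p \<noteq> q \<Longrightarrow> path_less p q \<or> path_less q p"
proof -
  assume "p \<noteq> q"
  then obtain n where n: "p n \<noteq> q n" "\<And>k. k < n \<Longrightarrow> p k = q k" by (rule first_difference) blast
  then consider "p n < q n" | "q n < p n" by linarith
  then show ?thesis
  proof cases
    case 1
    then show ?thesis using n(2) by (auto simp: path_less_def)
  next
    case 2
    then show ?thesis using n(2) [symmetric] by (auto simp: path_less_def)
  qed
qed

text \<open>The lexicographic order is decided at the first difference, and moving both points by
  less than their distance leaves all coordinates up to there unchanged. This gives the
  compatibility of order and balls.\<close>

lemma path_less_close:
  assumes "path_less p q" "path_dist p p' < path_dist p q" "path_dist q q' < path_dist p q"
  shows "path_less p' q'"
proof -
  obtain n where n: "\<forall>k<n. p k = q k" "p n < q n" using assms(1) by (auto simp: path_less_def)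
  then have "path_dist p q = (1/2) ^ n" by (intro path_dist_eqI) auto
  with assms have "\<forall>k\<le>n. p k = p' k" "\<forall>k\<le>n. q k = q' k"
    by (simp_all only: path_dist_less_iff)
  with n have "\<forall>k<n. p' k = q' k" "p' n < q' n" by (metis less_imp_le, metis order_refl)
  then show ?thesis by (auto simp: path_less_def)
qed

section \<open>Balls, compactness, order and similarities of the path space\<close>

context rooted_presentation
begin

definition cyl :: "nat list \<Rightarrow> (nat \<Rightarrow> nat) set" where
  "cyl u = app u ` E (lbl x u)"

lemma cyl_iff: "node x u \<Longrightarrow> p \<in> cyl u \<longleftrightarrow> ends x p \<and> (\<forall>i<length u. p i = u ! i)"
proof
  assume *: "node x u" "ends x p \<and> (\<forall>i<length u. p i = u ! i)"
  have "p = app u (\<lambda>n. p (n + length u))"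
    using * by (auto simp: app_nth fun_eq_iff)
  moreover from this have "ends (lbl x u) (\<lambda>n. p (n + length u))" using * by (metis ends_app)
  ultimately show "p \<in> cyl u" unfolding cyl_def by blast
qed (auto simp: cyl_def app_nth)

lemma app_in_cyl: "ends (lbl x u) r \<Longrightarrow> app u r \<in> cyl u"
  by (simp add: cyl_def)

lemma cyl_subset: "node x u \<Longrightarrow> node x w \<Longrightarrow> cyl w \<subseteq> cyl u \<Longrightarrow> \<exists>s. w = u @ s"
proof -
  assume *: "node x u" "node x w" "cyl w \<subseteq> cyl u"
  have "app w (\<lambda>_. 0) \<in> cyl u" using * by (intro subsetD [OF *(3)]) (simp add: cyl_def)
  then obtain q where "app w (\<lambda>_. 0) = app u q" by (auto simp: cyl_def)
  then consider s where "w = u @ s" | s where "u = w @ s" using app_eq_comparable by blast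
  then show ?thesis
  proof cases
    case 2
    have "s = []"
    proof (rule cylinder_self)
      show "node (lbl x w) s" using * 2 by simp
      fix p assume "ends (lbl x w) p"
      then have "app w p \<in> cyl u" using *(3) app_in_cyl by blast
      then show "\<exists>q. p = app s q" using 2 by (auto simp: cyl_def)
    qed
    with 2 show ?thesis by simp
  qed blast
qed

lemma cyl_inject: "node x u \<Longrightarrow> node x v \<Longrightarrow> cyl u = cyl v \<longleftrightarrow> u = v"
  using cylinder_inject unfolding cyl_def by blast

lemma ultrametric_path_space: "ultrametric (E x) path_dist"
proof -
  have "path_dist p r \<le> path_dist p q + path_dist q r" for p q r
    using path_dist_strong_triangle [of p r q] path_dist_nonneg [of p q] path_dist_nonneg [of q r] by linarith
  then show ?thesis
    by (auto simp: ultrametric_def Metric_space_def path_dist_nonneg path_dist_strong_triangle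
      intro: path_dist_commute)
qed

lemma path_ultrametric_space: "ultrametric_space (E x) path_dist"
  by unfold_locales (rule ultrametric_path_space)

interpretation P: ultrametric_space "E x" path_dist
  by (rule path_ultrametric_space)

lemma mcball_power: "ends x p \<Longrightarrow> P.mcball p ((1/2) ^ n) = {q. ends x q \<and> (\<forall>k<n. p k = q k)}"
  by (auto simp: path_dist_le_iff)

text \<open>If the path ends before depth \<open>n\<close>, agreement up to \<open>n\<close> already
  forces equality, and the cylinder of its leaf is that single point.\<close>

lemma agreement_cyl:
  assumes "ends x p"
  shows "\<exists>u. node x u \<and> {q. ends x q \<and> (\<forall>k<n. p k = q k)} = cyl u"
proof -
  obtain u r where u: "node x u" "p = app u r" "ends (lbl x u) r" "length u = n \<or> length u \<le> n \<and> ch (lbl x u) = []"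
    using ends_prefix [OF assms, of n] by blast
  have "{q. ends x q \<and> (\<forall>k<n. p k = q k)} = cyl u"
  proof (cases "length u = n")
    case True
    then show ?thesis using u(1,2) by (auto simp: cyl_iff app_nth)
  next
    case False
    then have leaf: "cyl u = {p}" "length u \<le> n" using u by (auto simp: cyl_def ends_leaf_iff)
    have "q = p" if "ends x q" "\<forall>k<n. p k = q k" for q
    proof -
      have "q i = u ! i" if "i < length u" for i
        using that \<open>\<forall>k<n. p k = q k\<close> leaf(2) u(2) by (metis app_nth less_le_trans)
      then have "q \<in> cyl u" using \<open>ends x q\<close> u(1) by (simp add: cyl_iff)
      then show ?thesis using leaf by simp
    qed
    then show ?thesis using leaf assms by auto
  qed
  then show ?thesis using u(1) by blast
qed

lemma balls_path_space: "balls (E x) path_dist = cyl ` {u. node x u}"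
proof (intro equalityI subsetI)
  fix B assume "B \<in> balls (E x) path_dist"
  then obtain p r where pr: "ends x p" "r > 0" "B = P.mcball p r" by (auto elim: P.ballsE)
  \<comment> \<open>A radius matters only through the largest power of 1/2 that does not exceed it,
    which is the power with the least exponent.\<close>
  define n where "n = (LEAST m. (1/2::real) ^ m \<le> r)"
  have "\<exists>m. (1/2::real) ^ m \<le> r"
    using real_arch_pow_inv [of r "1/2"] pr(2) by (auto intro: less_imp_le)
  then have n: "(1/2) ^ n \<le> r" unfolding n_def by (rule LeastI_ex)
  have "path_dist p q \<le> r \<longleftrightarrow> (\<forall>k<n. p k = q k)" for q
  proof
    assume le: "path_dist p q \<le> r"
    show "\<forall>k<n. p k = q k"
    proof (intro allI impI, rule ccontr)
      fix k assume "k < n" "p k \<noteq> q k"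
      then have "(1/2) ^ k \<le> r" using path_dist_ge [of p k q] le by simp
      then show False using \<open>k < n\<close> not_less_Least unfolding n_def by blast
    qed
  next
    assume "\<forall>k<n. p k = q k"
    then have "path_dist p q \<le> (1/2) ^ n" by (simp only: path_dist_le_iff)
    then show "path_dist p q \<le> r" using n by linarith
  qed
  then have "B = {q. ends x q \<and> (\<forall>k<n. p k = q k)}" using pr by auto
  then show "B \<in> cyl ` {u. node x u}" using agreement_cyl [OF pr(1), of n] by auto
next
  fix B assume "B \<in> cyl ` {u. node x u}"
  then obtain u where u: "node x u" "B = cyl u" by auto
  \<comment> \<open>Any point of the cylinder can be the centre; the leftmost one always
    exists.\<close>
  have "B = P.mcball (app u (\<lambda>_. 0)) ((1/2) ^ length u)"
    using u by (auto simp: mcball_power cyl_iff app_nth)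
  then show "B \<in> balls (E x) path_dist" using u P.ballsI by simp
qed

lemma compact_path_space: "compact_space P.mtopology"
  unfolding P.compact_space_eq_mcomplete_mtotally_bounded
proof
  have small: "\<exists>n. (1/2::real) ^ n < \<epsilon>" if "\<epsilon> > 0" for \<epsilon>
    using real_arch_pow_inv [of \<epsilon> "1/2"] that by auto
  show "P.mtotally_bounded (E x)"
    unfolding P.mtotally_bounded_def
  proof (intro allI impI)
    fix \<epsilon> :: real assume "\<epsilon> > 0"
    then obtain n where n: "(1/2) ^ n < \<epsilon>" using small by blast
    \<comment> \<open>The leftmost paths behind the nodes of depth at most \<open>n\<close> form a
      finite net; the shallower nodes account for paths that end early.\<close>
    define F where "F = {u. node x u \<and> length u \<le> n}"
    have "finite F"
    proof (rule koenig [of _ x])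
      fix p assume "ends x p"
      show "\<exists>m. map p [0..<m] \<notin> F" by (rule exI [of _ "Suc n"]) (simp add: F_def del: upt_Suc)
    qed (auto simp: F_def)
    have "\<exists>u\<in>F. path_dist (app u (\<lambda>_. 0)) p < \<epsilon>" if p: "ends x p" for p
    proof -
      obtain u r where u: "node x u" "p = app u r" "ends (lbl x u) r" "length u = n \<or> length u \<le> n \<and> ch (lbl x u) = []"
        using ends_prefix [OF p, of n] by blast
      have "path_dist (app u (\<lambda>_. 0)) p \<le> (1/2) ^ n"
      proof (cases "length u = n")
        case True
        then show ?thesis using u(2) by (auto simp: path_dist_le_iff app_nth)
      next
        case False
        then have "r = (\<lambda>_. 0)" using u by (auto simp: ends_leaf_iff)
        then show ?thesis using u(2) by simp
      qed
      moreover have "u \<in> F" using u by (auto simp: F_def)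
      ultimately show ?thesis using n by (meson le_less_trans)
    qed
    then have "E x \<subseteq> (\<Union>y\<in>(\<lambda>u. app u (\<lambda>_. 0)) ` F. P.mball y \<epsilon>)"
      by (force simp: F_def)
    then show "\<exists>K. finite K \<and> K \<subseteq> E x \<and> E x \<subseteq> (\<Union>y\<in>K. P.mball y \<epsilon>)"
      using \<open>finite F\<close> by (intro exI [of _ "(\<lambda>u. app u (\<lambda>_. 0)) ` F"]) (auto simp: F_def)
  qed
  show "P.mcomplete"
    unfolding P.mcomplete_def
  proof (intro allI impI)
    fix \<sigma> assume C: "P.MCauchy \<sigma>"
    then have \<sigma>: "ends x (\<sigma> n)" for n by (auto simp: P.MCauchy_def)
    have "\<exists>N. \<forall>k\<ge>N. \<forall>l\<ge>N. path_dist (\<sigma> k) (\<sigma> l) < (1/2) ^ n" for n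
      using C unfolding P.MCauchy_def by simp
    then obtain N where N: "\<And>n k l. k \<ge> N n \<Longrightarrow> l \<ge> N n \<Longrightarrow> path_dist (\<sigma> k) (\<sigma> l) < (1/2) ^ n"
      by metis
    \<comment> \<open>By the time \<open>N i\<close> the coordinate \<open>i\<close> has become
      constant along the sequence, and \<open>p\<close> collects these final values.\<close>
    define p where "p i = \<sigma> (N i) i" for i
    have p: "\<sigma> k i = p i" if "k \<ge> N i" for k i
      using N [OF that order_refl] by (auto simp: path_dist_less_iff p_def)
    \<comment> \<open>The sum is just a number above each of the finitely many
      \<open>N i\<close>.\<close>
    have agree: "\<forall>i<n. \<sigma> k i = p i" if k: "k \<ge> (\<Sum>i<n. N i)" for n k
    proof (intro allI impI)
      fix i assume "i < n"
      then have "N i \<le> (\<Sum>i<n. N i)" by (intro member_le_sum) auto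
      then show "\<sigma> k i = p i" using p k by simp
    qed
    have "ends x p"
      using \<sigma> agree by (intro ends_cong_limit) blast
    moreover have "\<exists>M. \<forall>k\<ge>M. ends x (\<sigma> k) \<and> path_dist (\<sigma> k) p < \<epsilon>" if \<epsilon>: "\<epsilon> > 0" for \<epsilon>
    proof -
      obtain n where n: "(1/2) ^ n < \<epsilon>" using small [OF \<epsilon>] by blast
      have "path_dist (\<sigma> k) p < \<epsilon>" if "k \<ge> (\<Sum>i<n. N i)" for k
      proof -
        have "path_dist (\<sigma> k) p \<le> (1/2) ^ n" unfolding path_dist_le_iff by (rule agree [OF that])
        with n show ?thesis by linarith
      qed
      then show ?thesis using \<sigma> by blast
    qed
    ultimately show "\<exists>p. limitin P.mtopology \<sigma> p sequentially"
      by (auto simp: P.limit_metric_sequentially)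
  qed
qed

definition path_order :: "((nat \<Rightarrow> nat) \<times> (nat \<Rightarrow> nat)) set" where
  "path_order = {(p, q). ends x p \<and> ends x q \<and> (p = q \<or> path_less p q)}"

lemma strict_less_path_order: "strict_less path_order p q \<longleftrightarrow> ends x p \<and> ends x q \<and> path_less p q"
  using path_less_irrefl by (auto simp: strict_less_def path_order_def)

lemma lin_ordered_path_space: "lin_ordered_ultrametric (E x) path_dist path_order"
  unfolding lin_ordered_ultrametric_def
proof (intro conjI ballI impI)
  show "ultrametric (E x) path_dist" by (rule ultrametric_path_space)
  show "linear_order_on (E x) path_order"
    using path_less_trans path_less_irrefl path_less_total
    unfolding linear_order_on_def partial_order_on_def preorder_on_def refl_on_def trans_def antisym_def total_on_def
    by (auto simp: path_order_def)
  fix B1 B2 p' q'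
  assume B: "B1 \<in> balls (E x) path_dist" "B2 \<in> balls (E x) path_dist" "B1 \<inter> B2 = {}"
    and "\<exists>p\<in>B1. \<exists>q\<in>B2. strict_less path_order p q" and in_B: "p' \<in> B1" "q' \<in> B2"
  then obtain p q where pq: "p \<in> B1" "q \<in> B2" "path_less p q"
    by (auto simp: strict_less_path_order)
  obtain r s where rs: "B1 = P.mcball p r" "B2 = P.mcball q s"
    using P.ball_centredE B pq by metis
  have ends: "ends x p" "ends x q" "ends x p'" "ends x q'"
    using B in_B pq P.ball_subset by blast+
  \<comment> \<open>The balls are disjoint, so neither radius reaches \<open>path_dist p q\<close>,
    while \<open>p'\<close> and \<open>q'\<close> stay within the respective radii.\<close>
  have "path_dist p p' < path_dist p q" "path_dist q q' < path_dist p q"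
    using rs in_B pq B(3) ends path_dist_commute [of p q] by fastforce+
  then show "strict_less path_order p' q'"
    using path_less_close pq ends by (auto simp: strict_less_path_order)
qed

text \<open>Between two cylinders there is the prefix swap if their nodes carry the same letter, and
  nothing otherwise; since cylinders determine nodes, the quantified \<open>u\<close> and
  \<open>v\<close> are unique.\<close>

definition path_sim :: "(nat \<Rightarrow> nat) set \<Rightarrow> (nat \<Rightarrow> nat) set \<Rightarrow> ((nat \<Rightarrow> nat) \<Rightarrow> nat \<Rightarrow> nat) set" where
  "path_sim A B = {f. \<exists>u v. node x u \<and> node x v \<and> A = cyl u \<and> B = cyl v \<and> lbl x u = lbl x v \<and>
     f \<in> extensional A \<and> (\<forall>r. ends (lbl x u) r \<longrightarrow> f (app u r) = app v r)}"

lemma path_sim_iff: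
  "node x u \<Longrightarrow> node x v \<Longrightarrow> f \<in> path_sim (cyl u) (cyl v) \<longleftrightarrow>
     lbl x u = lbl x v \<and> f \<in> extensional (cyl u) \<and> (\<forall>r. ends (lbl x u) r \<longrightarrow> f (app u r) = app v r)"
  by (auto simp: path_sim_def cyl_inject)

lemma path_sim_unique:
  assumes "node x u" "node x v" "f \<in> path_sim (cyl u) (cyl v)" "g \<in> path_sim (cyl u) (cyl v)"
  shows "f = g"
proof (rule extensionalityI [of _ "cyl u"])
  fix p assume "p \<in> cyl u"
  then obtain r where "ends (lbl x u) r" "p = app u r" by (auto simp: cyl_def)
  then show "f p = g p" using assms by (simp add: path_sim_iff)
qed (use assms in \<open>simp_all add: path_sim_iff\<close>)

lemma path_sim_at_most_one: "finite (path_sim A B)" "card (path_sim A B) \<le> 1"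
proof -
  have "\<exists>f. path_sim A B \<subseteq> {f}"
  proof (cases "path_sim A B = {}")
    case False
    then obtain f where f: "f \<in> path_sim A B" by blast
    then obtain u v where "node x u" "node x v" "A = cyl u" "B = cyl v"
      unfolding path_sim_def by blast
    then show ?thesis using path_sim_unique f by blast
  qed auto
  then obtain f where f: "path_sim A B \<subseteq> {f}" by blast
  then show "finite (path_sim A B)" by (rule finite_subset) simp
  show "card (path_sim A B) \<le> 1" using card_mono [OF _ f] by simp
qed

lemma path_sim_image:
  assumes "node x u" "node x v" "f \<in> path_sim (cyl u) (cyl v)" "node (lbl x u) s"
  shows "f ` cyl (u @ s) = cyl (v @ s)" "restrict f (cyl (u @ s)) \<in> path_sim (cyl (u @ s)) (cyl (v @ s))"
proof -
  have f: "lbl x u = lbl x v" "\<And>r. ends (lbl x u) r \<Longrightarrow> f (app u r) = app v r"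
    using assms by (auto simp: path_sim_iff)
  have f_s: "f (app (u @ s) r) = app (v @ s) r" if "ends (lbl x (u @ s)) r" for r
    using that f(2) [of "app s r"] assms(4) by simp
  then show "f ` cyl (u @ s) = cyl (v @ s)"
    using f(1) unfolding cyl_def image_image by (intro image_cong) auto
  have nodes: "node x (u @ s)" "node x (v @ s)" using assms f(1) by auto
  show "restrict f (cyl (u @ s)) \<in> path_sim (cyl (u @ s)) (cyl (v @ s))"
    unfolding path_sim_iff [OF nodes] using f_s app_in_cyl [of "u @ s"] f(1) by simp
qed

lemma finite_sim_path_space: "finite_sim_structure (E x) path_dist path_sim"
  unfolding finite_sim_structure_def balls_path_space
proof (intro conjI ballI impI)
  fix A B C f g
  show "finite (path_sim A B)" by (rule path_sim_at_most_one)
  show "restrict id B \<in> path_sim B B" if "B \<in> cyl ` {u. node x u}"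
    using that by (auto simp: path_sim_iff app_in_cyl)
  assume A: "A \<in> cyl ` {u. node x u}" and B: "B \<in> cyl ` {u. node x u}" and f: "f \<in> path_sim A B"
  from A B obtain u v where uv: "node x u" "A = cyl u" "node x v" "B = cyl v" by auto
  then have fs: "lbl x u = lbl x v" "f \<in> extensional A" "\<And>r. ends (lbl x u) r \<Longrightarrow> f (app u r) = app v r"
    using f by (auto simp: path_sim_iff)
  have img: "f ` A = B" using path_sim_image(1) [of u v f "[]"] uv f by simp
  show "surj_similarity path_dist A B f"
    unfolding surj_similarity_def
  \<comment> \<open>A prefix of length \<open>n\<close> shrinks distances by the \<open>n\<close>-th
    power of 1/2; exchanging \<open>u\<close> for \<open>v\<close> therefore scales by the quotient
    of the two factors.\<close>
  proof (intro conjI exI [of _ "(1/2) ^ length v / (1/2) ^ length u"] ballI)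
    fix p q assume "p \<in> A" "q \<in> A"
    then obtain r s where "ends (lbl x u) r" "p = app u r" "ends (lbl x u) s" "q = app u s"
      by (auto simp: uv cyl_def)
    then show "path_dist (f p) (f q) = (1/2) ^ length v / (1/2) ^ length u * path_dist p q"
      by (simp add: fs path_dist_app)
  qed (use fs img in auto)
  have "inj_on f A"
    by (auto simp: inj_on_def uv cyl_def fs)
  then have "inv_into A f (app v r) = app u r" if "ends (lbl x u) r" for r
    using inv_into_f_f [of f A "app u r"] fs(3) [OF that] app_in_cyl [OF that] uv by simp
  then show "restrict (inv_into A f) B \<in> path_sim B A"
    using uv fs(1) app_in_cyl [of v] by (simp add: path_sim_iff)
  show "restrict (g \<circ> f) A \<in> path_sim A C" if "C \<in> cyl ` {u. node x u}" "g \<in> path_sim B C"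
  proof -
    obtain w where w: "node x w" "C = cyl w" using \<open>C \<in> _\<close> by auto
    then show ?thesis
      using \<open>g \<in> _\<close> uv fs app_in_cyl [of u] by (simp add: path_sim_iff)
  qed
  show "restrict f C \<in> path_sim C (f ` C)" if C: "C \<in> cyl ` {u. node x u}" "C \<subseteq> A"
  proof -
    obtain w where w: "node x w" "C = cyl w" using C by auto
    then obtain s where s: "w = u @ s" using cyl_subset [OF uv(1) w(1)] C uv by auto
    then show ?thesis using path_sim_image [of u v f s] uv f w by simp
  qed
qed

lemma small_sim_path_space: "small_sim_structure (E x) path_dist path_order path_sim"
  unfolding small_sim_structure_def
proof (intro conjI ballI impI)
  fix A B f p q
  show "card (path_sim A B) \<le> 1" by (rule path_sim_at_most_one)
  assume "A \<in> balls (E x) path_dist" "B \<in> balls (E x) path_dist" and f: "f \<in> path_sim A B"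
    and pq: "p \<in> A" "q \<in> A" "(p, q) \<in> path_order"
  then obtain u v where uv: "node x u" "A = cyl u" "node x v" "B = cyl v" by (auto simp: balls_path_space)
  from pq uv obtain r s where rs: "ends (lbl x u) r" "p = app u r" "ends (lbl x u) s" "q = app u s"
    by (auto simp: cyl_def)
  have "lbl x u = lbl x v" "f p = app v r" "f q = app v s" using f uv rs by (simp_all add: path_sim_iff)
  then show "(f p, f q) \<in> path_order"
    using pq(3) uv rs by (auto simp: path_order_def path_less_app)
qed (rule lin_ordered_path_space compact_path_space finite_sim_path_space)+

lemma path_space_coded: "coded_sim_space ch S R x (E x) path_dist path_sim (\<lambda>p. p)"
proof -
  have cyl: "cyl = (\<lambda>u. app u ` E (lbl x u))" by (simp add: fun_eq_iff cyl_def)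
  show ?thesis
    by unfold_locales
      (simp_all add: finite_sim_path_space bij_betw_def balls_path_space [unfolded cyl] path_sim_iff [unfolded cyl])
qed

end

section \<open>Linearly ordered compact ultrametric spaces\<close>

text \<open>\<open>r\<close> is only known to be transitive and total on \<open>A\<close>, as is the
  order of disjoint balls. A new element is inserted between the elements below it and the
  rest.\<close>

lemma sorted_wrt_list_exists:
  assumes "finite A"
    and trans: "\<And>a b c. a \<in> A \<Longrightarrow> b \<in> A \<Longrightarrow> c \<in> A \<Longrightarrow> r a b \<Longrightarrow> r b c \<Longrightarrow> r a c"
    and total: "\<And>a b. a \<in> A \<Longrightarrow> b \<in> A \<Longrightarrow> a \<noteq> b \<Longrightarrow> r a b \<or> r b a"
  shows "\<exists>xs. set xs = A \<and> sorted_wrt r xs"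
  using assms
proof (induction A rule: finite_induct)
  case (insert a A)
  have "\<exists>xs. set xs = A \<and> sorted_wrt r xs"
  proof (rule insert.IH)
    show "r a b \<Longrightarrow> r b c \<Longrightarrow> r a c" if "a \<in> A" "b \<in> A" "c \<in> A" for a b c
      using insert.prems(1) [of a b c] that by simp
    show "r a b \<or> r b a" if "a \<in> A" "b \<in> A" "a \<noteq> b" for a b
      using insert.prems(2) [of a b] that by simp
  qed
  then obtain xs where xs: "set xs = A" "sorted_wrt r xs" by blast
  let ?xs = "filter (\<lambda>y. r y a) xs @ a # filter (\<lambda>y. \<not> r y a) xs"
  have "set ?xs = insert a A" using xs by auto
  moreover have above: "r a y" if "y \<in> A" "\<not> r y a" for y
    using insert.prems(2) [of a y] insert.hyps(2) that by auto
  have "r y z" if "y \<in> A" "r y a" "z \<in> A" "\<not> r z a" for y z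
    using insert.prems(1) [of y a z] above [of z] that by simp
  then have "sorted_wrt r ?xs"
    using xs above insert.hyps(2) by (simp add: sorted_wrt_append sorted_wrt_filter)
  ultimately show ?case by blast
qed simp

text \<open>Two different heads would each precede the other, against transitivity and
  irreflexivity.\<close>

lemma sorted_wrt_list_unique:
  assumes "sorted_wrt r xs" "sorted_wrt r ys" "set xs = set ys"
    and trans: "\<And>a b c. a \<in> set xs \<Longrightarrow> b \<in> set xs \<Longrightarrow> c \<in> set xs \<Longrightarrow> r a b \<Longrightarrow> r b c \<Longrightarrow> r a c"
    and irrefl: "\<And>a. a \<in> set xs \<Longrightarrow> \<not> r a a"
  shows "xs = ys"
  using assms
proof (induction xs arbitrary: ys)
  case (Cons a xs)
  from Cons.prems(3) obtain b ys' where ys: "ys = b # ys'" by (cases ys) auto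
  have "a = b"
  proof (rule ccontr)
    assume "a \<noteq> b"
    then have "r a b" "r b a" using Cons.prems(1-3) ys by auto
    then show False using Cons.prems(4) [of a b a] Cons.prems(5) [of a] Cons.prems(3) ys by auto
  qed
  have "a \<notin> set xs" using Cons.prems(1) Cons.prems(5) [of a] by auto
  moreover have "b \<notin> set ys'" using Cons.prems(2) Cons.prems(5) [of b] \<open>a = b\<close> ys by auto
  ultimately
  have "set xs = set ys'" using Cons.prems(3) ys \<open>a = b\<close> by auto
  moreover have "sorted_wrt r xs" "sorted_wrt r ys'" using Cons.prems ys by auto
  ultimately have "xs = ys'"
    using Cons.prems(4,5) by (intro Cons.IH) (auto intro: Cons.prems(4))
  then show ?case using ys \<open>a = b\<close> by simp
qed auto

text \<open>Balls have centres, so the space must have a point to be a ball itself and to possess a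
  class.\<close>

locale small_sim_space = sim_space X d Sim for X :: "'p set" and d Sim +
  fixes L :: "('p \<times> 'p) set"
  assumes nonempty: "X \<noteq> {}" and small: "small_sim_structure X d L Sim"
begin

lemma compact: "compact_space mtopology"
  and lin_ordered: "lin_ordered_ultrametric X d L"
  using small by (simp_all add: small_sim_structure_def)

lemma Sim_mono: "A \<in> balls X d \<Longrightarrow> B \<in> balls X d \<Longrightarrow> f \<in> Sim A B \<Longrightarrow> y \<in> A \<Longrightarrow> z \<in> A \<Longrightarrow>
      (y, z) \<in> L \<Longrightarrow> (f y, f z) \<in> L"
  using small by (simp add: small_sim_structure_def)

subsection \<open>Balls in a compact ultrametric space\<close>

text \<open>A set closed under moves of size \<open>r\<close> is recovered from its trace on a
  finite \<open>r\<close>-net, and a finite net has finitely many subsets. All finiteness statements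
  on balls below are reduced to this.\<close>

lemma finite_neighbourhood_closed:
  assumes "r > 0"
  shows "finite {C. C \<subseteq> X \<and> (\<forall>c\<in>C. \<forall>y\<in>X. d c y \<le> r \<longrightarrow> y \<in> C)}" (is "finite ?\<C>")
proof -
  have "mtotally_bounded X" using compact compact_space_eq_mcomplete_mtotally_bounded by blast
  then have "\<exists>K. finite K \<and> K \<subseteq> X \<and> X \<subseteq> (\<Union>k\<in>K. mball k r)"
    using assms by (simp add: mtotally_bounded_def)
  then obtain K where K: "finite K" "K \<subseteq> X" "X \<subseteq> (\<Union>k\<in>K. mball k r)" by (elim exE conjE)
  have "C = {y \<in> X. \<exists>k\<in>C \<inter> K. d k y < r}" if C: "C \<in> ?\<C>" for C
  proof (intro equalityI subsetI)
    fix y assume y: "y \<in> C"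
    then have "y \<in> (\<Union>k\<in>K. mball k r)" using K(3) C by blast
    then obtain k where "k \<in> K" "d k y < r" by auto
    moreover from this have "k \<in> X" "d y k \<le> r" using K(2) commute [of k y] by auto
    then have "k \<in> C" using C y by blast
    ultimately show "y \<in> {y \<in> X. \<exists>k\<in>C \<inter> K. d k y < r}" using y C by auto
  next
    fix y assume "y \<in> {y \<in> X. \<exists>k\<in>C \<inter> K. d k y < r}"
    then obtain k where "y \<in> X" "k \<in> C" "d k y < r" by blast
    then show "y \<in> C" using C less_imp_le by blast
  qed
  then have recover: "C = (\<lambda>D. {y \<in> X. \<exists>k\<in>D. d k y < r}) (C \<inter> K)" if "C \<in> ?\<C>" for C
    using that by simp
  have "inj_on (\<lambda>C. C \<inter> K) ?\<C>"
    by (rule inj_on_inverseI [where g = "\<lambda>D. {y \<in> X. \<exists>k\<in>D. d k y < r}"]) (rule recover [symmetric])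
  moreover have "(\<lambda>C. C \<inter> K) ` ?\<C> \<subseteq> Pow K" by blast
  ultimately show ?thesis using K(1) by (meson finite_Pow_iff inj_on_finite)
qed

text \<open>Every ball containing \<open>A\<close> is closed under moves up to the radius of
  \<open>A\<close>.\<close>

lemma finite_superballs:
  assumes "A \<in> balls X d"
  shows "finite {C \<in> balls X d. A \<subseteq> C}"
proof -
  obtain a r where a: "a \<in> X" "r > 0" "A = mcball a r" using assms by (rule ballsE)
  have "z \<in> C" if C: "C \<in> balls X d" "A \<subseteq> C" and y: "y \<in> C" "z \<in> X" "d y z \<le> r" for C y z
  proof -
    have "y \<in> X" using C y ball_subset by blast
    then have "mcball y r \<in> balls X d" using a by (simp add: ballsI)
    from balls_nested_or_disjoint [OF C(1) this] consider "mcball y r \<subseteq> C" | "C \<subseteq> mcball y r"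
      using y \<open>y \<in> X\<close> a by auto
    then have "mcball y r \<subseteq> C"
    proof cases
      case 2
      \<comment> \<open>If the ball around \<open>y\<close> contains \<open>C\<close>, it contains
        the centre \<open>a\<close> and hence equals \<open>A\<close>, which lies in
        \<open>C\<close>.\<close>
      have "a \<in> C" using a C by auto
      then have "mcball y r = A" using 2 a mcball_recentre [of a y r] by blast
      then show ?thesis using C by simp
    qed
    then show ?thesis using y \<open>y \<in> X\<close> by auto
  qed
  then have "{C \<in> balls X d. A \<subseteq> C} \<subseteq> {C. C \<subseteq> X \<and> (\<forall>c\<in>C. \<forall>y\<in>X. d c y \<le> r \<longrightarrow> y \<in> C)}"
    using ball_subset by blast
  then show ?thesis by (rule finite_subset) (rule finite_neighbourhood_closed [OF a(2)])
qed

lemma space_ball: "X \<in> balls X d"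
proof -
  have "mtotally_bounded X" using compact compact_space_eq_mcomplete_mtotally_bounded by blast
  then have "mbounded X" by (rule mtotally_bounded_imp_mbounded)
  then obtain c b where cb: "X \<subseteq> mcball c b" unfolding mbounded_def by (elim exE)
  then have "c \<in> X" using nonempty by fastforce
  \<comment> \<open>The bound \<open>b\<close> need not be positive, but the radius of a ball must
    be.\<close>
  have "X = mcball c (max b 1)" using cb \<open>c \<in> X\<close> by fastforce
  then show ?thesis using ballsI [OF \<open>c \<in> X\<close>, of "max b 1"] by simp
qed

abbreviation "sub \<equiv> max_proper_subballs X d"

lemma sub_ball: "M \<in> sub B \<Longrightarrow> M \<in> balls X d" and sub_psubset: "M \<in> sub B \<Longrightarrow> M \<subset> B"
  by (simp_all add: max_proper_subballs_def)

lemma sub_disjoint: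
  assumes "M \<in> sub B" "N \<in> sub B" "M \<noteq> N"
  shows "M \<inter> N = {}"
proof (rule ccontr)
  assume "M \<inter> N \<noteq> {}"
  then have "M \<subset> N \<or> N \<subset> M"
    using balls_nested_or_disjoint [OF sub_ball [OF assms(1)] sub_ball [OF assms(2)]] assms(3) by blast
  then show False using assms(1,2) unfolding max_proper_subballs_def by blast
qed

lemma sub_above:
  assumes "A \<in> balls X d" "A \<subset> B"
  shows "\<exists>M\<in>sub B. A \<subseteq> M"
proof -
  let ?\<C> = "{C \<in> balls X d. A \<subseteq> C \<and> C \<subset> B}"
  have "finite ?\<C>" by (rule finite_subset [OF _ finite_superballs [OF assms(1)]]) blast
  moreover have "A \<in> ?\<C>" using assms by simp
  ultimately obtain M where M: "M \<in> ?\<C>" "\<And>C. C \<in> ?\<C> \<Longrightarrow> M \<subseteq> C \<Longrightarrow> M = C"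
    using finite_has_maximal [of ?\<C>] by (metis (no_types, lifting) empty_iff)
  then have "M \<in> sub B" unfolding max_proper_subballs_def by blast
  then show ?thesis using M by blast
qed

lemma sub_cover:
  assumes "B \<in> balls X d" "b \<in> B" "b' \<in> B" "b \<noteq> b'"
  shows "\<exists>M\<in>sub B. b \<in> M"
proof -
  have X: "b \<in> X" "b' \<in> X" using assms ball_subset by blast+
  \<comment> \<open>Half the distance excludes \<open>b'\<close> from the ball around
    \<open>b\<close>, so \<open>A\<close> is a proper sub-ball and lies in a maximal one.\<close>
  define A where "A = mcball b (d b b' / 2)"
  have pos: "d b b' > 0" using X assms(4) by simp
  then have A: "A \<in> balls X d" "b \<in> A" "b' \<notin> A" using X by (auto simp: A_def intro: ballsI)
  then have "A \<subset> B" using balls_nested_or_disjoint [OF A(1) assms(1)] assms(2,3) by blast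
  then show ?thesis using sub_above A by blast
qed

text \<open>With two points \<open>m\<close>, \<open>n\<close> in different maximal sub-balls, every
  maximal sub-ball is closed under moves up to half their distance: a move leaving \<open>C\<close>
  would span a ball strictly between \<open>C\<close> and \<open>B\<close>.\<close>

lemma finite_sub:
  assumes "B \<in> balls X d"
  shows "finite (sub B)"
proof (cases "\<exists>M N. M \<in> sub B \<and> N \<in> sub B \<and> M \<noteq> N")
  case True
  then obtain M N where MN: "M \<in> sub B" "N \<in> sub B" "M \<inter> N = {}" using sub_disjoint by metis
  then obtain m n where mn: "m \<in> M" "n \<in> N" using ball_nonempty sub_ball by (metis ex_in_conv)
  then have mn_B: "m \<in> B" "n \<in> B" "m \<in> X" "n \<in> X" "m \<noteq> n"
    using MN sub_psubset sub_ball ball_subset by blast+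
  define \<delta> where "\<delta> = d m n / 2"
  have \<delta>: "\<delta> > 0" using mn_B by (simp add: \<delta>_def)
  have "y \<in> C" if C: "C \<in> sub B" and c: "c \<in> C" "y \<in> X" "d c y \<le> \<delta>" for C c y
  proof (rule ccontr)
    assume "y \<notin> C"
    have cX: "c \<in> X" "c \<in> B" using C c sub_ball sub_psubset ball_subset by blast+
    obtain s where s: "C = mcball c s" using ball_centredE sub_ball [OF C] c(1) by metis
    define Q where "Q = mcball c (d c y)"
    have "s < d c y" using \<open>y \<notin> C\<close> s cX c by auto
    then have "C \<subseteq> Q" using s by (auto simp: Q_def)
    moreover have "y \<in> Q" using cX c by (simp add: Q_def)
    ultimately have CQ: "C \<subset> Q" using \<open>y \<notin> C\<close> by blast
    have "c \<noteq> y" using c(1) \<open>y \<notin> C\<close> by blast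
    then have Q: "Q \<in> balls X d" using cX c by (simp add: Q_def ballsI)
    \<comment> \<open>Otherwise \<open>m\<close> and \<open>n\<close> would both be within \<delta>
      of \<open>c\<close>, hence of each other, although their distance is twice \<delta>.\<close>
    have "\<not> B \<subseteq> Q"
    proof
      assume "B \<subseteq> Q"
      then have "d c m \<le> \<delta>" "d c n \<le> \<delta>" using mn_B c(3) by (auto simp: Q_def)
      then have "d m n \<le> \<delta>" using strong_triangle [of m c n] mn_B cX by (simp add: commute)
      then show False using \<delta> by (simp add: \<delta>_def)
    qed
    moreover have "c \<in> Q" using cX by (simp add: Q_def)
    ultimately have "Q \<subset> B" using balls_nested_or_disjoint [OF Q assms] cX by blast
    then show False using CQ C Q by (auto simp: max_proper_subballs_def)
  qed
  then have "sub B \<subseteq> {C. C \<subseteq> X \<and> (\<forall>c\<in>C. \<forall>y\<in>X. d c y \<le> \<delta> \<longrightarrow> y \<in> C)}"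
    using sub_ball ball_subset by blast
  then show ?thesis by (rule finite_subset) (rule finite_neighbourhood_closed [OF \<delta>])
next
  case False
  then have "\<exists>M. sub B \<subseteq> {M}" by blast
  then show ?thesis using finite_subset by blast
qed

subsection \<open>The ordered list of maximal proper sub-balls\<close>

lemma L_strict_trans: "strict_less L a b \<Longrightarrow> strict_less L b c \<Longrightarrow> strict_less L a c"
  using lin_ordered
  unfolding lin_ordered_ultrametric_def linear_order_on_def partial_order_on_def preorder_on_def
    antisym_def trans_def strict_less_def by metis

lemma L_total: "a \<in> X \<Longrightarrow> b \<in> X \<Longrightarrow> a \<noteq> b \<Longrightarrow> strict_less L a b \<or> strict_less L b a"
  using lin_ordered
  unfolding lin_ordered_ultrametric_def linear_order_on_def total_on_def strict_less_def by metis

lemma L_balls: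
  assumes "A \<in> balls X d" "B \<in> balls X d" "A \<inter> B = {}" "a \<in> A" "b \<in> B" "strict_less L a b"
  shows "ball_less L A B"
  using lin_ordered assms unfolding lin_ordered_ultrametric_def ball_less_def by blast

lemma ball_less_total:
  assumes "A \<in> balls X d" "B \<in> balls X d" "A \<inter> B = {}"
  shows "ball_less L A B \<or> ball_less L B A"
proof -
  obtain a b where ab: "a \<in> A" "b \<in> B" using assms ball_nonempty by blast
  then have "a \<in> X" "b \<in> X" "a \<noteq> b" using assms ball_subset by blast+
  then show ?thesis using L_total [of a b] L_balls [of A B a b] L_balls [of B A b a] assms ab
    by (metis Int_commute)
qed

lemma ball_less_trans: "B \<noteq> {} \<Longrightarrow> ball_less L A B \<Longrightarrow> ball_less L B C \<Longrightarrow> ball_less L A C"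
  unfolding ball_less_def using L_strict_trans by (metis ex_in_conv)

lemma ball_less_irrefl: "B \<noteq> {} \<Longrightarrow> \<not> ball_less L B B"
  by (auto simp: ball_less_def strict_less_def)

definition subs :: "'p set \<Rightarrow> 'p set list" where
  "subs B = (SOME bs. set bs = sub B \<and> sorted_wrt (ball_less L) bs)"

lemma subs:
  assumes "B \<in> balls X d"
  shows "set (subs B) = sub B" "sorted_wrt (ball_less L) (subs B)"
proof -
  have "\<exists>bs. set bs = sub B \<and> sorted_wrt (ball_less L) bs"
    using finite_sub [OF assms]
  proof (rule sorted_wrt_list_exists)
    show "ball_less L A C" if "A \<in> sub B" "M \<in> sub B" "C \<in> sub B" "ball_less L A M" "ball_less L M C" for A M C
      using ball_less_trans ball_nonempty sub_ball that by metis
    show "ball_less L M N \<or> ball_less L N M" if "M \<in> sub B" "N \<in> sub B" "M \<noteq> N" for M N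
      using ball_less_total sub_ball sub_disjoint that by metis
  qed
  then have "set (subs B) = sub B \<and> sorted_wrt (ball_less L) (subs B)"
    unfolding subs_def by (rule someI_ex)
  then show "set (subs B) = sub B" "sorted_wrt (ball_less L) (subs B)" by auto
qed

lemma subs_unique:
  assumes "B \<in> balls X d" "set bs = sub B" "sorted_wrt (ball_less L) bs"
  shows "bs = subs B"
proof (rule sorted_wrt_list_unique [where r = "ball_less L"])
  show "ball_less L A C" if "A \<in> set bs" "M \<in> set bs" "C \<in> set bs" "ball_less L A M" "ball_less L M C" for A M C
    using ball_less_trans ball_nonempty sub_ball that assms(2) by metis
  show "\<not> ball_less L M M" if "M \<in> set bs" for M
    using ball_less_irrefl ball_nonempty sub_ball that assms(2) by metis
qed (use assms subs in auto)

lemma distinct_subs: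
  assumes "B \<in> balls X d" shows "distinct (subs B)"
proof -
  have "distinct bs" if "sorted_wrt (ball_less L) bs" "set bs \<subseteq> balls X d" for bs
    using that by (induction bs) (use ball_less_irrefl ball_nonempty in auto)
  then show ?thesis using subs [OF assms] sub_ball by blast
qed

lemma subs_nth:
  assumes "B \<in> balls X d" "i < length (subs B)"
  shows "subs B ! i \<in> sub B" "subs B ! i \<in> balls X d" "subs B ! i \<subset> B"
  using nth_mem [OF assms(2)] subs(1) [OF assms(1)] sub_ball sub_psubset by auto

lemma subs_index:
  assumes "B \<in> balls X d" "i < length (subs B)" "j < length (subs B)" "y \<in> subs B ! i" "y \<in> subs B ! j"
  shows "i = j"
proof -
  have "subs B ! i = subs B ! j"
    using sub_disjoint [OF subs_nth(1) [OF assms(1,2)] subs_nth(1) [OF assms(1,3)]] assms(4,5) by blast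
  then show ?thesis using distinct_subs [OF assms(1)] assms(2,3) by (simp add: nth_eq_iff_index_eq)
qed

lemma subs_singleton: "B \<in> balls X d \<Longrightarrow> subs B = [] \<longleftrightarrow> (\<exists>b. B = {b})"
proof
  assume B: "B \<in> balls X d" and "subs B = []"
  then have "sub B = {}" using subs(1) [OF B] by simp
  moreover obtain b where "b \<in> B" using ball_nonempty [OF B] by blast
  ultimately show "\<exists>b. B = {b}" using sub_cover [OF B] by blast
next
  assume B: "B \<in> balls X d" and "\<exists>b. B = {b}"
  then have "sub B = {}" using sub_psubset sub_ball ball_nonempty by blast
  then show "subs B = []" using subs(1) [OF B] by simp
qed

lemma subs_cover: "B \<in> balls X d \<Longrightarrow> subs B \<noteq> [] \<Longrightarrow> y \<in> B \<Longrightarrow> \<exists>i<length (subs B). y \<in> subs B ! i"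
proof -
  assume B: "B \<in> balls X d" "subs B \<noteq> []" "y \<in> B"
  then obtain y' where "y' \<in> B" "y \<noteq> y'" using subs_singleton [OF B(1)] by blast
  then obtain M where "M \<in> sub B" "y \<in> M" using sub_cover B by blast
  then show ?thesis using subs(1) [OF B(1)] by (metis in_set_conv_nth)
qed

text \<open>Maximal proper sub-balls cover a ball with more than one point, and a single proper one
  cannot. This excludes letters with exactly one child.\<close>

lemma length_subs:
  assumes "B \<in> balls X d" shows "length (subs B) \<noteq> 1"
proof
  assume len: "length (subs B) = 1"
  then have "subs B ! 0 \<subset> B" using subs_nth [OF assms] by simp
  then obtain y where "y \<in> B" "y \<notin> subs B ! 0" by blast
  moreover have "subs B \<noteq> []" using len by auto
  ultimately show False using subs_cover [OF assms] len by fastforce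
qed

subsection \<open>Similarities and ball classes\<close>

lemma Sim_bij:
  assumes "A \<in> balls X d" "B \<in> balls X d" "f \<in> Sim A B"
  shows "bij_betw f A B"
proof -
  have img: "f ` A = B" using sim_similarity [OF assms] by (simp add: surj_similarity_def)
  obtain c where c: "c > 0" "\<forall>y\<in>A. \<forall>z\<in>A. d (f y) (f z) = c * d y z"
    using assms by (rule sim_scaleE)
  have "inj_on f A"
  proof (rule inj_onI)
    fix y z assume yz: "y \<in> A" "z \<in> A" "f y = f z"
    have X: "y \<in> X" "z \<in> X" using ball_subset [OF assms(1)] yz by auto
    have "f y \<in> X" using ball_subset [OF assms(2)] img yz by auto
    then have "d (f y) (f z) = 0" using yz(3) by simp
    moreover have "d (f y) (f z) = c * d y z" using c(2) yz by blast
    ultimately show "y = z" using c(1) X by simp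
  qed
  then show ?thesis using img by (simp add: bij_betw_def)
qed

text \<open>The image is the part in \<open>B\<close> of the ball with scaled radius. Two balls that
  meet are nested, so this part is one of the two.\<close>

lemma Sim_image_ball:
  assumes "A \<in> balls X d" "B \<in> balls X d" "f \<in> Sim A B" "C \<in> balls X d" "C \<subseteq> A"
  shows "f ` C \<in> balls X d"
proof -
  have bij: "bij_betw f A B" using assms(1-3) by (rule Sim_bij)
  obtain c where c: "c > 0" "\<forall>y\<in>A. \<forall>z\<in>A. d (f y) (f z) = c * d y z"
    using assms(1-3) by (rule sim_scaleE)
  obtain y r where y: "y \<in> X" "r > 0" "C = mcball y r" using assms(4) by (rule ballsE)
  have yA: "y \<in> A" using y assms(5) by auto
  then have fy: "f y \<in> B" "f y \<in> X" using bij ball_subset [OF assms(2)] by (auto dest: bij_betwE)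
  define Q where "Q = mcball (f y) (c * r)"
  have Q: "Q \<in> balls X d" using fy c y by (simp add: Q_def ballsI)
  have "f ` C = Q \<inter> B"
  proof (intro equalityI subsetI)
    fix w assume "w \<in> f ` C"
    then obtain z where z: "z \<in> C" "w = f z" by blast
    then have "z \<in> A" "w \<in> B" using assms(5) bij by (auto dest: bij_betwE)
    moreover have "d (f y) w \<le> c * r" using c yA \<open>z \<in> A\<close> z y by simp
    ultimately show "w \<in> Q \<inter> B" using fy ball_subset [OF assms(2)] by (auto simp: Q_def)
  next
    fix w assume w: "w \<in> Q \<inter> B"
    then obtain z where z: "z \<in> A" "w = f z" using bij by (auto simp: bij_betw_def)
    then have "c * d y z \<le> c * r" using w c yA by (auto simp: Q_def)
    then have "d y z \<le> r" using c(1) by simp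
    then show "w \<in> f ` C" using z y ball_subset [OF assms(1)] by auto
  qed
  moreover have "f y \<in> Q" using fy c y by (simp add: Q_def)
  ultimately show ?thesis
    using balls_nested_or_disjoint [OF Q assms(2)] fy Q assms(2) by (metis IntI Int_absorb1 Int_absorb2 empty_iff)
qed

text \<open>A similarity and its inverse carry sub-balls to sub-balls, so maximal ones correspond.
  As the order is preserved too, the two lists match entry by entry, which makes the children of a
  ball class well defined.\<close>

lemma Sim_subs:
  assumes "A \<in> balls X d" "B \<in> balls X d" "f \<in> Sim A B"
  shows "subs B = map ((`) f) (subs A)"
proof -
  have step: "f ` M \<in> sub B" if AB: "A \<in> balls X d" "B \<in> balls X d" "f \<in> Sim A B" and M: "M \<in> sub A" for A B f M
  proof -
    have bij: "bij_betw f A B" using AB by (rule Sim_bij)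
    let ?g = "restrict (inv_into A f) B"
    have g: "?g \<in> Sim B A" using AB by (rule sim_inverse)
    have MA: "M \<subset> A" "M \<in> balls X d" using M sub_psubset sub_ball by auto
    have fM: "f ` M \<in> balls X d" using Sim_image_ball [OF AB] MA by blast
    have inj: "inj_on f A" using bij by (simp add: bij_betw_def)
    have "f ` M \<subset> B" using MA(1) bij inj inj_on_image_eq_iff [OF inj, of M A] by (auto simp: bij_betw_def)
    moreover have False if C: "C \<in> balls X d" "f ` M \<subset> C" "C \<subset> B" for C
    proof -
      define C' where "C' = ?g ` C"
      have "C' \<in> balls X d" unfolding C'_def using Sim_image_ball [OF AB(2,1) g C(1)] C by blast
      moreover have C': "f ` C' = C" "C' \<subseteq> A"
      proof -
        have k: "f (?g y) = y" "?g y \<in> A" if "y \<in> C" for y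
          using that C(3) bij bij_betwE [OF bij_betw_inv_into [OF bij]] by (auto simp: bij_betw_inv_into_right)
        have "(\<lambda>y. f (?g y)) ` C = (\<lambda>y. y) ` C" by (rule image_cong) (simp_all only: k)
        then show "f ` C' = C" unfolding C'_def image_image by simp
        show "C' \<subseteq> A" unfolding C'_def using k(2) by (rule image_subsetI)
      qed
      moreover have "M \<subset> C'"
        using C C' MA inj_on_image_subset_iff [OF inj, of M C'] by auto
      moreover have "C' \<subset> A" using C C' bij by (auto simp: bij_betw_def)
      ultimately show False using M by (auto simp: max_proper_subballs_def)
    qed
    ultimately show ?thesis using fM by (auto simp: max_proper_subballs_def)
  qed
  have bij: "bij_betw f A B" using assms by (rule Sim_bij)
  have "sub B \<subseteq> (`) f ` sub A"
  proof
    fix N assume N: "N \<in> sub B"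
    let ?g = "restrict (inv_into A f) B"
    have "?g ` N \<in> sub A" using step [OF assms(2,1) sim_inverse [OF assms] N] .
    moreover have "f ` ?g ` N = N"
    proof -
      have "f (?g y) = y" if "y \<in> N" for y
        using that sub_psubset [OF N] bij by (auto simp: bij_betw_inv_into_right)
      then show ?thesis by (force simp: image_image simp del: restrict_apply)
    qed
    ultimately show "N \<in> (`) f ` sub A" by (metis imageI)
  qed
  then have "set (map ((`) f) (subs A)) = sub B"
    using step [OF assms] subs(1) [OF assms(1)] by auto
  moreover have "sorted_wrt (ball_less L) (map ((`) f) (subs A))"
    unfolding sorted_wrt_map
  proof (rule sorted_wrt_mono_rel [OF _ subs(2) [OF assms(1)]])
    fix M N assume MN: "M \<in> set (subs A)" "N \<in> set (subs A)" "ball_less L M N"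
    then have MN_A: "M \<subseteq> A" "N \<subseteq> A" using subs(1) [OF assms(1)] sub_psubset by blast+
    have "strict_less L (f y) (f z)" if "y \<in> M" "z \<in> N" for y z
    proof -
      have yz: "y \<in> A" "z \<in> A" "(y, z) \<in> L" "y \<noteq> z"
        using that MN(3) MN_A by (auto simp: ball_less_def strict_less_def)
      then have "f y \<noteq> f z" using bij by (auto simp: bij_betw_def inj_on_def)
      then show ?thesis using Sim_mono [OF assms yz(1-3)] by (simp add: strict_less_def)
    qed
    then show "ball_less L (f ` M) (f ` N)" by (simp add: ball_less_def)
  qed
  ultimately show ?thesis using subs_unique [OF assms(2)] by metis
qed

abbreviation "cls \<equiv> ball_class X d Sim"

lemma cls_eq_iff:
  assumes "A \<in> balls X d" "B \<in> balls X d"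
  shows "cls A = cls B \<longleftrightarrow> Sim A B \<noteq> {}"
proof -
  have "equiv (balls X d) (sim_rel X d Sim)"
  proof (rule equivI)
    show "sim_rel X d Sim \<subseteq> balls X d \<times> balls X d" by (auto simp: sim_rel_def)
    show "refl_on (balls X d) (sim_rel X d Sim)"
      using sim_id by (auto simp: refl_on_def sim_rel_def)
    show "sym (sim_rel X d Sim)"
      using sim_inverse by (fastforce simp: sym_def sim_rel_def)
    show "trans (sim_rel X d Sim)"
      using sim_compose by (fastforce simp: trans_def sim_rel_def)
  qed
  from eq_equiv_class_iff [OF this assms] show ?thesis
    using assms by (simp add: ball_class_def sim_rel_def)
qed

lemma Sim_cls_subs:
  assumes "A \<in> balls X d" "B \<in> balls X d" "f \<in> Sim A B"
  shows "map cls (subs B) = map cls (subs A)"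
proof -
  have "cls (f ` M) = cls M" if M: "M \<in> set (subs A)" for M
  proof -
    have M': "M \<in> balls X d" "M \<subseteq> A" using M subs(1) [OF assms(1)] sub_ball sub_psubset by blast+
    have "restrict f M \<in> Sim M (f ` M)" using sim_restrict [OF assms M'] .
    then have "cls M = cls (f ` M)" using cls_eq_iff M' Sim_image_ball [OF assms M'] by blast
    then show ?thesis ..
  qed
  then show ?thesis using Sim_subs [OF assms] by simp
qed

text \<open>A representative ball is chosen; \<open>ch_cls\<close> shows that the choice does not
  matter. Sets that are not ball classes become leaves.\<close>

definition ch :: "'p set set \<Rightarrow> 'p set set list" where
  "ch a = (if a \<in> sim_alphabet X d Sim then map cls (subs (SOME B. B \<in> balls X d \<and> cls B = a)) else [])"

lemma ch_cls:
  assumes "B \<in> balls X d" shows "ch (cls B) = map cls (subs B)"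
proof -
  define A where "A = (SOME A. A \<in> balls X d \<and> cls A = cls B)"
  have A: "A \<in> balls X d \<and> cls A = cls B" unfolding A_def by (rule someI [of _ B]) (simp add: assms)
  then obtain f where "f \<in> Sim A B" using cls_eq_iff assms by blast
  then have "map cls (subs A) = map cls (subs B)" using Sim_cls_subs A assms by metis
  then show ?thesis using assms by (simp add: ch_def A_def [symmetric] sim_alphabet_def)
qed

lemma presentation: "rooted_presentation ch (sim_alphabet X d Sim) (sim_relations X d L Sim) (cls X)"
proof
  fix a :: "'p set set" and u v
  show "length (ch a) \<noteq> 1"
  proof (cases "a \<in> sim_alphabet X d Sim")
    case True
    then show ?thesis using length_subs by (auto simp: sim_alphabet_def ch_cls)
  qed (simp add: ch_def)
  have in_alphabet: "\<exists>B\<in>balls X d. a = cls B" if "ch a \<noteq> []" for a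
    using that by (auto simp: ch_def sim_alphabet_def split: if_splits)
  show "(u, v) \<in> sim_relations X d L Sim \<longleftrightarrow> (\<exists>a. u = [a] \<and> v = ch a \<and> ch a \<noteq> [])"
  proof
    assume "(u, v) \<in> sim_relations X d L Sim"
    then obtain B bs where B: "u = [cls B]" "v = map cls bs" "B \<in> balls X d" "bs \<noteq> []"
      "set bs = sub B" "sorted_wrt (ball_less L) bs" by (auto simp: sim_relations_def)
    then have "bs = subs B" using subs_unique by blast
    with B show "\<exists>a. u = [a] \<and> v = ch a \<and> ch a \<noteq> []" by (simp add: ch_cls)
  next
    assume "\<exists>a. u = [a] \<and> v = ch a \<and> ch a \<noteq> []"
    then obtain B where "B \<in> balls X d" "u = [cls B]" "v = ch (cls B)" "ch (cls B) \<noteq> []"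
      using in_alphabet by blast
    then show "(u, v) \<in> sim_relations X d L Sim"
      using subs [of B] by (auto simp: sim_relations_def ch_cls)
  qed
  show "set (ch a) \<subseteq> sim_alphabet X d Sim" if "a \<in> sim_alphabet X d Sim"
    using that subs(1) sub_ball by (auto simp: sim_alphabet_def ch_cls)
  show "cls X \<in> sim_alphabet X d Sim" using space_ball by (auto simp: sim_alphabet_def)
qed

end

section \<open>Coding points by paths\<close>

context small_sim_space
begin

interpretation rooted_presentation ch "sim_alphabet X d Sim" "sim_relations X d L Sim" "cls X"
  by (rule presentation)

text \<open>The balls met when a path is followed into maximal sub-balls. At a point the sequence
  becomes constant, in accordance with the padding by zeros.\<close>

primrec descent :: "'p set \<Rightarrow> (nat \<Rightarrow> nat) \<Rightarrow> nat \<Rightarrow> 'p set" where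
  "descent B p 0 = B"
| "descent B p (Suc n) = (if subs (descent B p n) = [] then descent B p n else subs (descent B p n) ! p n)"

lemma length_ch_cls: "B \<in> balls X d \<Longrightarrow> length (ch (cls B)) = length (subs B)"
  by (simp add: ch_cls)

lemma ch_cls_Nil: "B \<in> balls X d \<Longrightarrow> ch (cls B) = [] \<longleftrightarrow> subs B = []"
  by (simp add: ch_cls)

lemma ch_cls_nth: "B \<in> balls X d \<Longrightarrow> i < length (subs B) \<Longrightarrow> ch (cls B) ! i = cls (subs B ! i)"
  by (simp add: ch_cls)

lemma descent_leaf: "subs B = [] \<Longrightarrow> descent B p n = B"
  by (induction n) auto

lemma descent_scons: "subs B \<noteq> [] \<Longrightarrow> descent B (scons i p) (Suc n) = descent (subs B ! i) p n"
  by (induction n) auto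

lemma ends_cls_cases:
  assumes "ends (cls B) p" "B \<in> balls X d"
  obtains (leaf) "subs B = []" "p = (\<lambda>_. 0)"
  | (branch) i q where "subs B \<noteq> []" "i < length (subs B)" "p = scons i q" "ends (cls (subs B ! i)) q"
proof (cases "subs B = []")
  case True
  then show ?thesis using assms leaf ch_cls_Nil ends_leaf_iff by blast
next
  case False
  then have "ch (cls B) \<noteq> []" using ch_cls_Nil assms(2) by blast
  from ends_branchE [OF assms(1) this] obtain i q where
    "i < length (ch (cls B))" "p = scons i q" "ends (ch (cls B) ! i) q" .
  then show ?thesis using branch False assms(2) by (simp add: length_ch_cls ch_cls_nth)
qed

lemma descent_ball:
  assumes "ends (cls B) p" "B \<in> balls X d"
  shows "descent B p n \<in> balls X d"
  using assms
proof (induction n arbitrary: B p)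
  case (Suc n)
  from Suc.prems show ?case
  proof (cases rule: ends_cls_cases)
    case leaf
    then show ?thesis using Suc.prems by (simp add: descent_leaf)
  next
    case (branch i q)
    then show ?thesis using Suc.IH [of "subs B ! i" q] subs_nth Suc.prems by (simp add: descent_scons del: descent.simps)
  qed
qed simp

lemma descent_index:
  assumes "ends (cls B) p" "B \<in> balls X d" "subs (descent B p n) \<noteq> []"
  shows "p n < length (subs (descent B p n))"
  using assms
proof (induction n arbitrary: B p)
  case 0
  then show ?case by (cases rule: ends_cls_cases) auto
next
  case (Suc n)
  from Suc.prems(1,2) show ?case
  proof (cases rule: ends_cls_cases)
    case leaf
    then show ?thesis using Suc.prems by (simp add: descent_leaf del: descent.simps)
  next
    case (branch i q)
    then show ?thesis
      using Suc.IH [of "subs B ! i" q] subs_nth Suc.prems by (simp add: descent_scons del: descent.simps)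
  qed
qed

lemma descent_step:
  assumes "ends (cls B) p" "B \<in> balls X d" "subs (descent B p n) \<noteq> []"
  shows "descent B p (Suc n) \<in> sub (descent B p n)" "descent B p (Suc n) \<subset> descent B p n"
  using subs_nth(1,3) [OF descent_ball [OF assms(1,2)] descent_index [OF assms]] assms(3) by auto

lemma descent_Suc_subset:
  assumes "ends (cls B) p" "B \<in> balls X d"
  shows "descent B p (Suc n) \<subseteq> descent B p n"
  using descent_step [OF assms, of n] by (cases "subs (descent B p n) = []") auto

lemma descent_antimono:
  assumes "ends (cls B) p" "B \<in> balls X d" "m \<le> n"
  shows "descent B p n \<subseteq> descent B p m"
  using descent_Suc_subset [OF assms(1,2)] assms(3) lift_Suc_antimono_le [of "descent B p"] by blast

text \<open>A descent that branches forever is strictly decreasing, so it would put infinitely many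
  balls above \<open>A\<close>.\<close>

lemma descent_no_lower_bound:
  assumes "ends (cls B) p" "B \<in> balls X d" "A \<in> balls X d"
    and below: "\<And>n. A \<subseteq> descent B p n" and branching: "\<And>n. subs (descent B p n) \<noteq> []"
  shows False
proof -
  have psub: "descent B p n \<subset> descent B p m" if "m < n" for m n
    using descent_antimono [OF assms(1,2), of "Suc m" n] descent_step(2) [OF assms(1,2) branching, of m] that
    by (metis Suc_leI subset_psubset_trans)
  have "inj (descent B p)"
    by (rule injI) (metis psub nat_neq_iff psubset_eq)
  then have "infinite (range (descent B p))" by (rule range_inj_infinite)
  moreover have "range (descent B p) \<subseteq> {C \<in> balls X d. A \<subseteq> C}"
    using below descent_ball [OF assms(1,2)] by blast
  ultimately show False using finite_superballs [OF assms(3)] finite_subset by blast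
qed

definition reaches :: "'p set \<Rightarrow> (nat \<Rightarrow> nat) \<Rightarrow> 'p \<Rightarrow> bool" where
  "reaches B p y \<longleftrightarrow> (\<forall>n. y \<in> descent B p n)"

lemma reaches_in: "reaches B p y \<Longrightarrow> y \<in> B"
  unfolding reaches_def using descent.simps(1) by metis

lemma reaches_scons:
  assumes "B \<in> balls X d" "i < length (subs B)"
  shows "reaches B (scons i p) y \<longleftrightarrow> reaches (subs B ! i) p y"
proof -
  have ne: "subs B \<noteq> []" using assms(2) by auto
  show ?thesis
  proof
    assume "reaches B (scons i p) y"
    then show "reaches (subs B ! i) p y" unfolding reaches_def using descent_scons [OF ne] by metis
  next
    assume a: "reaches (subs B ! i) p y"
    have "y \<in> descent B (scons i p) n" for n
    proof (cases n)
      case 0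
      then show ?thesis using reaches_in [OF a] subs_nth(3) [OF assms] by auto
    next
      case (Suc m)
      then show ?thesis using a descent_scons [OF ne] by (simp add: reaches_def del: descent.simps)
    qed
    then show "reaches B (scons i p) y" by (simp add: reaches_def)
  qed
qed

text \<open>Cantor's intersection theorem: the descent is a decreasing sequence of nonempty closed
  sets in a compact space.\<close>

lemma reaches_exists:
  assumes "ends (cls B) p" "B \<in> balls X d"
  shows "\<exists>y. reaches B p y"
proof -
  have "closedin mtopology (descent B p n)" for n
    using descent_ball [OF assms, of n] by (auto elim: ballsE)
  moreover have "descent B p n \<noteq> {}" for n
    using ball_nonempty descent_ball [OF assms, of n] by blast
  moreover have "decseq (descent B p)"
    unfolding decseq_def using descent_antimono [OF assms] by blast
  ultimately have "(\<Inter>n. descent B p n) \<noteq> {}" by (rule compact_space_imp_nest [OF compact])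
  then show ?thesis by (auto simp: reaches_def)
qed

text \<open>If two points survived, each ball of the descent could be centred at \<open>y\<close>
  and would contain the ball around \<open>y\<close> that reaches up to \<open>z\<close>, a lower
  bound that cannot exist.\<close>

lemma reaches_unique:
  assumes "ends (cls B) p" "B \<in> balls X d" "reaches B p y" "reaches B p z"
  shows "y = z"
proof (rule ccontr)
  assume "y \<noteq> z"
  have yz: "y \<in> X" "z \<in> X" using reaches_in assms(2-4) ball_subset by blast+
  then have pos: "d y z > 0" using \<open>y \<noteq> z\<close> by simp
  show False
  proof (rule descent_no_lower_bound [OF assms(1,2)])
    show "mcball y (d y z) \<in> balls X d" using yz pos by (simp add: ballsI)
    fix n
    have n: "y \<in> descent B p n" "z \<in> descent B p n" using assms(3,4) by (simp_all add: reaches_def)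
    obtain r where r: "r > 0" "descent B p n = mcball y r"
      using descent_ball [OF assms(1,2)] n(1) by (rule ball_centredE)
    then have "d y z \<le> r" using n(2) by auto
    then have "mcball y (d y z) \<subseteq> mcball y r" by (rule mcball_subset_concentric)
    then show "mcball y (d y z) \<subseteq> descent B p n" by (simp only: r(2))
    show "subs (descent B p n) \<noteq> []"
      using n \<open>y \<noteq> z\<close> subs_singleton [OF descent_ball [OF assms(1,2)], of n] by auto
  qed
qed

definition branch_index :: "'p \<Rightarrow> 'p set \<Rightarrow> nat" where
  "branch_index y B = (SOME i. i < length (subs B) \<and> y \<in> subs B ! i)"

text \<open>The recursion is on the depth, with the ball changing along the way; the zeros at a
  point agree with the padding of paths.\<close>

primrec code :: "'p \<Rightarrow> nat \<Rightarrow> 'p set \<Rightarrow> nat" where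
  "code y 0 B = (if subs B = [] then 0 else branch_index y B)"
| "code y (Suc n) B = (if subs B = [] then 0 else code y n (subs B ! branch_index y B))"

lemma branch_index:
  assumes "B \<in> balls X d" "subs B \<noteq> []" "y \<in> B"
  shows "branch_index y B < length (subs B)" "y \<in> subs B ! branch_index y B"
  using someI_ex [OF subs_cover [OF assms]] unfolding branch_index_def by auto

lemma code_leaf: "subs B = [] \<Longrightarrow> (\<lambda>n. code y n B) = (\<lambda>_. 0)"
proof
  fix n assume "subs B = []" then show "code y n B = 0" by (cases n) auto
qed

lemma code_branch:
  assumes "subs B \<noteq> []"
  shows "(\<lambda>n. code y n B) = scons (branch_index y B) (\<lambda>n. code y n (subs B ! branch_index y B))"
proof
  fix n show "code y n B = scons (branch_index y B) (\<lambda>n. code y n (subs B ! branch_index y B)) n"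
    using assms by (cases n) auto
qed

lemma ends_code:
  assumes "B \<in> balls X d" "y \<in> B"
  shows "ends (cls B) (\<lambda>n. code y n B)"
proof -
  have "ends a p" if "\<exists>B. a = cls B \<and> B \<in> balls X d \<and> y \<in> B \<and> p = (\<lambda>n. code y n B)" for a p
    using that
  proof (coinduction arbitrary: a p)
    case ends
    then obtain B where B: "a = cls B" "B \<in> balls X d" "y \<in> B" "p = (\<lambda>n. code y n B)" by blast
    show ?case
    proof (cases "subs B = []")
      case True
      then show ?thesis using B code_leaf ch_cls_Nil by auto
    next
      case False
      let ?i = "branch_index y B"
      let ?M = "subs B ! ?i"
      have i: "?i < length (subs B)" "y \<in> ?M" using branch_index [OF B(2) False B(3)] by auto
      have "?i < length (ch a)" "ch a ! ?i = cls ?M"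
        using i B by (simp_all add: length_ch_cls ch_cls_nth)
      moreover have "p = scons ?i (\<lambda>n. code y n ?M)" unfolding B(4) using False by (rule code_branch)
      moreover have "?M \<in> balls X d" using subs_nth B(2) i(1) by blast
      ultimately show ?thesis using i(2) by blast
    qed
  qed
  then show ?thesis using assms by blast
qed

lemma reaches_code:
  assumes "B \<in> balls X d" "y \<in> B"
  shows "reaches B (\<lambda>n. code y n B) y"
proof -
  have "y \<in> descent B (\<lambda>n. code y n B) n" for n
    using assms
  proof (induction n arbitrary: B)
    case (Suc n)
    show ?case
    proof (cases "subs B = []")
      case True
      then show ?thesis using Suc.prems by (simp add: descent_leaf del: descent.simps)
    next
      case False
      note i = branch_index [OF Suc.prems(1) False Suc.prems(2)]
      show ?thesis
        unfolding code_branch [OF False] descent_scons [OF False]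
        using Suc.IH [OF subs_nth(2) [OF Suc.prems(1) i(1)] i(2)] .
    qed
  qed simp
  then show ?thesis by (simp add: reaches_def)
qed

text \<open>Maximal sub-balls of a ball are disjoint, so at every depth the point determines the
  next step.\<close>

lemma reaches_path_unique:
  assumes "B \<in> balls X d" "ends (cls B) p" "ends (cls B) q" "reaches B p y" "reaches B q y"
  shows "p = q"
proof -
  have "p n = q n" for n
    using assms
  proof (induction n arbitrary: B p q)
    case (0 B p q)
    from 0(2,1) show ?case
    proof (cases rule: ends_cls_cases)
      case leaf
      with 0(3,1) show ?thesis by (cases rule: ends_cls_cases) auto
    next
      case (branch i p')
      note p = branch
      from 0(3,1) show ?thesis
      proof (cases rule: ends_cls_cases)
        case (branch j q')
        have "i = j"
          using subs_index [OF 0(1) p(2) branch(2), of y] 0(4,5) reaches_in p branch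
          by (metis 0(1) reaches_scons)
        then show ?thesis using p branch by simp
      qed (use p in simp)
    qed
  next
    case (Suc n)
    from Suc.prems(2,1) show ?case
    proof (cases rule: ends_cls_cases)
      case leaf
      with Suc.prems(3,1) show ?thesis by (cases rule: ends_cls_cases) auto
    next
      case (branch i p')
      note p = branch
      from Suc.prems(3,1) show ?thesis
      proof (cases rule: ends_cls_cases)
        case (branch j q')
        have at': "reaches (subs B ! i) p' y" "reaches (subs B ! j) q' y"
          using Suc.prems(4,5) p branch reaches_scons [OF Suc.prems(1)] by auto
        then have "i = j" using subs_index [OF Suc.prems(1) p(2) branch(2)] reaches_in by blast
        then have "p' n = q' n"
          using Suc.IH [of "subs B ! i" p' q'] subs_nth(2) [OF Suc.prems(1) p(2)] p branch at' by simp
        then show ?thesis using p branch by simp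
      qed (use p in simp)
    qed
  qed
  then show ?thesis by (rule ext)
qed

lemma node_cls_Cons:
  "B \<in> balls X d \<Longrightarrow> node (cls B) (i # u) \<longleftrightarrow> i < length (subs B) \<and> node (cls (subs B ! i)) u"
  by (auto simp: length_ch_cls ch_cls_nth)

primrec node_ball :: "'p set \<Rightarrow> nat list \<Rightarrow> 'p set" where
  "node_ball B [] = B"
| "node_ball B (i # u) = node_ball (subs B ! i) u"

lemma node_ball:
  assumes "B \<in> balls X d" "node (cls B) u"
  shows "node_ball B u \<in> balls X d" "lbl (cls B) u = cls (node_ball B u)" "node_ball B u \<subseteq> B"
  using assms
proof (induction u arbitrary: B)
  case (Cons i u)
  {
    case 1
    then have "i < length (subs B)" "node (cls (subs B ! i)) u" by (simp_all only: node_cls_Cons)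
    then show ?case using Cons.IH(1) subs_nth(2) [OF 1(1)] by simp
  next
    case 2
    then have "i < length (subs B)" "node (cls (subs B ! i)) u" by (simp_all only: node_cls_Cons)
    then show ?case using Cons.IH(2) subs_nth(2) [OF 2(1)] 2(1) by (simp add: ch_cls_nth)
  next
    case 3
    then have "i < length (subs B)" "node (cls (subs B ! i)) u" by (simp_all only: node_cls_Cons)
    then show ?case using Cons.IH(3) [of "subs B ! i"] subs_nth(2,3) [OF 3(1)] by fastforce
  }
qed simp_all

lemma reaches_app:
  assumes "B \<in> balls X d" "node (cls B) u"
  shows "reaches B (app u p) y \<longleftrightarrow> reaches (node_ball B u) p y"
  using assms
proof (induction u arbitrary: B)
  case (Cons i u)
  then have i: "i < length (subs B)" "node (cls (subs B ! i)) u" by (simp_all only: node_cls_Cons)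
  then show ?case using Cons.IH [OF subs_nth(2) [OF Cons.prems(1) i(1)] i(2)] reaches_scons [OF Cons.prems(1) i(1)] by simp
qed simp

lemma descent_node_ball:
  assumes "B \<in> balls X d" "ends (cls B) p"
  shows "\<exists>u. node (cls B) u \<and> descent B p n = node_ball B u"
  using assms
proof (induction n arbitrary: B p)
  case 0
  then show ?case by (intro exI [of _ "[]"]) simp
next
  case (Suc n)
  from Suc.prems(2,1) show ?case
  proof (cases rule: ends_cls_cases)
    case leaf
    then show ?thesis by (intro exI [of _ "[]"]) (simp add: descent_leaf del: descent.simps)
  next
    case (branch i q)
    then obtain u where "node (cls (subs B ! i)) u" "descent (subs B ! i) q n = node_ball (subs B ! i) u"
      using Suc.IH [of "subs B ! i" q] subs_nth(2) [OF Suc.prems(1)] by blast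
    then show ?thesis
      using branch Suc.prems(1)
      by (intro exI [of _ "i # u"]) (simp add: descent_scons length_ch_cls ch_cls_nth del: descent.simps)
  qed
qed

text \<open>Follow the path of a point of \<open>A\<close>. As long as \<open>A\<close> lies
  strictly inside the current ball, it lies in the next one, so if equality never occurred
  \<open>A\<close> would be a lower bound of an endless descent.\<close>

lemma ball_is_node_ball:
  assumes "A \<in> balls X d"
  shows "\<exists>u. node (cls X) u \<and> A = node_ball X u"
proof (rule ccontr)
  assume no: "\<nexists>u. node (cls X) u \<and> A = node_ball X u"
  obtain y where y: "y \<in> A" using ball_nonempty [OF assms] by blast
  then have yX: "y \<in> X" using ball_subset [OF assms] by blast
  define p where "p = (\<lambda>n. code y n X)"
  have p: "ends (cls X) p" "reaches X p y"
    using ends_code [OF space_ball yX] reaches_code [OF space_ball yX] by (simp_all add: p_def)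
  have neq: "A \<noteq> descent X p n" for n
    using descent_node_ball [OF space_ball p(1), of n] no by metis
  have below: "A \<subseteq> descent X p n \<and> subs (descent X p n) \<noteq> []" for n
  proof (induction n)
    case 0
    have "A \<subset> X" using neq [of 0] ball_subset [OF assms] by auto
    then show ?case using y subs_singleton [OF space_ball] by auto
  next
    case (Suc n)
    then have "A \<subset> descent X p n" using neq by blast
    then obtain M where M: "M \<in> sub (descent X p n)" "A \<subseteq> M" using sub_above assms by blast
    note step = descent_step [OF p(1) space_ball, of n]
    have "y \<in> descent X p (Suc n)" using p(2) unfolding reaches_def by blast
    then have "M = descent X p (Suc n)"
      using sub_disjoint [OF M(1) step(1)] Suc y M(2) by blast
    with M(2) have sub': "A \<subset> descent X p (Suc n)" using neq [of "Suc n"] by blast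
    then have "\<nexists>b. descent X p (Suc n) = {b}" using y by auto
    then show ?case
      using sub' subs_singleton [OF descent_ball [OF p(1) space_ball, of "Suc n"]] by auto
  qed
  then show False using descent_no_lower_bound [OF p(1) space_ball assms] by blast
qed

definition \<Psi> :: "(nat \<Rightarrow> nat) \<Rightarrow> 'p" where
  "\<Psi> p = (THE y. reaches X p y)"

lemma \<Psi>: "ends (cls X) p \<Longrightarrow> reaches X p y \<longleftrightarrow> y = \<Psi> p"
  unfolding \<Psi>_def using reaches_exists [OF _ space_ball] reaches_unique [OF _ space_ball] by (metis the_equality)

lemma bij_\<Psi>: "bij_betw \<Psi> (E (cls X)) X"
proof (rule bij_betw_imageI)
  show "inj_on \<Psi> (E (cls X))"
  proof (rule inj_onI)
    fix p q assume pq: "p \<in> E (cls X)" "q \<in> E (cls X)" "\<Psi> p = \<Psi> q"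
    then have "reaches X p (\<Psi> p)" "reaches X q (\<Psi> p)" using \<Psi> by auto
    then show "p = q" using reaches_path_unique [OF space_ball] pq by blast
  qed
  have "\<Psi> p \<in> X" if "ends (cls X) p" for p using \<Psi> that reaches_in by blast
  moreover have "y \<in> \<Psi> ` E (cls X)" if "y \<in> X" for y
    using ends_code [OF space_ball that] reaches_code [OF space_ball that] \<Psi> by blast
  ultimately show "\<Psi> ` E (cls X) = X" by blast
qed

lemma node_ball_image:
  assumes "node (cls X) u"
  shows "\<Psi> ` app u ` E (lbl (cls X) u) = node_ball X u"
proof -
  note nb = node_ball [OF space_ball assms]
  have "\<Psi> (app u r) \<in> node_ball X u" if "ends (lbl (cls X) u) r" for r
    using \<Psi> [of "app u r" "\<Psi> (app u r)"] that assms reaches_app [OF space_ball assms] reaches_in by simp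
  moreover have "y \<in> \<Psi> ` app u ` E (lbl (cls X) u)" if y: "y \<in> node_ball X u" for y
  proof -
    define r where "r = (\<lambda>n. code y n (node_ball X u))"
    have r: "ends (lbl (cls X) u) r" using ends_code [OF nb(1) y] by (simp add: nb(2) r_def)
    have "reaches X (app u r) y" using reaches_code [OF nb(1) y] reaches_app [OF space_ball assms] by (simp add: r_def)
    then have "y = \<Psi> (app u r)" using \<Psi> r assms by simp
    then show ?thesis using r by blast
  qed
  ultimately show ?thesis by blast
qed

text \<open>By \<open>Sim_subs\<close> a similarity maps the descents in \<open>A\<close> to the
  descents in \<open>B\<close> along the same path. Members of \<open>Sim\<close> thus keep the path
  below the ball and change only the prefix leading to it.\<close>

lemma reaches_Sim:
  assumes "A \<in> balls X d" "B \<in> balls X d" "f \<in> Sim A B" "ends (cls A) p" "reaches A p y"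
  shows "reaches B p (f y)"
proof -
  have "f ` descent A p n = descent B p n" for n
    using assms(1-4)
  proof (induction n arbitrary: A B f p)
    case 0
    then show ?case using Sim_bij by (simp add: bij_betw_def)
  next
    case (Suc n)
    note sB = Sim_subs [OF Suc.prems(1-3)]
    from Suc.prems(4,1) show ?case
    proof (cases rule: ends_cls_cases)
      case leaf
      then have "subs B = []" using sB by simp
      then show ?thesis
        using leaf Sim_bij [OF Suc.prems(1-3)] by (simp add: descent_leaf bij_betw_def del: descent.simps)
    next
      case (branch i q)
      let ?M = "subs A ! i"
      note M = subs_nth(2,3) [OF Suc.prems(1) branch(2)]
      have B: "subs B \<noteq> []" "subs B ! i = f ` ?M" using sB branch(1,2) by auto
      have "restrict f ?M \<in> Sim ?M (f ` ?M)" "f ` ?M \<in> balls X d"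
        using sim_restrict [OF Suc.prems(1-3) M(1)] Sim_image_ball [OF Suc.prems(1-3) M(1)] M(2) by auto
      then have "restrict f ?M ` descent ?M q n = descent (f ` ?M) q n"
        using Suc.IH [OF M(1)] branch(4) by blast
      moreover have "descent ?M q n \<subseteq> ?M"
        using descent_antimono [OF branch(4) M(1), of 0 n] by simp
      then have "restrict f ?M ` descent ?M q n = f ` descent ?M q n" by (intro image_cong) auto
      ultimately show ?thesis
        using branch B by (simp add: descent_scons del: descent.simps)
    qed
  qed
  then show ?thesis using assms(5) unfolding reaches_def by blast
qed

text \<open>For the converse inclusion, equal letters mean that some similarity \<open>g\<close>
  between the two balls exists; its values are already prescribed by the paths, so the given prefix
  swap is \<open>g\<close>.\<close>

lemma coded: "coded_sim_space ch (sim_alphabet X d Sim) (sim_relations X d L Sim) (cls X) X d Sim \<Psi>"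
proof unfold_locales
  show "bij_betw \<Psi> (E (cls X)) X" by (rule bij_\<Psi>)
  have "balls X d = node_ball X ` {u. node (cls X) u}"
    using ball_is_node_ball node_ball(1) [OF space_ball] by blast
  also have "\<dots> = (\<lambda>u. \<Psi> ` app u ` E (lbl (cls X) u)) ` {u. node (cls X) u}"
    by (intro image_cong) (simp_all add: node_ball_image)
  finally show "balls X d = (\<lambda>u. \<Psi> ` app u ` E (lbl (cls X) u)) ` {u. node (cls X) u}" .
  fix u v f assume u: "node (cls X) u" and v: "node (cls X) v"
  note nu = node_ball [OF space_ball u] and nv = node_ball [OF space_ball v]
  let ?A = "node_ball X u" and ?B = "node_ball X v"
  have sim_values: "g (\<Psi> (app u r)) = \<Psi> (app v r)" if g: "g \<in> Sim ?A ?B" and r: "ends (lbl (cls X) u) r" for g r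
  proof -
    have eq: "lbl (cls X) u = lbl (cls X) v"
      using cls_eq_iff [OF nu(1) nv(1)] g nu(2) nv(2) by auto
    have "reaches X (app u r) (\<Psi> (app u r))" using \<Psi> u r by simp
    then have "reaches ?A r (\<Psi> (app u r))" using reaches_app [OF space_ball u] by simp
    then have "reaches ?B r (g (\<Psi> (app u r)))" using reaches_Sim [OF nu(1) nv(1) g] r nu(2) by simp
    then have "reaches X (app v r) (g (\<Psi> (app u r)))" using reaches_app [OF space_ball v] by simp
    then show ?thesis using \<Psi> v r eq by simp
  qed
  have "f \<in> Sim ?A ?B \<longleftrightarrow> lbl (cls X) u = lbl (cls X) v \<and> f \<in> extensional ?A \<and>
          (\<forall>r. ends (lbl (cls X) u) r \<longrightarrow> f (\<Psi> (app u r)) = \<Psi> (app v r))"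
  proof
    assume f: "f \<in> Sim ?A ?B"
    then show "lbl (cls X) u = lbl (cls X) v \<and> f \<in> extensional ?A \<and>
          (\<forall>r. ends (lbl (cls X) u) r \<longrightarrow> f (\<Psi> (app u r)) = \<Psi> (app v r))"
      using sim_values [OF f] cls_eq_iff [OF nu(1) nv(1)] nu(2) nv(2) sim_similarity [OF nu(1) nv(1) f]
      by (auto simp: surj_similarity_def)
  next
    assume f: "lbl (cls X) u = lbl (cls X) v \<and> f \<in> extensional ?A \<and>
          (\<forall>r. ends (lbl (cls X) u) r \<longrightarrow> f (\<Psi> (app u r)) = \<Psi> (app v r))"
    then obtain g where g: "g \<in> Sim ?A ?B"
      using cls_eq_iff [OF nu(1) nv(1)] nu(2) nv(2) by auto
    have "f = g"
    proof (rule extensionalityI [of _ ?A])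
      fix y assume "y \<in> ?A"
      then obtain r where "ends (lbl (cls X) u) r" "y = \<Psi> (app u r)"
        using node_ball_image [OF u] by blast
      then show "f y = g y" using f sim_values [OF g] by simp
    qed (use f sim_similarity [OF nu(1) nv(1) g] in \<open>auto simp: surj_similarity_def\<close>)
    then show "f \<in> Sim ?A ?B" using g by simp
  qed
  then show "f \<in> Sim (\<Psi> ` app u ` E (lbl (cls X) u)) (\<Psi> ` app v ` E (lbl (cls X) v)) \<longleftrightarrow>
       lbl (cls X) u = lbl (cls X) v \<and> f \<in> extensional (\<Psi> ` app u ` E (lbl (cls X) u)) \<and>
       (\<forall>r. ends (lbl (cls X) u) r \<longrightarrow> f (\<Psi> (app u r)) = \<Psi> (app v r))"
    by (simp only: node_ball_image [OF u] node_ball_image [OF v])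
qed

theorem Gamma_iso_diagrams:
  "Gamma X d Sim \<cong> braided_diagram_group (sim_alphabet X d Sim) (sim_relations X d L Sim) [cls X]"
proof -
  have "Gamma X d Sim \<cong> swap_group"
    using coded_sim_space.transport_iso [OF coded] swap_group_closed by (rule iso_symI)
  moreover have "swap_group \<cong> braided_diagram_group (sim_alphabet X d Sim) (sim_relations X d L Sim) [cls X]"
    using swap_group_iso by (rule is_isoI)
  ultimately show ?thesis by (rule iso_trans)
qed

end

section \<open>Tree-like presentations as child functions, and the conclusion\<close>

definition children :: "('a list \<times> 'a list) set \<Rightarrow> 'a \<Rightarrow> 'a list" where
  "children R a = (if \<exists>w. ([a], w) \<in> R then THE w. ([a], w) \<in> R else [])"

lemma children_eq: "tree_like R \<Longrightarrow> ([a], w) \<in> R \<Longrightarrow> children R a = w"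
  unfolding children_def tree_like_def by (auto intro: the_equality)

lemma children_cases:
  assumes "tree_like R" shows "children R a = [] \<or> ([a], children R a) \<in> R"
proof (cases "\<exists>w. ([a], w) \<in> R")
  case True
  then obtain w where "([a], w) \<in> R" by blast
  with children_eq [OF assms this] show ?thesis by simp
qed (simp add: children_def)

lemma rooted_presentation_children:
  assumes "semigroup_presentation S R" "tree_like R" "x \<in> S"
  shows "rooted_presentation (children R) S R x"
proof
  fix a u v
  have shape: "\<forall>(u, v)\<in>R. length u = 1 \<and> length v > 1" using assms(2) by (simp add: tree_like_def)
  have long: "length w > 1" if "([a], w) \<in> R" for w using bspec [OF shape that] by simp
  note cases = children_cases [OF assms(2)]
  show "length (children R a) \<noteq> 1" using cases [of a] long by fastforce
  show "(u, v) \<in> R \<longleftrightarrow> (\<exists>a. u = [a] \<and> v = children R a \<and> children R a \<noteq> [])"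
  proof
    assume uv: "(u, v) \<in> R"
    from bspec [OF shape this] have "length u = 1" "length v > 1" by simp_all
    moreover from this obtain b where "u = [b]" by (auto simp: length_Suc_conv)
    ultimately show "\<exists>a. u = [a] \<and> v = children R a \<and> children R a \<noteq> []"
      using children_eq [OF assms(2)] uv by auto
  next
    assume "\<exists>a. u = [a] \<and> v = children R a \<and> children R a \<noteq> []"
    then show "(u, v) \<in> R"
      using cases by auto
  qed
  show "set (children R a) \<subseteq> S"
    using cases [of a] assms(1) by (auto simp: semigroup_presentation_def)
qed (rule assms(3))

theorem theorem9p13:
  shows "(\<forall>(X :: 'p set) d L Sim.
            X \<noteq> {} \<and> small_sim_structure X d L Sim \<longrightarrow>
            Gamma X d Sim \<cong>
              braided_diagram_group (sim_alphabet X d Sim) (sim_relations X d L Sim)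
                [ball_class X d Sim X])
       \<and> (\<forall>(S :: 'a set) R x.
            semigroup_presentation S R \<and> tree_like R \<and> x \<in> S \<longrightarrow>
            (\<exists>(XP :: (nat \<Rightarrow> nat) set) d L Sim.
               XP \<noteq> {} \<and> small_sim_structure XP d L Sim \<and>
               braided_diagram_group S R [x] \<cong> Gamma XP d Sim))"
proof (intro conjI allI impI)
  fix X :: "'p set" and d L Sim
  assume *: "X \<noteq> {} \<and> small_sim_structure X d L Sim"
  then have "ultrametric X d" "finite_sim_structure X d Sim"
    by (simp_all add: small_sim_structure_def lin_ordered_ultrametric_def)
  with * interpret small_sim_space X d Sim L
    by unfold_locales simp_all
  show "Gamma X d Sim \<cong> braided_diagram_group (sim_alphabet X d Sim) (sim_relations X d L Sim) [cls X]"
    by (rule Gamma_iso_diagrams)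
next
  fix S :: "'a set" and R x
  assume "semigroup_presentation S R \<and> tree_like R \<and> x \<in> S"
  then interpret rooted_presentation "children R" S R x
    by (intro rooted_presentation_children) auto
  \<comment> \<open>\<open>upward\<close> leads from swap maps to diagrams, so in this half it is
    the one to be inverted; in the other half it is the coding of points.\<close>
  have "braided_diagram_group S R [x] \<cong> swap_group"
    using swap_group_iso swap_group_closed by (rule iso_symI)
  moreover have "swap_group \<cong> Gamma (E x) path_dist path_sim"
    using coded_sim_space.transport_iso [OF path_space_coded] by (rule is_isoI)
  ultimately have "braided_diagram_group S R [x] \<cong> Gamma (E x) path_dist path_sim" by (rule iso_trans)
  moreover have "E x \<noteq> {}" using ends_zero by blast
  ultimately show "\<exists>(XP :: (nat \<Rightarrow> nat) set) d L Sim.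
      XP \<noteq> {} \<and> small_sim_structure XP d L Sim \<and> braided_diagram_group S R [x] \<cong> Gamma XP d Sim"
    using small_sim_path_space by blast
qed

end
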